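(* Let $n\ge1$ and $p\in\mathbb{C}[z_1,\dots,z_n]$. Let $\mathcal{Q}_p$ be the quotient module of the Bergman space $L_a^2(\mathbb{B}_n)$ determined by the submodule $[p]$, and let $X_p\subset\mathbb{C}^n$ be the associated maximal ideal space (defined in the context). Then $$\overline{Z(p)\cap\mathbb{B}_n}\cap\partial\mathbb{B}_n\ \subseteq\ X_p\ \subseteq\ Z(p)\cap\partial\mathbb{B}_n,$$ where $Z(p)=\{z\in\mathbb{C}^n:p(z)=0\}$.
   Context: $\mathbb{B}_n=\{z\in\mathbb{C}^n:|z|<1\}$; $L_a^2(\mathbb{B}_n)$ is the Hilbert space of analytic functions on $\mathbb{B}_n$ square integrable with respect to normalized Lebesgue measure; $M_f$ is multiplication by $f$. $[p]$ is the closure of $p\,\mathbb{C}[z_1,\dots,z_n]$ in $L_a^2(\mathbb{B}_n)$. The quotient module $\mathcal{Q}_p=L_a^2(\mathbb{B}_n)/[p]$ is identified with the orthogonal complement $L_a^2(\mathbb{B}_n)\ominus[p]$, and for a polynomial $f$, $Q_f$ is the compression of $M_f$ to $\mathcal{Q}_p$. $\mathcal{T}(\mathcal{Q}_p)$ is the $C^*$-algebra of operators on $\mathcal{Q}_p$ generated by $\{Q_f:f\in\mathbb{C}[z_1,\dots,z_n]\}$ and $\mathcal{K}(\mathcal{Q}_p)$ is the ideal of compact operators on $\mathcal{Q}_p$. All commutators $[Q_f,Q_g^*]$ ($f,g$ polynomials) are compact, so $\mathcal{T}(\mathcal{Q}_p)/\mathcal{K}(\mathcal{Q}_p)$ (the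 image of $\mathcal{T}(\mathcal{Q}_p)$ in the Calkin algebra) is a commutative $C^*$-algebra, isometrically isomorphic to $C(X_p)$ for a compact metrizable space $X_p$. Via the image of $(Q_{z_1},\dots,Q_{z_n})$ in this algebra, $X_p$ is identified with a subset of $\mathbb{C}^n$, namely the set of points $(\chi(\pi(Q_{z_1})),\dots,\chi(\pi(Q_{z_n})))$ with $\chi$ a character of the quotient algebra and $\pi$ the quotient map. *)

theory Defs
  imports "HOL-Analysis.Analysis" "HOL-Library.Poly_Mapping"
begin

section \<open>Polynomials on complex n-space\<close>

text \<open>
  The variables are indexed by a finite type, so \<open>\<complex>\<^sup>n\<close> is \<^typ>\<open>complex ^ 'n\<close> with
  \<open>n = CARD('n)\<close>. A polynomial maps finitely many monomials (exponent vectors) to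
  nonzero coefficients; addition and multiplication are those of \<^theory>\<open>HOL-Library.Poly_Mapping\<close>.
\<close>

type_synonym 'n cpoly = "('n \<Rightarrow>\<^sub>0 nat) \<Rightarrow>\<^sub>0 complex"

definition peval :: "('n::finite) cpoly \<Rightarrow> complex ^ 'n \<Rightarrow> complex" where
  "peval p z = (\<Sum>m\<in>Poly_Mapping.keys p.
      Poly_Mapping.lookup p m * (\<Prod>i\<in>UNIV. (z $ i) ^ Poly_Mapping.lookup m i))"

definition pvar :: "'n \<Rightarrow> ('n::finite) cpoly" where
  "pvar i = Poly_Mapping.single (Poly_Mapping.single i 1) 1"

definition zero_set :: "('n::finite) cpoly \<Rightarrow> (complex ^ 'n) set" where
  "zero_set p = {z. peval p z = 0}"

lemma peval_pvar: "peval (pvar i) z = z $ i"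
proof -
  have "(\<Prod>j\<in>UNIV. (z $ j) ^ Poly_Mapping.lookup (Poly_Mapping.single i (1::nat)) j)
      = (\<Prod>j\<in>UNIV. if j = i then z $ j else 1)"
    by (rule prod.cong) (auto simp: lookup_single when_def)
  then show ?thesis
    by (simp add: peval_def pvar_def)
qed


section \<open>The Bergman space of the unit ball\<close>

text \<open>Analyticity is complex Frechet differentiability: the real derivative exists and is complex linear.\<close>

definition analytic_on_ball :: "(complex ^ ('n::finite) \<Rightarrow> complex) \<Rightarrow> bool" where
  "analytic_on_ball f \<longleftrightarrow>
     (\<forall>z\<in>ball 0 1. \<exists>D. (f has_derivative D) (at z) \<and> (\<forall>c v. D (c *s v) = c * D v))"

definition ball_measure :: "(complex ^ ('n::finite)) measure" where
  "ball_measure = uniform_measure lborel (ball 0 1)"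

lemma analytic_on_ball_const: "analytic_on_ball (\<lambda>z. c)"
  unfolding analytic_on_ball_def by (auto intro!: exI[of _ "\<lambda>v. 0"])

lemma analytic_on_ball_nth: "analytic_on_ball (\<lambda>z. z $ i)"
  unfolding analytic_on_ball_def
  by (auto intro!: exI[of _ "\<lambda>v. v $ i"] bounded_linear_imp_has_derivative bounded_linear_vec_nth)

lemma analytic_on_ball_add:
  assumes "analytic_on_ball f" "analytic_on_ball g"
  shows "analytic_on_ball (\<lambda>z. f z + g z)"
  unfolding analytic_on_ball_def
proof
  fix z :: "complex ^ 'a" assume z: "z \<in> ball 0 1"
  obtain D E where "(f has_derivative D) (at z)" "\<forall>c v. D (c *s v) = c * D v"
    "(g has_derivative E) (at z)" "\<forall>c v. E (c *s v) = c * E v"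
    using assms z unfolding analytic_on_ball_def by meson
  then show "\<exists>D. ((\<lambda>z. f z + g z) has_derivative D) (at z) \<and> (\<forall>c v. D (c *s v) = c * D v)"
    by (intro exI[of _ "\<lambda>v. D v + E v"]) (auto intro!: has_derivative_add simp: algebra_simps)
qed

lemma analytic_on_ball_mult:
  assumes "analytic_on_ball f" "analytic_on_ball g"
  shows "analytic_on_ball (\<lambda>z. f z * g z)"
  unfolding analytic_on_ball_def
proof
  fix z :: "complex ^ 'a" assume z: "z \<in> ball 0 1"
  obtain D E where "(f has_derivative D) (at z)" "\<forall>c v. D (c *s v) = c * D v"
    "(g has_derivative E) (at z)" "\<forall>c v. E (c *s v) = c * E v"
    using assms z unfolding analytic_on_ball_def by meson
  then show "\<exists>D. ((\<lambda>z. f z * g z) has_derivative D) (at z) \<and> (\<forall>c v. D (c *s v) = c * D v)"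
    by (intro exI[of _ "\<lambda>v. f z * E v + D v * g z"] conjI has_derivative_mult)
       (auto simp: algebra_simps)
qed

lemma analytic_on_ball_sum:
  "(\<And>i. i \<in> A \<Longrightarrow> analytic_on_ball (f i)) \<Longrightarrow> analytic_on_ball (\<lambda>z. \<Sum>i\<in>A. f i z)"
  by (induction A rule: infinite_finite_induct)
     (auto intro: analytic_on_ball_const analytic_on_ball_add)

lemma analytic_on_ball_prod:
  "(\<And>i. i \<in> A \<Longrightarrow> analytic_on_ball (f i)) \<Longrightarrow> analytic_on_ball (\<lambda>z. \<Prod>i\<in>A. f i z)"
  by (induction A rule: infinite_finite_induct)
     (auto intro: analytic_on_ball_const analytic_on_ball_mult)

lemma analytic_on_ball_power:
  "analytic_on_ball f \<Longrightarrow> analytic_on_ball (\<lambda>z. f z ^ k)"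
  by (induction k) (auto intro: analytic_on_ball_const analytic_on_ball_mult)

lemma analytic_on_ball_peval: "analytic_on_ball (peval p)"
  unfolding peval_def
  by (intro analytic_on_ball_sum analytic_on_ball_mult analytic_on_ball_const
      analytic_on_ball_prod analytic_on_ball_power analytic_on_ball_nth)

lemma analytic_on_ball_cong:
  assumes "analytic_on_ball f" "\<And>z. z \<in> ball 0 1 \<Longrightarrow> f z = g z"
  shows "analytic_on_ball g"
  using assms unfolding analytic_on_ball_def
  by (meson has_derivative_transform_within_open open_ball)

lemma analytic_on_ball_continuous:
  "analytic_on_ball f \<Longrightarrow> continuous_on (ball 0 1) f"
  unfolding analytic_on_ball_def
  by (meson continuous_at_imp_continuous_on has_derivative_continuous)

lemma analytic_on_ball_measurable:
  fixes f :: "complex ^ ('n::finite) \<Rightarrow> complex"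
  assumes "analytic_on_ball f" "\<And>z. z \<notin> ball 0 1 \<Longrightarrow> f z = 0"
  shows "f \<in> borel_measurable ball_measure"
proof -
  have "(\<lambda>z. indicator (ball 0 1) z *\<^sub>R f z) \<in> borel_measurable borel"
    using analytic_on_ball_continuous[OF assms(1)]
    by (intro borel_measurable_continuous_on_indicator) auto
  moreover have "(\<lambda>z. indicator (ball 0 1) z *\<^sub>R f z) = f"
    using assms(2) by (force simp: indicator_def)
  moreover have "borel_measurable (ball_measure :: (complex ^ 'n) measure) =
      (borel_measurable borel :: (complex ^ 'n \<Rightarrow> complex) set)"
    by (rule measurable_cong_sets) (auto simp: ball_measure_def)
  ultimately show ?thesis by simp
qed

lemma emeasure_lborel_ball_pos:
  "emeasure lborel (ball (0::complex ^ ('n::finite)) 1) \<noteq> 0"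
proof
  assume "emeasure lborel (ball (0::complex ^ 'n) 1) = 0"
  then have "ball (0::complex ^ 'n) 1 \<in> null_sets lborel" by auto
  then have "negligible (ball (0::complex ^ 'n) 1)"
    by (simp add: negligible_iff_null_sets null_sets_completionI)
  then show False
    by (metis negligible_empty open_ball open_not_negligible ball_eq_empty not_one_le_zero)
qed

lemma AE_ball_measure:
  fixes P :: "complex ^ ('n::finite) \<Rightarrow> bool"
  shows "(AE z in ball_measure. P z) \<longleftrightarrow> (AE z in lborel. z \<in> ball 0 1 \<longrightarrow> P z)"
  unfolding ball_measure_def
  using emeasure_lborel_ball_pos emeasure_lborel_ball_finite
  by (intro AE_uniform_measure) auto

text \<open>
  Elements of the Bergman space are represented by their extension by \<open>0\<close> to all of
  \<^typ>\<open>complex ^ 'n\<close>, which makes the representing function unique.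
\<close>

typedef ('n::finite) bergman =
  "{f :: complex ^ 'n \<Rightarrow> complex. analytic_on_ball f \<and> (\<forall>z. z \<notin> ball 0 1 \<longrightarrow> f z = 0) \<and>
      integrable ball_measure (\<lambda>z. (cmod (f z))\<^sup>2)}"
  by (rule exI[of _ "\<lambda>z. 0"]) (auto intro: analytic_on_ball_const)

setup_lifting type_definition_bergman

lemma integrable_sq_add:
  fixes f g :: "complex ^ ('n::finite) \<Rightarrow> complex"
  assumes "f \<in> borel_measurable ball_measure" "g \<in> borel_measurable ball_measure"
    "integrable ball_measure (\<lambda>z. (cmod (f z))\<^sup>2)"
    "integrable ball_measure (\<lambda>z. (cmod (g z))\<^sup>2)"
  shows "integrable ball_measure (\<lambda>z. (cmod (f z + g z))\<^sup>2)"
proof (rule Bochner_Integration.integrable_bound)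
  show "integrable ball_measure (\<lambda>z. 2 * (cmod (f z))\<^sup>2 + 2 * (cmod (g z))\<^sup>2)"
    using assms by auto
  show "(\<lambda>z. (cmod (f z + g z))\<^sup>2) \<in> borel_measurable ball_measure"
    using assms by measurable
  have "(cmod (a + b))\<^sup>2 \<le> 2 * (cmod a)\<^sup>2 + 2 * (cmod b)\<^sup>2" for a b :: complex
  proof -
    have "(cmod (a + b))\<^sup>2 \<le> (cmod a + cmod b)\<^sup>2"
      by (simp add: norm_triangle_ineq power_mono)
    also have "\<dots> \<le> 2 * (cmod a)\<^sup>2 + 2 * (cmod b)\<^sup>2"
      using sum_squares_bound[of "cmod a" "cmod b"] by (simp add: power2_sum)
    finally show ?thesis .
  qed
  then show "AE z in ball_measure. norm ((cmod (f z + g z))\<^sup>2)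
      \<le> norm (2 * (cmod (f z))\<^sup>2 + 2 * (cmod (g z))\<^sup>2)"
    by auto
qed

lemma integrable_mult_cnj:
  fixes f g :: "complex ^ ('n::finite) \<Rightarrow> complex"
  assumes "f \<in> borel_measurable ball_measure" "g \<in> borel_measurable ball_measure"
    "integrable ball_measure (\<lambda>z. (cmod (f z))\<^sup>2)"
    "integrable ball_measure (\<lambda>z. (cmod (g z))\<^sup>2)"
  shows "integrable ball_measure (\<lambda>z. f z * cnj (g z))"
proof (rule Bochner_Integration.integrable_bound)
  show "integrable ball_measure (\<lambda>z. (cmod (f z))\<^sup>2 + (cmod (g z))\<^sup>2)"
    using assms by auto
  have "(\<lambda>z. cnj (g z)) \<in> borel_measurable ball_measure"
    using assms(2) by (intro borel_measurable_continuous_on[OF _ assms(2)] continuous_intros)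
  then show "(\<lambda>z. f z * cnj (g z)) \<in> borel_measurable ball_measure"
    using assms(1) by measurable
  have "cmod a * cmod b \<le> (cmod a)\<^sup>2 + (cmod b)\<^sup>2" for a b :: complex
  proof -
    have "2 * (cmod a * cmod b) \<le> (cmod a)\<^sup>2 + (cmod b)\<^sup>2"
      using sum_squares_bound[of "cmod a" "cmod b"] by (simp add: mult.assoc)
    moreover have "0 \<le> cmod a * cmod b" by simp
    ultimately show ?thesis by linarith
  qed
  then show "AE z in ball_measure. norm (f z * cnj (g z)) \<le> norm ((cmod (f z))\<^sup>2 + (cmod (g z))\<^sup>2)"
    by (auto simp: norm_mult)
qed

lift_definition bergman_cscale :: "complex \<Rightarrow> ('n::finite) bergman \<Rightarrow> 'n bergman"
  is "\<lambda>c f z. c * f z"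
  by (auto intro: analytic_on_ball_mult analytic_on_ball_const simp: norm_mult power_mult_distrib)

lemma bounded_peval: "\<exists>B. \<forall>z\<in>ball 0 1. cmod (peval p z) \<le> B"
proof -
  have "continuous_on (cball 0 1) (peval p)"
    unfolding peval_def by (intro continuous_intros)
  then have "bounded (peval p ` cball 0 1)"
    by (intro compact_imp_bounded compact_continuous_image) auto
  then show ?thesis
    unfolding bounded_iff by force
qed

text \<open>The multiplication operator \<open>M\<^sub>f\<close> for a polynomial \<open>f\<close>.\<close>

lift_definition bergman_mult :: "('n::finite) cpoly \<Rightarrow> 'n bergman \<Rightarrow> 'n bergman"
  is "\<lambda>p f z. peval p z * f z"
proof -
  fix p :: "'n cpoly" and f :: "complex ^ 'n \<Rightarrow> complex"
  assume f: "analytic_on_ball f \<and> (\<forall>z. z \<notin> ball 0 1 \<longrightarrow> f z = 0) \<and>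
      integrable ball_measure (\<lambda>z. (cmod (f z))\<^sup>2)"
  then have a: "analytic_on_ball (\<lambda>z. peval p z * f z)"
    by (intro analytic_on_ball_mult analytic_on_ball_peval) auto
  obtain B where B: "\<And>z. z \<in> ball 0 1 \<Longrightarrow> cmod (peval p z) \<le> B"
    using bounded_peval by blast
  have "integrable ball_measure (\<lambda>z. (cmod (peval p z * f z))\<^sup>2)"
  proof (rule Bochner_Integration.integrable_bound)
    show "integrable ball_measure (\<lambda>z. B\<^sup>2 * (cmod (f z))\<^sup>2)" using f by auto
    show "(\<lambda>z. (cmod (peval p z * f z))\<^sup>2) \<in> borel_measurable ball_measure"
    proof -
      have "(\<lambda>z. peval p z * f z) \<in> borel_measurable ball_measure"
        using f by (intro analytic_on_ball_measurable[OF a]) simp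
      then show ?thesis by measurable
    qed
    have "(cmod (peval p z * f z))\<^sup>2 \<le> B\<^sup>2 * (cmod (f z))\<^sup>2" for z
    proof (cases "z \<in> ball 0 1")
      case True
      then show ?thesis using B[of z]
        by (auto simp: norm_mult power_mult_distrib intro!: mult_right_mono power_mono)
    qed (use f in auto)
    then show "AE z in ball_measure. norm ((cmod (peval p z * f z))\<^sup>2) \<le> norm (B\<^sup>2 * (cmod (f z))\<^sup>2)"
      by auto
  qed
  then show "analytic_on_ball (\<lambda>z. peval p z * f z) \<and>
      (\<forall>z. z \<notin> ball 0 1 \<longrightarrow> peval p z * f z = 0) \<and>
      integrable ball_measure (\<lambda>z. (cmod (peval p z * f z))\<^sup>2)"
    using a f by auto
qed

lift_definition bergman_cinner :: "('n::finite) bergman \<Rightarrow> 'n bergman \<Rightarrow> complex"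
  is "\<lambda>f g. LINT z|ball_measure. f z * cnj (g z)" .

lift_definition bergman_one :: "('n::finite) bergman" is "\<lambda>z. if z \<in> ball 0 1 then 1 else 0"
proof -
  have a: "analytic_on_ball (\<lambda>z::complex ^ 'n. if z \<in> ball 0 1 then 1 else 0)"
    by (rule analytic_on_ball_cong[OF analytic_on_ball_const[of 1]]) auto
  interpret finite_measure "ball_measure :: (complex ^ 'n) measure"
    using emeasure_lborel_ball_finite[of "0::complex ^ 'n" 1]
      emeasure_lborel_ball_pos[where 'n = 'n]
    by (intro finite_measureI) (auto simp: ball_measure_def divide_ennreal_def ennreal_mult_eq_top_iff)
  have "integrable ball_measure (\<lambda>z::complex ^ 'n. (cmod (if z \<in> ball 0 1 then 1 else 0))\<^sup>2)"
    by (rule integrable_const_bound[of _ 1]) (use analytic_on_ball_measurable[OF a] in \<open>auto\<close>)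
  then show "?thesis" using a by auto
qed

instantiation bergman :: (finite) real_vector
begin

lift_definition zero_bergman :: "'a bergman" is "\<lambda>z. 0"
  by (auto intro: analytic_on_ball_const)

lift_definition plus_bergman :: "'a bergman \<Rightarrow> 'a bergman \<Rightarrow> 'a bergman" is "\<lambda>f g z. f z + g z"
  by (intro conjI analytic_on_ball_add integrable_sq_add analytic_on_ball_measurable) simp_all

definition scaleR_bergman :: "real \<Rightarrow> 'a bergman \<Rightarrow> 'a bergman" where
  "scaleR_bergman r f = bergman_cscale (of_real r) f"

definition uminus_bergman :: "'a bergman \<Rightarrow> 'a bergman" where
  "uminus_bergman f = bergman_cscale (-1) f"

definition minus_bergman :: "'a bergman \<Rightarrow> 'a bergman \<Rightarrow> 'a bergman" where
  "minus_bergman f g = f + (- g)"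

instance
proof
  fix f g h :: "'a bergman" and r s :: real
  show "f + g + h = f + (g + h)" by transfer (simp add: add.assoc)
  show "f + g = g + f" by transfer (simp add: add.commute)
  show "0 + f = f" by transfer simp
  show "- f + f = 0" unfolding uminus_bergman_def by transfer simp
  show "f - g = f + - g" by (simp add: minus_bergman_def)
  show "r *\<^sub>R (f + g) = r *\<^sub>R f + r *\<^sub>R g"
    unfolding scaleR_bergman_def by transfer (simp add: algebra_simps)
  show "(r + s) *\<^sub>R f = r *\<^sub>R f + s *\<^sub>R f"
    unfolding scaleR_bergman_def by transfer (simp add: algebra_simps)
  show "r *\<^sub>R s *\<^sub>R f = (r * s) *\<^sub>R f"
    unfolding scaleR_bergman_def by transfer (simp add: algebra_simps)
  show "1 *\<^sub>R f = f" unfolding scaleR_bergman_def by transfer simp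
qed

end

instantiation bergman :: (finite) real_inner
begin

definition inner_bergman :: "'a bergman \<Rightarrow> 'a bergman \<Rightarrow> real" where
  "inner_bergman f g = Re (bergman_cinner f g)"

definition norm_bergman :: "'a bergman \<Rightarrow> real" where
  "norm_bergman f = sqrt (inner f f)"

definition dist_bergman :: "'a bergman \<Rightarrow> 'a bergman \<Rightarrow> real" where
  "dist_bergman f g = norm (f - g)"

definition sgn_bergman :: "'a bergman \<Rightarrow> 'a bergman" where
  "sgn_bergman f = f /\<^sub>R norm f"

definition uniformity_bergman :: "('a bergman \<times> 'a bergman) filter" where
  "uniformity_bergman = (INF e\<in>{0<..}. principal {(f, g). dist f g < e})"

definition open_bergman :: "'a bergman set \<Rightarrow> bool" where
  "open_bergman U \<longleftrightarrow> (\<forall>f\<in>U. \<forall>\<^sub>F (f', g) in uniformity. f' = f \<longrightarrow> g \<in> U)"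

instance
proof
  fix f g h :: "'a bergman" and r :: real
  have int: "integrable ball_measure (\<lambda>z. Rep_bergman u z * cnj (Rep_bergman v z))"
    for u v :: "'a bergman"
    using Rep_bergman[of u] Rep_bergman[of v]
    by (intro integrable_mult_cnj analytic_on_ball_measurable) simp_all
  show "sgn f = f /\<^sub>R norm f" by (simp add: sgn_bergman_def)
  show "dist f g = norm (f - g)" by (simp add: dist_bergman_def)
  show "uniformity = (INF e\<in>{0<..}. principal {(f::'a bergman, g). dist f g < e})"
    by (simp add: uniformity_bergman_def)
  show "open U \<longleftrightarrow> (\<forall>f\<in>U. \<forall>\<^sub>F (f', g) in uniformity. f' = f \<longrightarrow> g \<in> U)" for U :: "'a bergman set"
    by (simp add: open_bergman_def)
  show "norm f = sqrt (inner f f)" by (simp add: norm_bergman_def)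
  show "inner f g = inner g f"
  proof -
    have "bergman_cinner f g = cnj (bergman_cinner g f)"
      unfolding bergman_cinner.rep_eq by (subst Bochner_Integration.integral_cnj[symmetric]) (simp add: mult.commute)
    then show ?thesis by (simp add: inner_bergman_def)
  qed
  show "inner (f + g) h = inner f h + inner g h"
    by (simp add: inner_bergman_def bergman_cinner.rep_eq plus_bergman.rep_eq distrib_right int)
  show "inner (r *\<^sub>R f) g = r * inner f g"
    by (simp add: inner_bergman_def bergman_cinner.rep_eq scaleR_bergman_def bergman_cscale.rep_eq
        mult.assoc)
  have sq: "inner f f = (LINT z|ball_measure. (cmod (Rep_bergman f z))\<^sup>2)"
  proof -
    have "bergman_cinner f f = (LINT z|ball_measure. complex_of_real ((cmod (Rep_bergman f z))\<^sup>2))"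
      unfolding bergman_cinner.rep_eq complex_norm_square by simp
    also have "\<dots> = complex_of_real (LINT z|ball_measure. (cmod (Rep_bergman f z))\<^sup>2)"
      by (rule integral_complex_of_real)
    finally show ?thesis by (simp add: inner_bergman_def)
  qed
  show "0 \<le> inner f f" unfolding sq by (rule integral_nonneg_AE) auto
  show "inner f f = 0 \<longleftrightarrow> f = 0"
  proof
    assume "inner f f = 0"
    then have "AE z in ball_measure. (cmod (Rep_bergman f z))\<^sup>2 = 0"
      unfolding sq using Rep_bergman[of f] by (subst (asm) integral_nonneg_eq_0_iff_AE) auto
    then have ae: "AE z in lborel. \<not> (z \<in> ball 0 1 \<and> Rep_bergman f z \<noteq> 0)"
      unfolding AE_ball_measure by simp
    define S where "S = {z \<in> ball 0 1. Rep_bergman f z \<noteq> 0}"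
    have "continuous_on (ball 0 1) (Rep_bergman f)"
      using Rep_bergman[of f] by (auto intro: analytic_on_ball_continuous)
    then have "open (ball 0 1 \<inter> Rep_bergman f -` (- {0}))"
      by (intro continuous_open_preimage) auto
    moreover have "ball 0 1 \<inter> Rep_bergman f -` (- {0}) = S" by (auto simp: S_def)
    ultimately have S: "open S" by simp
    have "S \<in> null_sets lborel"
      using ae S by (subst (asm) AE_iff_null) (auto simp: S_def)
    then have "negligible S"
      by (simp add: negligible_iff_null_sets null_sets_completionI)
    then have "S = {}" using S open_not_negligible by blast
    then have "Rep_bergman f z = 0" for z
      using Rep_bergman[of f] by (cases "z \<in> ball 0 1") (auto simp: S_def)
    then have "Rep_bergman f = Rep_bergman 0" by (auto simp: zero_bergman.rep_eq)
    then show "f = 0" by (simp add: Rep_bergman_inject)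
  next
    assume "f = 0"
    then show "inner f f = 0" unfolding sq by (simp add: zero_bergman.rep_eq)
  qed
qed

end

lemma norm_bergman_eq:
  "norm f = sqrt (LINT z|ball_measure. (cmod (Rep_bergman f z))\<^sup>2)"
proof -
  have "bergman_cinner f f = (LINT z|ball_measure. complex_of_real ((cmod (Rep_bergman f z))\<^sup>2))"
    unfolding bergman_cinner.rep_eq complex_norm_square by simp
  also have "\<dots> = complex_of_real (LINT z|ball_measure. (cmod (Rep_bergman f z))\<^sup>2)"
    by (rule integral_complex_of_real)
  finally show ?thesis by (simp add: norm_bergman_def inner_bergman_def)
qed

lemma norm_bergman_cscale: "norm (bergman_cscale c f) = cmod c * norm f"
  by (simp add: norm_bergman_eq bergman_cscale.rep_eq norm_mult power_mult_distrib real_sqrt_mult)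

lemma bounded_linear_bergman_cscale: "bounded_linear (bergman_cscale c)"
proof (rule bounded_linear_intro[where K = "cmod c"])
  fix f g :: "'a bergman" and r :: real
  show "bergman_cscale c (f + g) = bergman_cscale c f + bergman_cscale c g"
    by transfer (simp add: distrib_left)
  show "bergman_cscale c (r *\<^sub>R f) = r *\<^sub>R bergman_cscale c f"
    unfolding scaleR_bergman_def by transfer (simp add: mult.left_commute)
  show "norm (bergman_cscale c f) \<le> norm f * cmod c"
    by (simp add: norm_bergman_cscale)
qed


section \<open>The quotient module and its operators\<close>

definition submodule :: "('n::finite) cpoly \<Rightarrow> 'n bergman set" where
  "submodule p = closure (range (\<lambda>q. bergman_mult (p * q) bergman_one))"

definition quotient_module :: "('n::finite) cpoly \<Rightarrow> 'n bergman set" where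
  "quotient_module p = {h. \<forall>g\<in>submodule p. bergman_cinner h g = 0}"

definition orth_proj :: "('n::finite) bergman set \<Rightarrow> 'n bergman \<Rightarrow> 'n bergman" where
  "orth_proj Q h = (THE g. g \<in> Q \<and> (\<forall>k\<in>Q. bergman_cinner (h - g) k = 0))"

type_synonym 'n operator = "'n bergman \<Rightarrow>\<^sub>L 'n bergman"

definition op_cscale :: "complex \<Rightarrow> ('n::finite) operator \<Rightarrow> 'n operator" where
  "op_cscale c T = Blinfun (\<lambda>h. bergman_cscale c (blinfun_apply T h))"

lemma blinfun_apply_op_cscale: "blinfun_apply (op_cscale c T) h = bergman_cscale c (blinfun_apply T h)"
  unfolding op_cscale_def
  by (subst bounded_linear_Blinfun_apply)
     (auto intro!: bounded_linear_compose[OF bounded_linear_bergman_cscale] blinfun.bounded_linear_right)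

text \<open>
  A bounded operator on a closed subspace \<open>Q\<close> is represented by its extension by \<open>0\<close> on the
  orthogonal complement of \<open>Q\<close>; this identification is isometric and respects sums, products
  and adjoints. The identity of \<open>Q\<close> becomes the orthogonal projection onto \<open>Q\<close>. As
  \<^typ>\<open>'a \<Rightarrow>\<^sub>L 'b\<close> only provides real linearity, complex homogeneity is required explicitly.
\<close>

definition bounded_ops :: "('n::finite) bergman set \<Rightarrow> 'n operator set" where
  "bounded_ops Q = {T.
     (\<forall>c h. blinfun_apply T (bergman_cscale c h) = bergman_cscale c (blinfun_apply T h)) \<and>
     (\<forall>h\<in>Q. blinfun_apply T h \<in> Q) \<and>
     (\<forall>h. (\<forall>g\<in>Q. bergman_cinner h g = 0) \<longrightarrow> blinfun_apply T h = 0)}"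

definition compact_ops :: "('n::finite) bergman set \<Rightarrow> 'n operator set" where
  "compact_ops Q = {T \<in> bounded_ops Q. compact (closure (blinfun_apply T ` (Q \<inter> cball 0 1)))}"

text \<open>\<open>compression Q f\<close> is \<open>h \<mapsto> P (f h)\<close> on \<open>Q\<close> and \<open>0\<close> on its complement, \<open>P\<close> being the projection onto \<open>Q\<close>.\<close>

definition compression :: "('n::finite) bergman set \<Rightarrow> 'n cpoly \<Rightarrow> 'n operator" where
  "compression Q f = Blinfun (\<lambda>h. orth_proj Q (bergman_mult f (orth_proj Q h)))"

definition cstar_subalgebra :: "('n::finite) bergman set \<Rightarrow> 'n operator set \<Rightarrow> bool" where
  "cstar_subalgebra Q A \<longleftrightarrow>
     A \<subseteq> bounded_ops Q \<and> closed A \<and> 0 \<in> A \<and>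
     (\<forall>S\<in>A. \<forall>T\<in>A. S + T \<in> A) \<and>
     (\<forall>c. \<forall>T\<in>A. op_cscale c T \<in> A) \<and>
     (\<forall>S\<in>A. \<forall>T\<in>A. S o\<^sub>L T \<in> A) \<and>
     (\<forall>T\<in>A. \<exists>T'\<in>A. \<forall>g\<in>Q. \<forall>h\<in>Q.
        bergman_cinner (blinfun_apply T g) h = bergman_cinner g (blinfun_apply T' h))"

definition toeplitz_algebra :: "('n::finite) cpoly \<Rightarrow> 'n operator set" where
  "toeplitz_algebra p = \<Inter>{A. cstar_subalgebra (quotient_module p) A \<and>
     range (compression (quotient_module p)) \<subseteq> A}"


section \<open>The image in the Calkin algebra and its characters\<close>

definition calkin_class :: "('n::finite) bergman set \<Rightarrow> 'n operator \<Rightarrow> 'n operator set" where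
  "calkin_class Q T = {S \<in> bounded_ops Q. S - T \<in> compact_ops Q}"

text \<open>
  Characters of the quotient algebra, i.e. nonzero multiplicative linear functionals on
  \<open>calkin_class Q ` toeplitz_algebra p\<close>. The operations of the quotient are those induced on classes by
  representatives, e.g. \<open>\<pi>(S) \<pi>(T) = \<pi>(S T)\<close>. The values of \<open>\<phi>\<close> at other sets are irrelevant.
\<close>

definition is_character :: "('n::finite) cpoly \<Rightarrow> ('n operator set \<Rightarrow> complex) \<Rightarrow> bool" where
  "is_character p \<phi> \<longleftrightarrow>
     (let \<T> = toeplitz_algebra p; \<pi> = calkin_class (quotient_module p) in
       (\<forall>S\<in>\<T>. \<forall>T\<in>\<T>. \<phi> (\<pi> (S + T)) = \<phi> (\<pi> S) + \<phi> (\<pi> T)) \<and>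
       (\<forall>c. \<forall>T\<in>\<T>. \<phi> (\<pi> (op_cscale c T)) = c * \<phi> (\<pi> T)) \<and>
       (\<forall>S\<in>\<T>. \<forall>T\<in>\<T>. \<phi> (\<pi> (S o\<^sub>L T)) = \<phi> (\<pi> S) * \<phi> (\<pi> T)) \<and>
       (\<exists>T\<in>\<T>. \<phi> (\<pi> T) \<noteq> 0))"

definition maximal_ideal_space :: "('n::finite) cpoly \<Rightarrow> (complex ^ 'n) set" where
  "maximal_ideal_space p =
     {z. \<exists>\<phi>. is_character p \<phi> \<and>
       (\<forall>i. z $ i = \<phi> (calkin_class (quotient_module p) (compression (quotient_module p) (pvar i))))}"

end

theory Submission
  imports Defs "HOL-Complex_Analysis.Complex_Analysis"
begin

text \<open>
  Write \<open>Q\<close> for the quotient module, \<open>Q\<^sub>f\<close> for the compression of the multiplication operator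
  \<open>M\<^sub>f\<close> to \<open>Q\<close> and \<open>M\<^sub>i\<close> for multiplication by the \<open>i\<close>-th coordinate. Since \<open>[p]\<close> is
  invariant under multiplication by polynomials, \<open>Q\<close> is invariant under all \<open>M\<^sub>f\<^sup>*\<close>, so
  \<open>Q\<^sub>f\<^sup>*\<close> is the restriction of \<open>M\<^sub>f\<^sup>*\<close> and \<open>f \<mapsto> Q\<^sub>f\<close> is multiplicative.
  Both inclusions rest on the reproducing kernels \<open>K\<^sub>w\<close>, which are joint eigenvectors:
  \<open>M\<^sub>f\<^sup>* K\<^sub>w\<close> is \<open>K\<^sub>w\<close> times the conjugate of \<open>f(w)\<close>.
  The kernel \<open>K\<^sub>w\<close> lies in \<open>Q\<close> if \<open>p(w) = 0\<close>.

  The first inclusion. Let \<open>w\<close> run through zeros of \<open>p\<close> in the ball that tend to a boundary point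
  \<open>z\<close>, and let \<open>u\<^sub>w\<close> be the normalized kernel. From \<open>\<Sum>\<^sub>i |z\<^sub>i|\<^sup>2 < 1\<close> on the ball one gets
  \<open>\<Sum>\<^sub>i \<parallel>(M\<^sub>i - w\<^sub>i) u\<^sub>w\<parallel>\<^sup>2 \<le> 1 - |w|\<^sup>2\<close>, which tends to \<open>0\<close>. So the \<open>u\<^sub>w\<close> are
  approximate eigenvectors of all \<open>Q\<^sub>f\<close> and all \<open>Q\<^sub>f\<^sup>*\<close>. The operators for which they are
  approximate eigenvectors, together with the adjoint, form a \<open>C\<^sup>*\<close>-algebra, which therefore contains
  the algebra generated by the compressions, and the approximate eigenvalue is multiplicative. It vanishes on
  compact operators, because no subsequence of the \<open>u\<^sub>w\<close> converges: a limit would be annihilated by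
  multiplication with all the functions \<open>x\<^sub>i - z\<^sub>i\<close> of the variable \<open>x\<close>
  (\<open>zero_set_boundary_subset\<close>).

  The second inclusion. A character is a multiplicative functional \<open>\<chi>\<close> on the operator algebra that
  vanishes on compact operators; it is automatically contractive (\<open>chi_norm_le\<close>). It is evaluation at
  a point \<open>w\<close> on the compressions of polynomials. Since polynomials are dense in the
  Bergman space, \<open>Q\<^sub>p = 0\<close>, so \<open>p(w) = 0\<close>; contractivity gives \<open>|w| \<le> 1\<close>. Suppose that
  \<open>|w| < 1\<close>. Then \<open>B = \<Sum>\<^sub>i (Q\<^sub>i - w\<^sub>i) (Q\<^sub>i - w\<^sub>i)\<^sup>*\<close> satisfies \<open>\<chi>(B) = 0\<close>. It annihilates
  \<open>K\<^sub>w\<close>, which lies in \<open>Q\<close>, and is bounded below on the complement of \<open>K\<^sub>w\<close> in \<open>Q\<close>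
  (\<open>shift_adj_bounded_below\<close>). Hence the powers of \<open>1 - t B\<close> converge, for small \<open>t > 0\<close>,
  to the projection onto \<open>K\<^sub>w\<close>, which is compact; but \<open>\<chi>\<close> is \<open>1\<close> on the powers and \<open>0\<close>
  on the limit (\<open>point_not_in_ball\<close>).

  The lower bound for \<open>B\<close> comes from the identity
  \<open>\<Sum>\<^sub>i M\<^sub>i M\<^sub>i\<^sup>* z\<^sup>\<alpha> = |\<alpha>| / (n + |\<alpha>|) z\<^sup>\<alpha>\<close>: up to finitely many
  dimensions \<open>\<Sum>\<^sub>i \<parallel>M\<^sub>i\<^sup>* h\<parallel>\<^sup>2\<close> is as close to \<open>\<parallel>h\<parallel>\<^sup>2\<close> as desired, in particular larger than
  \<open>|w|\<^sup>2 \<parallel>h\<parallel>\<^sup>2\<close> by a fixed factor. A joint eigenvector of the \<open>M\<^sub>i\<^sup>*\<close> is a multiple of a kernel, and a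
  compactness argument combines the two facts.

  These arguments rest on the theory of the Bergman space itself: Weierstrass' theorem and homogeneous expansions for
  analytic functions of several variables, the invariance of Lebesgue measure under unitary maps, the mean value
  property and with it the completeness of the space, and the norms of the monomials.
\<close>


section \<open>Projections and adjoints in a real Hilbert space\<close>

text \<open>
  By the parallelogram law a sequence in \<open>S\<close> whose distance to \<open>x\<close> tends to the infimum is a Cauchy
  sequence; its limit is the nearest point.
\<close>

lemma orthogonal_projection_exists:
  fixes S :: "'a::{real_inner,complete_space} set"
  assumes S: "subspace S" "closed S"
  shows "\<exists>y\<in>S. \<forall>s\<in>S. inner (x - y) s = 0"
proof -
  have ne: "S \<noteq> {}" using subspace_0[OF S(1)] by blast
  define d where "d = infdist x S"
  have d0: "d \<ge> 0" by (simp add: d_def infdist_nonneg)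
  have dle: "d \<le> norm (x - s)" if "s \<in> S" for s
    using infdist_le[OF that, of x] by (simp add: d_def dist_norm)
  have "\<exists>s\<in>S. norm (x - s) < d + 1 / real (Suc n)" for n
  proof (rule ccontr)
    assume "\<not> ?thesis"
    then have "\<And>s. s \<in> S \<Longrightarrow> d + 1 / real (Suc n) \<le> dist x s" by (force simp: dist_norm)
    then have "d + 1 / real (Suc n) \<le> infdist x S"
      using ne by (auto simp: infdist_def intro!: cINF_greatest)
    then show False by (simp add: d_def field_simps)
  qed
  then obtain y where yS: "\<And>n. y n \<in> S" and y: "\<And>n. norm (x - y n) < d + 1 / real (Suc n)"
    by metis
  have par: "(norm (y m - y n))\<^sup>2 \<le> 8 * d * (1 / real (Suc N)) + 4 * (1 / real (Suc N))\<^sup>2"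
    if "N \<le> m" "N \<le> n" for m n N
  proof -
    define e where "e = 1 / real (Suc N)"
    have b: "(norm (x - y k))\<^sup>2 \<le> (d + e)\<^sup>2" if "N \<le> k" for k
    proof -
      have "1 / real (Suc k) \<le> e" using that by (simp add: e_def frac_le)
      then show ?thesis using y[of k] by (intro power_mono) auto
    qed
    \<comment> \<open>The midpoint is at distance at least \<open>d\<close> from \<open>x\<close>, which forces \<open>y m\<close> and \<open>y n\<close> together.\<close>
    have "(1/2) *\<^sub>R (y m + y n) \<in> S" using yS S(1) by (simp add: subspace_add subspace_scale)
    then have "d \<le> norm (x - (1/2) *\<^sub>R (y m + y n))" by (rule dle)
    then have "d\<^sup>2 \<le> (norm (x - (1/2) *\<^sub>R (y m + y n)))\<^sup>2" using d0 by (intro power_mono)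
    moreover have "(norm (y m - y n))\<^sup>2 =
        2 * (norm (x - y m))\<^sup>2 + 2 * (norm (x - y n))\<^sup>2 - 4 * (norm (x - (1/2) *\<^sub>R (y m + y n)))\<^sup>2"
      by (simp add: power2_norm_eq_inner inner_diff inner_add inner_commute algebra_simps)
    ultimately have "(norm (y m - y n))\<^sup>2 \<le> 4 * (d + e)\<^sup>2 - 4 * d\<^sup>2"
      using b[OF that(1)] b[OF that(2)] by linarith
    then show ?thesis unfolding e_def[symmetric] by (simp add: power2_sum algebra_simps)
  qed
  have "Cauchy y"
  proof (rule CauchyI)
    fix \<epsilon> :: real assume \<epsilon>: "\<epsilon> > 0"
    have "(\<lambda>N. 8 * d * (1 / real (Suc N)) + 4 * (1 / real (Suc N))\<^sup>2) \<longlonglongrightarrow> 8 * d * 0 + 4 * 0\<^sup>2"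
      by (intro tendsto_intros LIMSEQ_Suc[OF lim_1_over_n])
    then have "\<forall>\<^sub>F N in sequentially. 8 * d * (1 / real (Suc N)) + 4 * (1 / real (Suc N))\<^sup>2 < \<epsilon>\<^sup>2"
      using \<epsilon> by (intro order_tendstoD) auto
    then obtain N where N: "8 * d * (1 / real (Suc N)) + 4 * (1 / real (Suc N))\<^sup>2 < \<epsilon>\<^sup>2"
      by (auto simp: eventually_sequentially)
    have "norm (y m - y n) < \<epsilon>" if "N \<le> m" "N \<le> n" for m n
      using par[OF that] N \<epsilon> by (intro power2_less_imp_less[of _ \<epsilon>]) auto
    then show "\<exists>M. \<forall>m\<ge>M. \<forall>n\<ge>M. norm (y m - y n) < \<epsilon>" by blast
  qed
  then obtain z where z: "y \<longlonglongrightarrow> z" using Cauchy_convergent convergent_def by blast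
  have zS: "z \<in> S" using closed_sequentially[OF S(2)] yS z by blast
  have "(\<lambda>n. norm (x - y n)) \<longlonglongrightarrow> norm (x - z)" by (intro tendsto_intros z)
  moreover have "(\<lambda>n. d + 1 / real (Suc n)) \<longlonglongrightarrow> d + 0"
    by (intro tendsto_intros LIMSEQ_Suc[OF lim_1_over_n])
  ultimately have "norm (x - z) \<le> d + 0"
    by (rule LIMSEQ_le) (use y in \<open>auto intro: less_imp_le\<close>)
  then have zd: "norm (x - z) \<le> d" by simp
  have "inner (x - z) s = 0" if s: "s \<in> S" for s
  proof (cases "s = 0")
    case False
    \<comment> \<open>The value of \<open>t\<close> that minimizes the distance from \<open>x\<close> to \<open>z + t s\<close>.\<close>
    define t where "t = inner (x - z) s / (inner s s)"
    have "z + t *\<^sub>R s \<in> S" using zS s S(1) by (simp add: subspace_add subspace_scale)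
    then have "norm (x - z) \<le> norm (x - z - t *\<^sub>R s)" using dle zd by (fastforce simp: algebra_simps)
    then have "(norm (x - z))\<^sup>2 \<le> (norm (x - z - t *\<^sub>R s))\<^sup>2" by (intro power_mono) auto
    also have "\<dots> = (norm (x - z))\<^sup>2 - 2 * t * inner (x - z) s + t\<^sup>2 * inner s s"
      unfolding power2_norm_eq_inner inner_diff[of "x - z" "t *\<^sub>R s"]
      by (simp add: inner_diff_left[of "x-z" "t *\<^sub>R s"] inner_diff_right[of _ "x-z" "t *\<^sub>R s"]
          inner_commute[of s "x - z"] inner_commute[of s x] inner_commute[of s z] power2_eq_square algebra_simps)
    also have "\<dots> = (norm (x - z))\<^sup>2 - (inner (x - z) s)\<^sup>2 / inner s s"
      using False by (simp add: t_def power2_eq_square field_simps)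
    finally have "(inner (x - z) s)\<^sup>2 / inner s s \<le> 0" by simp
    moreover have "inner s s > 0" using False by simp
    ultimately show ?thesis by (simp add: divide_le_0_iff)
  qed auto
  then show ?thesis using zS by blast
qed

text \<open>
  The representing vector is a multiple of a vector orthogonal to the kernel of \<open>f\<close>.
\<close>

lemma riesz_representation:
  fixes f :: "'a::{real_inner,complete_space} \<Rightarrow> real"
  assumes f: "bounded_linear f"
  shows "\<exists>y. \<forall>x. f x = inner x y"
proof (cases "\<forall>x. f x = 0")
  case False
  interpret bounded_linear f by fact
  obtain x0 where x0: "f x0 \<noteq> 0" using False by blast
  define K where "K = {x. f x = 0}"
  have "subspace K" by (auto simp: K_def subspace_def add scaleR zero)
  moreover have "closed K"
    unfolding K_def by (intro closed_Collect_eq continuous_on_const linear_continuous_on f)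
  ultimately obtain y0 where y0: "y0 \<in> K" "\<And>s. s \<in> K \<Longrightarrow> inner (x0 - y0) s = 0"
    using orthogonal_projection_exists by blast
  define u where "u = x0 - y0"
  have fu: "f u \<noteq> 0" using x0 y0(1) by (simp add: u_def K_def diff)
  then have u0: "u \<noteq> 0" using zero by metis
  have "f x = inner x ((f u / inner u u) *\<^sub>R u)" for x
  proof -
    have "x - (f x / f u) *\<^sub>R u \<in> K" using fu by (simp add: K_def diff scaleR)
    then have "inner u (x - (f x / f u) *\<^sub>R u) = 0" using y0(2) by (simp add: u_def)
    then have "inner x u = f x / f u * inner u u" by (simp add: inner_diff_right inner_commute)
    then show ?thesis using fu u0 by simp
  qed
  then show ?thesis by blast
qed (auto intro: exI[of _ 0])

lemma inner_eqI:
  fixes a b :: "'a::real_inner"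
  assumes "\<And>x. inner x a = inner x b"
  shows "a = b"
proof -
  have "inner (a - b) (a - b) = 0" using assms[of "a - b"] by (simp only: inner_diff_right)
  then show ?thesis by simp
qed

lemma adjoint_exists:
  fixes T :: "'a::{real_inner,complete_space} \<Rightarrow>\<^sub>L 'a"
  shows "\<exists>T' :: 'a \<Rightarrow>\<^sub>L 'a. \<forall>x y. inner (T x) y = inner x (T' y)"
proof -
  have "\<exists>v. \<forall>x. inner (T x) y = inner x v" for y
    by (intro riesz_representation bounded_linear_compose[OF bounded_linear_inner_left]
        blinfun.bounded_linear_right)
  then obtain g where g: "\<And>x y. inner (T x) y = inner x (g y)" by metis
  have "bounded_linear g"
  proof (rule bounded_linear_intro[where K = "norm T"])
    show "g (x + y) = g x + g y" for x y
      by (rule inner_eqI) (simp add: inner_add_right g[symmetric])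
    show "g (r *\<^sub>R x) = r *\<^sub>R g x" for r x
      by (rule inner_eqI) (simp add: g[symmetric])
    show "norm (g y) \<le> norm y * norm T" for y
    proof (cases "g y = 0")
      case False
      have "norm (g y) * norm (g y) = inner (T (g y)) y"
        by (simp add: g power2_eq_square[symmetric] power2_norm_eq_inner)
      also have "\<dots> \<le> norm (T (g y)) * norm y" by (rule norm_cauchy_schwarz)
      also have "\<dots> \<le> (norm T * norm (g y)) * norm y"
        by (intro mult_right_mono norm_blinfun) auto
      finally show ?thesis using False by (simp add: mult_ac)
    qed auto
  qed
  then show ?thesis
    using g by (intro exI[of _ "Blinfun g"]) (simp add: bounded_linear_Blinfun_apply)
qed

text \<open>
  The adjoint for the real inner product. On the Bergman space it agrees with the complex adjoint of a
  complex linear operator, see \<open>cinner_hadj\<close>.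
\<close>

definition hadj :: "('a::{real_inner,complete_space} \<Rightarrow>\<^sub>L 'a) \<Rightarrow> 'a \<Rightarrow>\<^sub>L 'a" where
  "hadj T = (SOME T'. \<forall>x y. inner (blinfun_apply T x) y = inner x (blinfun_apply T' y))"

lemma inner_hadj: "inner (blinfun_apply T x) y = inner x (blinfun_apply (hadj T) y)"
  using someI_ex[OF adjoint_exists[of T]] unfolding hadj_def by blast

lemma inner_hadj': "inner (blinfun_apply (hadj T) y) x = inner y (blinfun_apply T x)"
  by (metis inner_commute inner_hadj)

lemma hadj_unique:
  assumes "\<And>x y. inner (blinfun_apply T x) y = inner x (blinfun_apply T' y)"
  shows "hadj T = T'"
  by (rule blinfun_eqI, rule inner_eqI) (simp add: inner_hadj[symmetric] assms)

lemma hadj_hadj [simp]: "hadj (hadj T) = T"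
  by (rule hadj_unique) (simp add: inner_hadj')

lemma hadj_add: "hadj (S + T) = hadj S + hadj T"
  by (rule hadj_unique) (simp add: blinfun.add_left inner_add_left inner_add_right inner_hadj)

lemma hadj_diff: "hadj (S - T) = hadj S - hadj T"
  by (rule hadj_unique) (simp add: blinfun.diff_left inner_diff_left inner_diff_right inner_hadj)

lemma hadj_compose: "hadj (S o\<^sub>L T) = hadj T o\<^sub>L hadj S"
  by (rule hadj_unique) (simp add: inner_hadj)

lemma norm_hadj_le: "norm (hadj T) \<le> norm T"
proof (rule norm_blinfun_bound)
  fix y
  let ?g = "hadj T y"
  show "norm ?g \<le> norm T * norm y"
  proof (cases "?g = 0")
    case False
    have "norm ?g * norm ?g = inner (T ?g) y"
      by (simp add: inner_hadj power2_eq_square[symmetric] power2_norm_eq_inner)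
    also have "\<dots> \<le> norm (T ?g) * norm y" by (rule norm_cauchy_schwarz)
    also have "\<dots> \<le> (norm T * norm ?g) * norm y"
      by (intro mult_right_mono norm_blinfun) auto
    finally show ?thesis using False by (simp add: mult_ac)
  qed auto
qed auto


section \<open>Polynomials and multiplication operators\<close>

abbreviation pconst :: "complex \<Rightarrow> ('n::finite) cpoly" where
  "pconst c \<equiv> Poly_Mapping.single 0 c"

definition mono_eval :: "('n::finite \<Rightarrow>\<^sub>0 nat) \<Rightarrow> complex ^ 'n \<Rightarrow> complex" where
  "mono_eval m z = (\<Prod>i\<in>UNIV. (z $ i) ^ Poly_Mapping.lookup m i)"

lemma mono_eval_add: "mono_eval (a + b) z = mono_eval a z * mono_eval b z"
  by (simp add: mono_eval_def lookup_add power_add prod.distrib)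

lemma mono_eval_zero [simp]: "mono_eval 0 z = 1"
  by (simp add: mono_eval_def)

lemma mono_eval_single: "mono_eval (Poly_Mapping.single i k) z = (z $ i) ^ k"
proof -
  have "(\<Prod>j\<in>UNIV. (z $ j) ^ Poly_Mapping.lookup (Poly_Mapping.single i k) j)
      = (\<Prod>j\<in>UNIV. if j = i then (z $ j) ^ k else 1)"
    by (rule prod.cong) (auto simp: lookup_single when_def)
  then show ?thesis by (simp add: mono_eval_def)
qed

lemma peval_superset:
  assumes "finite A" "Poly_Mapping.keys p \<subseteq> A"
  shows "peval p z = (\<Sum>m\<in>A. Poly_Mapping.lookup p m * mono_eval m z)"
  unfolding peval_def mono_eval_def
  by (rule sum.mono_neutral_left) (use assms in \<open>auto simp: in_keys_iff\<close>)

lemma peval_single [simp]: "peval (Poly_Mapping.single m c) z = c * mono_eval m z"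
  by (subst peval_superset[of "{m}"]) auto

lemma peval_zero [simp]: "peval 0 z = 0"
  by (simp add: peval_def)

lemma peval_add [simp]: "peval (p + q) z = peval p z + peval q z"
  using Poly_Mapping.keys_add[of p q]
  by (simp add: peval_superset[of "Poly_Mapping.keys p \<union> Poly_Mapping.keys q"]
      lookup_add algebra_simps sum.distrib)

lemma peval_sum [simp]: "peval (\<Sum>i\<in>A. f i) z = (\<Sum>i\<in>A. peval (f i) z)"
  by (induction A rule: infinite_finite_induct) auto

lemma poly_mapping_sum_singles:
  "p = (\<Sum>m\<in>Poly_Mapping.keys p. Poly_Mapping.single m (Poly_Mapping.lookup p m))"
proof (rule poly_mapping_eqI)
  fix k
  have "(\<Sum>m\<in>Poly_Mapping.keys p. Poly_Mapping.lookup p m when m = k) =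
      (\<Sum>m\<in>Poly_Mapping.keys p. if m = k then Poly_Mapping.lookup p m else 0)"
    by (rule sum.cong) (auto simp: when_def)
  then show "Poly_Mapping.lookup p k = Poly_Mapping.lookup
      (\<Sum>m\<in>Poly_Mapping.keys p. Poly_Mapping.single m (Poly_Mapping.lookup p m)) k"
    by (auto simp: lookup_sum lookup_single in_keys_iff)
qed

lemma peval_mult [simp]: "peval (p * q) z = peval p z * peval q z"
proof -
  have 1: "peval (Poly_Mapping.single m c * q) z = c * mono_eval m z * peval q z" for m c
    by (subst (1 2) poly_mapping_sum_singles[of q])
       (simp add: sum_distrib_left mult_single mono_eval_add mult_ac)
  show ?thesis
    by (subst (1 2) poly_mapping_sum_singles[of p]) (simp add: sum_distrib_right 1)
qed

lemma peval_one [simp]: "peval 1 z = 1"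
  using peval_single[of 0 1 z] by (simp only: single_one mono_eval_zero mult_1)

lemma peval_pvar' [simp]: "peval (pvar i) z = z $ i"
  by (rule peval_pvar)

text \<open>
  Polynomials form the algebra generated by the constants and the variables. Multiplicative statements are
  inherited from these generators.
\<close>

lemma cpoly_induct [case_names const var add mult]:
  fixes f :: "('n::finite) cpoly"
  assumes const: "\<And>c. P (pconst c)" and var: "\<And>i. P (pvar i)"
    and add: "\<And>f g. P f \<Longrightarrow> P g \<Longrightarrow> P (f + g)"
    and mult: "\<And>f g. P f \<Longrightarrow> P g \<Longrightarrow> P (f * g)"
  shows "P f"
proof -
  have 1: "P (Poly_Mapping.single (Poly_Mapping.single i k) 1)" for i k
  proof (induction k)
    case (Suc k)
    have "Poly_Mapping.single (Poly_Mapping.single i (Suc k)) 1 =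
        pvar i * Poly_Mapping.single (Poly_Mapping.single i k) (1::complex)"
      by (simp add: pvar_def mult_single single_add[symmetric])
    then show ?case using Suc mult var by simp
  qed (use const[of 1] in auto)
  have 2: "P (Poly_Mapping.single (\<Sum>i\<in>F. Poly_Mapping.single i (Poly_Mapping.lookup m i)) 1)"
    if "finite F" for F and m :: "'n \<Rightarrow>\<^sub>0 nat"
    using that
  proof induction
    case (insert j F)
    have "Poly_Mapping.single (\<Sum>i\<in>insert j F. Poly_Mapping.single i (Poly_Mapping.lookup m i)) 1 =
        Poly_Mapping.single (Poly_Mapping.single j (Poly_Mapping.lookup m j)) 1 *
        Poly_Mapping.single (\<Sum>i\<in>F. Poly_Mapping.single i (Poly_Mapping.lookup m i)) (1::complex)"
      using insert by (simp add: mult_single)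
    then show ?case using mult[OF 1 insert.IH] by simp
  qed (use const[of 1] in auto)
  have 3: "P (Poly_Mapping.single m c)" for m :: "'n \<Rightarrow>\<^sub>0 nat" and c
  proof -
    have "P (Poly_Mapping.single m 1)"
      using 2[OF finite_keys[of m], of m] by (simp only: poly_mapping_sum_singles[of m, symmetric])
    from mult[OF const[of c] this] show ?thesis by (simp add: mult_single)
  qed
  have "P (\<Sum>m\<in>F. Poly_Mapping.single m (Poly_Mapping.lookup f m))" if "finite F" for F
    using that by induction (use const[of 0] in \<open>auto intro!: 3 add\<close>)
  from this[OF finite_keys[of f]] show ?thesis
    by (simp only: poly_mapping_sum_singles[of f, symmetric])
qed

lemma bergman_eqI: "(\<And>z. z \<in> ball 0 1 \<Longrightarrow> Rep_bergman f z = Rep_bergman g z) \<Longrightarrow> f = g"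
proof -
  assume *: "\<And>z. z \<in> ball 0 1 \<Longrightarrow> Rep_bergman f z = Rep_bergman g z"
  have "Rep_bergman f z = Rep_bergman g z" for z
    using * Rep_bergman[of f] Rep_bergman[of g] by (cases "z \<in> ball 0 1") auto
  then show "f = g" by (simp add: Rep_bergman_inject[symmetric] fun_eq_iff)
qed

lemma Rep_bergman_outside: "z \<notin> ball 0 1 \<Longrightarrow> Rep_bergman f z = 0"
  using Rep_bergman[of f] by auto

lemma Rep_bergman_analytic: "analytic_on_ball (Rep_bergman f)"
  using Rep_bergman[of f] by auto

lemma Rep_bergman_measurable: "Rep_bergman f \<in> borel_measurable ball_measure"
  using Rep_bergman[of f] by (intro analytic_on_ball_measurable) auto

lemma Rep_bergman_sq_integrable: "integrable ball_measure (\<lambda>z. (cmod (Rep_bergman f z))\<^sup>2)"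
  using Rep_bergman[of f] by auto

lemma Rep_bergman_mult_cnj_integrable:
  "integrable ball_measure (\<lambda>z. Rep_bergman f z * cnj (Rep_bergman g z))"
  by (intro integrable_mult_cnj Rep_bergman_measurable Rep_bergman_sq_integrable)

lemma Rep_bergman_uminus: "Rep_bergman (- f) z = - Rep_bergman f z"
  by (simp add: uminus_bergman_def bergman_cscale.rep_eq)

lemma Rep_bergman_diff: "Rep_bergman (f - g) z = Rep_bergman f z - Rep_bergman g z"
  unfolding minus_bergman_def plus_bergman.rep_eq Rep_bergman_uminus by simp

lemma Rep_bergman_scaleR: "Rep_bergman (r *\<^sub>R f) z = r * Rep_bergman f z"
  by (simp add: scaleR_bergman_def bergman_cscale.rep_eq)

lemma norm_bergman_sq: "(norm f)\<^sup>2 = (LINT z|ball_measure. (cmod (Rep_bergman f z))\<^sup>2)"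
  unfolding norm_bergman_eq by (simp add: integral_nonneg_AE)

lemmas bergman_rep = plus_bergman.rep_eq zero_bergman.rep_eq Rep_bergman_uminus Rep_bergman_diff
  Rep_bergman_scaleR bergman_cscale.rep_eq bergman_mult.rep_eq

lemma cinner_cscale_left: "bergman_cinner (bergman_cscale c f) g = c * bergman_cinner f g"
  by (simp add: bergman_cinner.rep_eq bergman_rep mult.assoc)

lemma cinner_cnj: "bergman_cinner g f = cnj (bergman_cinner f g)"
  unfolding bergman_cinner.rep_eq
  by (subst Bochner_Integration.integral_cnj[symmetric]) (simp add: mult.commute)

lemma cinner_cscale_right: "bergman_cinner f (bergman_cscale c g) = cnj c * bergman_cinner f g"
  by (subst (1 2) cinner_cnj) (simp add: cinner_cscale_left)

lemma cinner_add_left: "bergman_cinner (f + g) h = bergman_cinner f h + bergman_cinner g h"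
  by (simp add: bergman_cinner.rep_eq bergman_rep distrib_right Rep_bergman_mult_cnj_integrable)

lemma cinner_diff_left: "bergman_cinner (f - g) h = bergman_cinner f h - bergman_cinner g h"
  by (simp add: bergman_cinner.rep_eq bergman_rep left_diff_distrib Rep_bergman_mult_cnj_integrable)

lemma cinner_add_right: "bergman_cinner h (f + g) = bergman_cinner h f + bergman_cinner h g"
  by (subst (1 2 3) cinner_cnj) (simp add: cinner_add_left)

lemma cinner_diff_right: "bergman_cinner h (f - g) = bergman_cinner h f - bergman_cinner h g"
  by (subst (1 2 3) cinner_cnj) (simp add: cinner_diff_left)

lemma cinner_zero [simp]: "bergman_cinner 0 g = 0" "bergman_cinner g 0 = 0"
  by (simp_all add: bergman_cinner.rep_eq bergman_rep)

lemma cinner_inner: "bergman_cinner f g = Complex (inner f g) (inner f (bergman_cscale \<i> g))"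
  by (simp add: complex_eq_iff inner_bergman_def cinner_cscale_right)

lemma cinner_self: "bergman_cinner f f = of_real ((norm f)\<^sup>2)"
proof -
  have "bergman_cinner f f = cnj (bergman_cinner f f)" by (rule cinner_cnj)
  then have "Im (bergman_cinner f f) = 0" by (simp add: complex_eq_iff)
  then show ?thesis by (simp add: complex_eq_iff power2_norm_eq_inner inner_bergman_def)
qed

lemma cscale_add: "bergman_cscale c (f + g) = bergman_cscale c f + bergman_cscale c g"
  by (rule bergman_eqI) (simp add: bergman_rep algebra_simps)

lemma cscale_diff: "bergman_cscale c (f - g) = bergman_cscale c f - bergman_cscale c g"
  by (rule bergman_eqI) (simp add: bergman_rep algebra_simps)

lemma cscale_add_left: "bergman_cscale (a + b) h = bergman_cscale a h + bergman_cscale b h"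
  by (rule bergman_eqI) (simp add: bergman_rep algebra_simps)

lemma cscale_diff_left: "bergman_cscale (a - b) h = bergman_cscale a h - bergman_cscale b h"
  by (rule bergman_eqI) (simp add: bergman_rep algebra_simps)

lemma cscale_cscale [simp]: "bergman_cscale c (bergman_cscale d f) = bergman_cscale (c * d) f"
  by (rule bergman_eqI) (simp add: bergman_rep)

lemma cscale_1 [simp]: "bergman_cscale 1 f = f"
  by (rule bergman_eqI) (simp add: bergman_rep)

lemma cscale_0 [simp]: "bergman_cscale 0 f = 0" "bergman_cscale c 0 = 0"
  by (rule bergman_eqI, simp add: bergman_rep)+

lemma cscale_scaleR: "r *\<^sub>R f = bergman_cscale (of_real r) f"
  by (simp add: scaleR_bergman_def)

text \<open>This carries the projection theorem, which speaks of the real inner product, over to complex subspaces.\<close>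

lemma cinner_zero_iff_inner:
  assumes "\<And>c s. s \<in> S \<Longrightarrow> bergman_cscale c s \<in> S"
  shows "(\<forall>s\<in>S. bergman_cinner h s = 0) \<longleftrightarrow> (\<forall>s\<in>S. inner h s = 0)"
  using assms by (auto simp: cinner_inner complex_eq_iff)

lemma cinner_cauchy_schwarz: "cmod (bergman_cinner f g) \<le> norm f * norm g"
proof (cases "bergman_cinner f g = 0")
  case False
  \<comment> \<open>A unimodular factor makes the inner product real, so that the real inequality applies.\<close>
  define c where "c = cnj (bergman_cinner f g) / cmod (bergman_cinner f g)"
  have c: "cmod c = 1" using False by (simp add: c_def norm_divide)
  have "cmod (bergman_cinner f g) = Re (c * bergman_cinner f g)"
    using False by (simp add: c_def complex_norm_square[symmetric] power2_eq_square mult.commute[of "cnj _"])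
  also have "\<dots> = inner (bergman_cscale c f) g" by (simp add: inner_bergman_def cinner_cscale_left)
  also have "\<dots> \<le> norm (bergman_cscale c f) * norm g" by (rule norm_cauchy_schwarz)
  finally show ?thesis by (simp add: norm_bergman_cscale c)
qed simp

lemma bounded_linear_cinner_left: "bounded_linear (\<lambda>h. bergman_cinner h g)"
proof (rule bounded_linear_intro[where K = "norm g"])
  show "bergman_cinner (r *\<^sub>R h) g = r *\<^sub>R bergman_cinner h g" for r h
    by (simp only: cscale_scaleR cinner_cscale_left scaleR_conv_of_real)
qed (simp_all add: cinner_add_left cinner_cauchy_schwarz)

lemma norm_bergman_mult_le:
  assumes "\<And>z. z \<in> ball 0 1 \<Longrightarrow> cmod (peval f z) \<le> B"
  shows "norm (bergman_mult f h) \<le> B * norm h"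
proof -
  have "norm (peval f 0) \<le> B" using assms[of 0] by simp
  then have B: "B \<ge> 0" by (rule order_trans[OF norm_ge_zero])
  have "(norm (bergman_mult f h))\<^sup>2 \<le> (LINT z|ball_measure. B\<^sup>2 * (cmod (Rep_bergman h z))\<^sup>2)"
    unfolding norm_bergman_sq
  proof (rule integral_mono)
    show "(cmod (Rep_bergman (bergman_mult f h) z))\<^sup>2 \<le> B\<^sup>2 * (cmod (Rep_bergman h z))\<^sup>2" for z
      using assms[of z] B by (cases "z \<in> ball 0 1")
        (auto simp: bergman_rep norm_mult power_mult_distrib Rep_bergman_outside intro!: mult_right_mono power_mono)
  qed (auto intro: Rep_bergman_sq_integrable)
  also have "\<dots> = (B * norm h)\<^sup>2" by (simp add: norm_bergman_sq power_mult_distrib)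
  finally show ?thesis by (rule power2_le_imp_le) (use B in simp)
qed

lemma bounded_linear_bergman_mult: "bounded_linear (bergman_mult f)"
proof -
  obtain B where B: "\<And>z. z \<in> ball 0 1 \<Longrightarrow> cmod (peval f z) \<le> B"
    using bounded_peval by blast
  show ?thesis
  proof (rule bounded_linear_intro[where K = B])
    show "norm (bergman_mult f h) \<le> norm h * B" for h
      using norm_bergman_mult_le[OF B] by (simp add: mult.commute)
  qed (auto intro!: bergman_eqI simp: bergman_rep algebra_simps)
qed

definition mult_op :: "('n::finite) cpoly \<Rightarrow> 'n operator" where
  "mult_op f = Blinfun (bergman_mult f)"

lemma mult_op_apply [simp]: "blinfun_apply (mult_op f) h = bergman_mult f h"
  unfolding mult_op_def by (simp add: bounded_linear_Blinfun_apply bounded_linear_bergman_mult)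

lemma mult_op_cscale: "bergman_mult f (bergman_cscale c h) = bergman_cscale c (bergman_mult f h)"
  by (rule bergman_eqI) (simp add: bergman_rep)

lemma bergman_mult_add: "bergman_mult (f + g) h = bergman_mult f h + bergman_mult g h"
  by (rule bergman_eqI) (simp add: bergman_rep algebra_simps)

lemma bergman_mult_mult: "bergman_mult (f * g) h = bergman_mult f (bergman_mult g h)"
  by (rule bergman_eqI) (simp add: bergman_rep algebra_simps)

lemma bergman_mult_const: "bergman_mult (pconst c) h = bergman_cscale c h"
  by (rule bergman_eqI) (simp add: bergman_rep)

definition poly_fun :: "('n::finite) cpoly \<Rightarrow> 'n bergman" where
  "poly_fun q = bergman_mult q bergman_one"

lemma Rep_poly_fun: "z \<in> ball 0 1 \<Longrightarrow> Rep_bergman (poly_fun q) z = peval q z"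
  by (simp add: poly_fun_def bergman_rep bergman_one.rep_eq)


section \<open>Analytic functions of several complex variables\<close>

text \<open>
  The condition of \<open>analytic_on_ball\<close> on an arbitrary set, so that it can be localized.
\<close>

definition analytic_in :: "(complex ^ ('n::finite)) set \<Rightarrow> (complex ^ 'n \<Rightarrow> complex) \<Rightarrow> bool" where
  "analytic_in U f \<longleftrightarrow> (\<forall>z\<in>U. \<exists>D. (f has_derivative D) (at z) \<and> (\<forall>c v. D (c *s v) = c * D v))"

definition dirderiv :: "(complex ^ ('n::finite) \<Rightarrow> complex) \<Rightarrow> complex ^ 'n \<Rightarrow> complex ^ 'n \<Rightarrow> complex" where
  "dirderiv f v z = frechet_derivative f (at z) v"

lemma analytic_on_ball_iff_analytic_in: "analytic_on_ball f \<longleftrightarrow> analytic_in (ball 0 1) f"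
  by (simp add: analytic_on_ball_def analytic_in_def)

lemma norm_vec_scalar_mult [simp]: "norm (c *s (v :: complex ^ ('n::finite))) = cmod c * norm v"
proof -
  have "(\<Sum>i\<in>UNIV. (cmod (c * v $ i))\<^sup>2) = (cmod c)\<^sup>2 * (\<Sum>i\<in>UNIV. (cmod (v $ i))\<^sup>2)"
    by (simp add: norm_mult power_mult_distrib sum_distrib_left)
  then show ?thesis by (simp add: norm_vec_def L2_set_def real_sqrt_mult)
qed

lemma bounded_linear_vec_scalar_mult_left: "bounded_linear (\<lambda>t::complex. t *s (v :: complex ^ ('n::finite)))"
  by (rule bounded_linear_intro[where K = "norm v"]) (auto simp: vec_eq_iff algebra_simps)

lemma bounded_linear_vec_scalar_mult_right: "bounded_linear (\<lambda>v. (t::complex) *s (v :: complex ^ ('n::finite)))"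
  by (rule bounded_linear_intro[where K = "cmod t"]) (auto simp: vec_eq_iff algebra_simps)

lemmas continuous_on_vec_scalar_mult_left [continuous_intros] =
  bounded_linear.continuous_on[OF bounded_linear_vec_scalar_mult_left]

lemmas continuous_on_vec_scalar_mult_right [continuous_intros] =
  bounded_linear.continuous_on[OF bounded_linear_vec_scalar_mult_right]

lemma analytic_in_derivative:
  assumes "analytic_in U f" "z \<in> U"
  shows "(f has_derivative (\<lambda>v. dirderiv f v z)) (at z)"
    and "dirderiv f (c *s v) z = c * dirderiv f v z"
proof -
  obtain D where D: "(f has_derivative D) (at z)" "\<forall>c v. D (c *s v) = c * D v"
    using assms unfolding analytic_in_def by blast
  have "D = frechet_derivative f (at z)" using D(1) by (rule frechet_derivative_at)
  then have "D = (\<lambda>v. dirderiv f v z)" by (simp add: dirderiv_def fun_eq_iff)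
  then show "(f has_derivative (\<lambda>v. dirderiv f v z)) (at z)" "dirderiv f (c *s v) z = c * dirderiv f v z"
    using D by auto
qed

lemma analytic_in_subset: "analytic_in U f \<Longrightarrow> V \<subseteq> U \<Longrightarrow> analytic_in V f"
  unfolding analytic_in_def by blast

lemma analytic_in_continuous_on: "analytic_in U f \<Longrightarrow> continuous_on U f"
  by (meson analytic_in_derivative(1) continuous_at_imp_continuous_on has_derivative_continuous)

text \<open>
  Restriction to complex lines gives access to the theory of one variable.
\<close>

lemma analytic_in_slice:
  assumes "analytic_in U f" "z + t *s v \<in> U"
  shows "((\<lambda>t. f (z + t *s v)) has_field_derivative dirderiv f v (z + t *s v)) (at t)"
proof -
  have "((\<lambda>t. z + t *s v) has_derivative (\<lambda>s. s *s v)) (at t)"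
    by (auto intro!: derivative_eq_intros bounded_linear_imp_has_derivative
        bounded_linear_vec_scalar_mult_left)
  from has_derivative_compose[OF this analytic_in_derivative(1)[OF assms]]
  have "((\<lambda>t. f (z + t *s v)) has_derivative (\<lambda>s. dirderiv f (s *s v) (z + t *s v))) (at t)" .
  moreover have "(\<lambda>s. dirderiv f (s *s v) (z + t *s v)) = (*) (dirderiv f v (z + t *s v))"
    by (simp add: analytic_in_derivative(2)[OF assms] fun_eq_iff mult.commute)
  ultimately show ?thesis by (simp add: has_field_derivative_def)
qed

lemma analytic_in_slice_holomorphic:
  assumes "analytic_in U f" "\<And>t. t \<in> T \<Longrightarrow> z + t *s v \<in> U"
  shows "(\<lambda>t. f (z + t *s v)) holomorphic_on T"
  unfolding holomorphic_on_def
  using analytic_in_slice[OF assms(1)] assms(2) field_differentiable_def field_differentiable_at_within by blast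

lemma analytic_in_affine:
  assumes "analytic_in U f" "\<And>z. z \<in> V \<Longrightarrow> a + c *s z \<in> U"
  shows "analytic_in V (\<lambda>z. f (a + c *s z))"
  unfolding analytic_in_def
proof
  fix z assume z: "z \<in> V"
  have "((\<lambda>z. a + c *s z) has_derivative (\<lambda>v. c *s v)) (at z)"
    by (auto intro!: derivative_eq_intros bounded_linear_imp_has_derivative
        bounded_linear_vec_scalar_mult_right)
  from has_derivative_compose[OF this analytic_in_derivative(1)[OF assms(1) assms(2)[OF z]]]
  have "((\<lambda>z. f (a + c *s z)) has_derivative (\<lambda>v. dirderiv f (c *s v) (a + c *s z))) (at z)" .
  moreover have "dirderiv f (c *s (d *s v)) (a + c *s z) = d * dirderiv f (c *s v) (a + c *s z)" for d v
    by (simp add: analytic_in_derivative(2)[OF assms(1) assms(2)[OF z]])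
  ultimately show "\<exists>D. ((\<lambda>z. f (a + c *s z)) has_derivative D) (at z) \<and> (\<forall>c v. D (c *s v) = c * D v)"
    by blast
qed

lemma analytic_in_add: "analytic_in U f \<Longrightarrow> analytic_in U g \<Longrightarrow> analytic_in U (\<lambda>z. f z + g z)"
  unfolding analytic_in_def
proof
  fix z assume a: "\<forall>z\<in>U. \<exists>D. (f has_derivative D) (at z) \<and> (\<forall>c v. D (c *s v) = c * D v)"
    "\<forall>z\<in>U. \<exists>D. (g has_derivative D) (at z) \<and> (\<forall>c v. D (c *s v) = c * D v)" "z \<in> U"
  then obtain D E where "(f has_derivative D) (at z)" "\<forall>c v. D (c *s v) = c * D v"
    "(g has_derivative E) (at z)" "\<forall>c v. E (c *s v) = c * E v" by meson
  then show "\<exists>D. ((\<lambda>z. f z + g z) has_derivative D) (at z) \<and> (\<forall>c v. D (c *s v) = c * D v)"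
    by (intro exI[of _ "\<lambda>v. D v + E v"]) (auto intro!: has_derivative_add simp: algebra_simps)
qed

lemma analytic_in_cmult: "analytic_in U f \<Longrightarrow> analytic_in U (\<lambda>z. c * f z)"
  unfolding analytic_in_def
proof
  fix z assume a: "\<forall>z\<in>U. \<exists>D. (f has_derivative D) (at z) \<and> (\<forall>c v. D (c *s v) = c * D v)" "z \<in> U"
  then obtain D where "(f has_derivative D) (at z)" "\<forall>c v. D (c *s v) = c * D v" by meson
  then show "\<exists>D. ((\<lambda>z. c * f z) has_derivative D) (at z) \<and> (\<forall>c v. D (c *s v) = c * D v)"
    by (intro exI[of _ "\<lambda>v. c * D v"]) (auto intro!: has_derivative_mult_right)
qed

lemma analytic_in_diff: "analytic_in U f \<Longrightarrow> analytic_in U g \<Longrightarrow> analytic_in U (\<lambda>z. f z - g z)"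
  using analytic_in_add[of U f "\<lambda>z. (-1) * g z"] analytic_in_cmult[of U g "-1"] by simp

text \<open>
  Cauchy's inequality for the function \<open>f(z + t v)\<close> of \<open>t\<close> on the disc of radius \<open>r / |v|\<close>.
\<close>

lemma analytic_in_dirderiv_bound:
  assumes f: "analytic_in U f" and r: "r > 0" "cball z r \<subseteq> U"
    and M: "\<And>w. w \<in> cball z r \<Longrightarrow> cmod (f w) \<le> M"
  shows "cmod (dirderiv f v z) \<le> M / r * norm v"
proof (cases "v = 0")
  case True
  have "z \<in> U" using r by auto
  from analytic_in_derivative(2)[OF f this, of 0 v] show ?thesis using True by simp
next
  case False
  define \<rho> where "\<rho> = r / norm v"
  have \<rho>: "\<rho> > 0" using r False by (simp add: \<rho>_def)
  have in_cball: "z + t *s v \<in> cball z r" if "t \<in> cball 0 \<rho>" for t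
    using that False by (simp add: \<rho>_def dist_norm pos_le_divide_eq)
  have hol: "(\<lambda>t. f (z + t *s v)) holomorphic_on cball 0 \<rho>"
    using in_cball r by (intro analytic_in_slice_holomorphic[OF f]) auto
  have "cmod ((deriv ^^ 1) (\<lambda>t. f (z + t *s v)) 0) \<le> fact 1 * M / \<rho> ^ 1"
  proof (rule Cauchy_inequality)
    show "(\<lambda>t. f (z + t *s v)) holomorphic_on ball 0 \<rho>"
      using hol ball_subset_cball holomorphic_on_subset by blast
    show "continuous_on (cball 0 \<rho>) (\<lambda>t. f (z + t *s v))"
      using hol by (rule holomorphic_on_imp_continuous_on)
    show "cmod (f (z + t *s v)) \<le> M" if "cmod (0 - t) = \<rho>" for t
      using in_cball[of t] that by (intro M) auto
  qed (fact \<rho>)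
  moreover have "deriv (\<lambda>t. f (z + t *s v)) 0 = dirderiv f v z"
  proof -
    have "z \<in> U" using r by (meson centre_in_cball less_imp_le subsetD)
    then show ?thesis using DERIV_imp_deriv[OF analytic_in_slice[OF f, of z 0 v]] by simp
  qed
  ultimately show ?thesis by (simp add: \<rho>_def)
qed

lemma dirderiv_diff:
  assumes "analytic_in U f" "analytic_in U g" "z \<in> U"
  shows "dirderiv (\<lambda>z. f z - g z) v z = dirderiv f v z - dirderiv g v z"
proof -
  have "((\<lambda>z. f z - g z) has_derivative (\<lambda>v. dirderiv f v z - dirderiv g v z)) (at z)"
    by (intro has_derivative_diff analytic_in_derivative(1)[OF assms(1,3)] analytic_in_derivative(1)[OF assms(2,3)])
  from frechet_derivative_at[OF this] show ?thesis by (simp add: dirderiv_def fun_eq_iff)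
qed

text \<open>Weierstrass' theorem: by Cauchy's inequality the derivatives converge locally uniformly too.\<close>

lemma analytic_in_uniform_limit:
  fixes f :: "nat \<Rightarrow> complex ^ ('n::finite) \<Rightarrow> complex"
  assumes U: "open U"
    and lim: "\<And>z. z \<in> U \<Longrightarrow> \<exists>r>0. ball z r \<subseteq> U \<and> (\<forall>\<^sub>F n in sequentially. analytic_in (ball z r) (f n)) \<and>
        uniform_limit (ball z r) f g sequentially"
  shows "analytic_in U g"
  unfolding analytic_in_def
proof
  fix z assume "z \<in> U"
  then obtain r where r: "r > 0" and ev: "\<forall>\<^sub>F n in sequentially. analytic_in (ball z r) (f n)"
    and ul: "uniform_limit (ball z r) f g sequentially"
    using lim by blast
  from ev obtain N where N: "\<And>n. n \<ge> N \<Longrightarrow> analytic_in (ball z r) (f n)"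
    by (auto simp: eventually_sequentially)
  define F where "F n = f (n + N)" for n
  have F: "analytic_in (ball z r) (F n)" for n using N by (simp add: F_def)
  have ulF: "uniform_limit (ball z r) F g sequentially"
    unfolding uniform_limit_iff
  proof (intro allI impI)
    fix e :: real assume "e > 0"
    with ul have "\<forall>\<^sub>F n in sequentially. \<forall>x\<in>ball z r. dist (f n x) (g x) < e"
      unfolding uniform_limit_iff by blast
    then obtain K where "\<And>n. n \<ge> K \<Longrightarrow> \<forall>x\<in>ball z r. dist (f n x) (g x) < e"
      unfolding eventually_sequentially by blast
    then show "\<forall>\<^sub>F n in sequentially. \<forall>x\<in>ball z r. dist (F n x) (g x) < e"
      unfolding eventually_sequentially F_def by (metis trans_le_add1)
  qed
  define S where "S = ball z (r / 2)"
  have sub: "cball x (r / 3) \<subseteq> ball z r" if "x \<in> S" for x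
  proof
    fix y assume "y \<in> cball x (r/3)"
    then show "y \<in> ball z r" using that r dist_triangle[of z y x] by (simp add: S_def)
  qed
  have SU: "x \<in> ball z r" if "x \<in> S" for x using that r by (simp add: S_def)
  have cau: "\<exists>N. \<forall>m\<ge>N. \<forall>n\<ge>N. \<forall>x\<in>S. \<forall>h. cmod (dirderiv (F m) h x - dirderiv (F n) h x) \<le> e * norm h"
    if e: "e > 0" for e
  proof -
    have "uniformly_Cauchy_on (ball z r) F"
      using ulF uniformly_convergent_Cauchy uniformly_convergent_on_def by blast
    then obtain N where N: "\<And>m n w. m \<ge> N \<Longrightarrow> n \<ge> N \<Longrightarrow> w \<in> ball z r \<Longrightarrow> dist (F m w) (F n w) < e * (r / 3)"
    proof -
      have "e * (r / 3) > 0" using r e by simp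
      then show ?thesis using \<open>uniformly_Cauchy_on _ _\<close> that unfolding uniformly_Cauchy_on_def by blast
    qed
    have "cmod (dirderiv (F m) h x - dirderiv (F n) h x) \<le> e * norm h"
      if "m \<ge> N" "n \<ge> N" "x \<in> S" for m n x h
    proof -
      have "cmod (dirderiv (\<lambda>w. F m w - F n w) h x) \<le> (e * (r / 3)) / (r / 3) * norm h"
      proof (rule analytic_in_dirderiv_bound[OF analytic_in_diff[OF F F]])
        show "cball x (r / 3) \<subseteq> ball z r" by (rule sub[OF that(3)])
        fix w assume "w \<in> cball x (r / 3)"
        then have "w \<in> ball z r" using sub[OF that(3)] by blast
        from N[OF that(1,2) this] show "cmod (F m w - F n w) \<le> e * (r / 3)"
          by (simp add: dist_norm)
      qed (use r in simp)
      then show ?thesis using r dirderiv_diff[OF F F SU[OF that(3)]] by simp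
    qed
    then show ?thesis by blast
  qed
  have "Cauchy (\<lambda>n. dirderiv (F n) h x)" if x: "x \<in> S" for x h
  proof (rule CauchyI)
    fix e :: real assume e: "e > 0"
    have "e / (norm h + 1) > 0" using e by (simp add: add_nonneg_pos)
    from cau[OF this] x obtain N where N: "\<And>m n. m \<ge> N \<Longrightarrow> n \<ge> N \<Longrightarrow>
        cmod (dirderiv (F m) h x - dirderiv (F n) h x) \<le> e / (norm h + 1) * norm h" by blast
    have "e / (norm h + 1) * norm h < e" using e by (simp add: divide_simps add_nonneg_pos)
    then show "\<exists>M. \<forall>m\<ge>M. \<forall>n\<ge>M. norm (dirderiv (F m) h x - dirderiv (F n) h x) < e"
      using N by (intro exI[of _ N]) (blast intro: le_less_trans)
  qed
  then have "\<exists>l. (\<lambda>n. dirderiv (F n) h x) \<longlonglongrightarrow> l" if "x \<in> S" for x h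
    using that Cauchy_convergent convergent_def by blast
  then obtain D where D: "\<And>x h. x \<in> S \<Longrightarrow> (\<lambda>n. dirderiv (F n) h x) \<longlonglongrightarrow> D x h"
    by metis
  have zS: "z \<in> S" using r by (simp add: S_def)
  have "\<exists>g'. \<forall>x\<in>S. (\<lambda>n. F n x) \<longlonglongrightarrow> g' x \<and> (g' has_derivative D x) (at x within S)"
  proof (rule has_derivative_sequence[where ?x0.0 = z and l = "g z"])
    show "convex S" by (simp add: S_def)
    show "(F n has_derivative (\<lambda>h. dirderiv (F n) h x)) (at x within S)" if "x \<in> S" for n x
      using analytic_in_derivative(1)[OF F SU[OF that]] has_derivative_at_withinI by blast
    show "\<forall>\<^sub>F n in sequentially. \<forall>x\<in>S. \<forall>h. cmod (dirderiv (F n) h x - D x h) \<le> e * norm h"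
      if e: "e > 0" for e
    proof -
      obtain N where N: "\<And>m n x h. m \<ge> N \<Longrightarrow> n \<ge> N \<Longrightarrow> x \<in> S \<Longrightarrow>
          cmod (dirderiv (F m) h x - dirderiv (F n) h x) \<le> e * norm h" using cau[OF e] by blast
      have "cmod (dirderiv (F n) h x - D x h) \<le> e * norm h" if "n \<ge> N" "x \<in> S" for n x h
      proof (rule tendsto_upperbound)
        show "(\<lambda>m. cmod (dirderiv (F n) h x - dirderiv (F m) h x)) \<longlonglongrightarrow> cmod (dirderiv (F n) h x - D x h)"
          by (intro tendsto_intros D that)
        show "\<forall>\<^sub>F m in sequentially. cmod (dirderiv (F n) h x - dirderiv (F m) h x) \<le> e * norm h"
          using that by (intro eventually_sequentiallyI[of N] N)
      qed auto
      then show ?thesis by (auto simp: eventually_sequentially)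
    qed
    show "z \<in> S" by fact
    show "(\<lambda>n. F n z) \<longlonglongrightarrow> g z"
      using tendsto_uniform_limitI[OF ulF] r by auto
  qed
  then obtain g' where g': "\<And>x. x \<in> S \<Longrightarrow> (\<lambda>n. F n x) \<longlonglongrightarrow> g' x"
    "\<And>x. x \<in> S \<Longrightarrow> (g' has_derivative D x) (at x within S)" by blast
  have "g' x = g x" if "x \<in> S" for x
    using LIMSEQ_unique[OF g'(1)[OF that] tendsto_uniform_limitI[OF ulF SU[OF that]]] .
  moreover have "(g' has_derivative D z) (at z)"
    using g'(2)[OF zS] zS by (simp add: S_def at_within_open[OF _ open_ball])
  ultimately have "(g has_derivative D z) (at z)"
    using has_derivative_transform_within_open[of g' "D z" z UNIV S g] zS by (simp add: S_def)
  moreover have "D z (c *s v) = c * D z v" for c v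
  proof -
    have "(\<lambda>n. dirderiv (F n) (c *s v) z) \<longlonglongrightarrow> D z (c *s v)" by (rule D[OF zS])
    moreover have "(\<lambda>n. dirderiv (F n) (c *s v) z) \<longlonglongrightarrow> c * D z v"
      unfolding analytic_in_derivative(2)[OF F SU[OF zS]] by (intro tendsto_intros D zS)
    ultimately show ?thesis by (rule LIMSEQ_unique)
  qed
  ultimately show "\<exists>D. (g has_derivative D) (at z) \<and> (\<forall>c v. D (c *s v) = c * D v)" by blast
qed


text \<open>
  The difference quotients of \<open>f\<close> in the direction \<open>v\<close> are analytic. By Taylor's theorem on complex lines
  they converge locally uniformly to the derivative, so Weierstrass' theorem applies.
\<close>

lemma analytic_in_dirderiv:
  assumes U: "open U" and f: "analytic_in U f"
  shows "analytic_in U (dirderiv f v)"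
proof (rule analytic_in_uniform_limit[OF U])
  define F where "F n z = of_nat (Suc n) * (f (z + (1 / of_nat (Suc n)) *s v) - f z)" for n z
  fix z assume "z \<in> U"
  then obtain r' where r': "r' > 0" "cball z r' \<subseteq> U" using U open_contains_cball by blast
  define r where "r = r' / 3"
  have r: "r > 0" "cball z (3 * r) \<subseteq> U" using r' by (simp_all add: r_def)
  have "compact (f ` cball z (3 * r))"
    using analytic_in_continuous_on[OF f] r(2) by (intro compact_continuous_image) (auto intro: continuous_on_subset)
  then obtain M where M: "\<And>w. w \<in> cball z (3 * r) \<Longrightarrow> cmod (f w) \<le> M"
    using compact_imp_bounded bounded_iff by (metis (no_types, lifting) imageI)
  \<comment> \<open>Adding \<open>1\<close> covers the case \<open>v = 0\<close>.\<close>
  define \<rho> where "\<rho> = r / (norm v + 1)"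
  have \<rho>: "\<rho> > 0" using r by (simp add: \<rho>_def add_nonneg_pos)
  have small: "norm (t *s v) \<le> c * r" if "cmod t \<le> c * \<rho>" "c \<ge> 0" for t c
  proof -
    have "norm (t *s v) \<le> c * \<rho> * (norm v + 1)"
      using that \<rho> by (auto intro!: mult_mono)
    also have "\<dots> = c * r" by (simp add: \<rho>_def add_nonneg_eq_0_iff)
    finally show ?thesis .
  qed
  have inside: "w + t *s v \<in> cball z (3 * r)" if "w \<in> ball z r" "cmod t \<le> 2 * \<rho>" for w t
  proof -
    have "dist z (w + t *s v) \<le> dist z w + norm (t *s v)"
      using norm_triangle_ineq4[of "z - w" "t *s v"] by (simp add: dist_norm algebra_simps)
    then show ?thesis using small[OF that(2)] that(1) r by simp
  qed
  have est: "cmod (f (w + t *s v) - (f w + dirderiv f v w * t)) \<le> 2 * M / \<rho>\<^sup>2 * (cmod t)\<^sup>2"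
    if w: "w \<in> ball z r" and t: "cmod t < \<rho>" for w t
  proof -
    define g where "g t = f (w + t *s v)" for t
    have hol: "g holomorphic_on ball 0 (2 * \<rho>)"
      unfolding g_def using inside[OF w] r by (intro analytic_in_slice_holomorphic[OF f]) auto
    have sub: "cball s \<rho> \<subseteq> ball 0 (2 * \<rho>)" if "s \<in> ball 0 \<rho>" for s
    proof
      fix x assume "x \<in> cball s \<rho>"
      then show "x \<in> ball 0 (2 * \<rho>)" using that dist_triangle[of 0 x s] by simp
    qed
    have b2: "cmod ((deriv ^^ 2) g s) \<le> 2 * M / \<rho>\<^sup>2" if s: "s \<in> ball 0 \<rho>" for s
    proof -
      have "cmod ((deriv ^^ 2) g s) \<le> fact 2 * M / \<rho> ^ 2"
      proof (rule Cauchy_inequality)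
        show "g holomorphic_on ball s \<rho>"
          using hol sub[OF s] ball_subset_cball holomorphic_on_subset by (metis subset_trans)
        show "continuous_on (cball s \<rho>) g"
          using hol sub[OF s] holomorphic_on_imp_continuous_on continuous_on_subset by blast
        fix x assume "cmod (s - x) = \<rho>"
        then have "x \<in> ball 0 (2 * \<rho>)" using sub[OF s] by (auto simp: dist_norm)
        then show "cmod (g x) \<le> M" unfolding g_def by (intro M inside[OF w]) auto
      qed (fact \<rho>)
      then show ?thesis by simp
    qed
    have "cmod ((deriv ^^ 0) g t - (\<Sum>i\<le>1. (deriv ^^ i) g 0 * (t - 0) ^ i / fact i))
        \<le> 2 * M / \<rho>\<^sup>2 * cmod (t - 0) ^ (Suc 1) / fact 1"
    proof (rule complex_Taylor[where S = "ball 0 \<rho>"])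
      fix i :: nat and x :: complex assume x: "x \<in> ball 0 \<rho>"
      have "((deriv ^^ i) g has_field_derivative (deriv ^^ Suc i) g x) (at x)"
        using x \<rho> by (intro has_field_derivative_higher_deriv[OF hol]) auto
      then show "((deriv ^^ i) g has_field_derivative (deriv ^^ Suc i) g x) (at x within ball 0 \<rho>)"
        by (rule has_field_derivative_at_within)
    qed (use b2 \<rho> t in \<open>auto simp: numeral_2_eq_2\<close>)
    moreover have "deriv g 0 = dirderiv f v w"
      unfolding g_def using DERIV_imp_deriv[OF analytic_in_slice[OF f, of w 0 v]] r inside[OF w, of 0] \<rho> by auto
    ultimately show ?thesis by (simp add: g_def power2_eq_square mult.assoc)
  qed
  have M0: "0 \<le> M" using M[of z] r norm_ge_zero order_trans by (metis centre_in_cball less_imp_le mult_pos_pos zero_less_numeral)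
  obtain N where N: "1 / real (Suc N) < \<rho>" using \<rho> nat_approx_posE by metis
  have tn: "cmod (1 / of_nat (Suc n)) < \<rho>" if "n \<ge> N" for n
  proof -
    have "1 / real (Suc n) \<le> 1 / real (Suc N)" using that by (simp add: frac_le)
    moreover have "cmod (1 / of_nat (Suc n)) = 1 / real (Suc n)" by (simp only: norm_divide norm_one norm_of_nat)
    ultimately show ?thesis using N by linarith
  qed
  have bound: "cmod (F n w - dirderiv f v w) \<le> 2 * M / \<rho>\<^sup>2 * (1 / real (Suc n))"
    if n: "n \<ge> N" and w: "w \<in> ball z r" for n w
  proof -
    define t :: complex where "t = 1 / of_nat (Suc n)"
    have nt: "of_nat (Suc n) * t = 1" "cmod t = 1 / real (Suc n)" unfolding t_def by (simp_all del: of_nat_Suc add: norm_divide)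
    have "F n w - dirderiv f v w = of_nat (Suc n) * (f (w + t *s v) - (f w + dirderiv f v w * t))"
      using nt(1) unfolding F_def t_def[symmetric] by (simp add: algebra_simps del: of_nat_Suc)
    then have "cmod (F n w - dirderiv f v w) = real (Suc n) * cmod (f (w + t *s v) - (f w + dirderiv f v w * t))"
      by (simp only: norm_mult norm_of_nat)
    also have "\<dots> \<le> real (Suc n) * (2 * M / \<rho>\<^sup>2 * (cmod t)\<^sup>2)"
      using est[OF w, of t] tn[OF n] unfolding t_def[symmetric] by (intro mult_left_mono) auto
    also have "\<dots> = 2 * M / \<rho>\<^sup>2 * (1 / real (Suc n))"
      unfolding nt(2) by (simp add: power2_eq_square del: of_nat_Suc)
    finally show ?thesis .
  qed
  have "ball z r \<subseteq> U" using r by auto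
  moreover have "\<forall>\<^sub>F n in sequentially. analytic_in (ball z r) (F n)"
  proof (rule eventually_sequentiallyI[of N])
    fix n assume n: "N \<le> n"
    have "analytic_in (ball z r) (\<lambda>w. f ((1 / of_nat (Suc n)) *s v + 1 *s w))"
      using inside[of _ "1 / of_nat (Suc n)"] tn[OF n] \<rho> r
      by (intro analytic_in_affine[OF f]) (auto simp: add.commute)
    then have "analytic_in (ball z r) (\<lambda>w. f (w + (1 / of_nat (Suc n)) *s v))" by (simp add: add.commute)
    then show "analytic_in (ball z r) (F n)"
      unfolding F_def using analytic_in_subset[OF f \<open>ball z r \<subseteq> U\<close>] by (intro analytic_in_cmult analytic_in_diff)
  qed
  moreover have "uniform_limit (ball z r) F (dirderiv f v) sequentially"
    unfolding uniform_limit_iff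
  proof (intro allI impI)
    fix e :: real assume "e > 0"
    have "(\<lambda>n. 2 * M / \<rho>\<^sup>2 * (1 / real (Suc n))) \<longlonglongrightarrow> 2 * M / \<rho>\<^sup>2 * 0"
      by (intro tendsto_intros LIMSEQ_Suc[OF lim_1_over_n])
    then have "\<forall>\<^sub>F n in sequentially. 2 * M / \<rho>\<^sup>2 * (1 / real (Suc n)) < e"
      using \<open>e > 0\<close> by (intro order_tendstoD) auto
    then show "\<forall>\<^sub>F n in sequentially. \<forall>x\<in>ball z r. dist (F n x) (dirderiv f v x) < e"
      using eventually_ge_at_top[of N]
    proof eventually_elim
      case (elim n)
      show ?case
      proof
        fix x assume "x \<in> ball z r"
        from le_less_trans[OF bound[OF elim(2) this] elim(1)] show "dist (F n x) (dirderiv f v x) < e"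
          by (simp only: dist_norm)
      qed
    qed
  qed
  ultimately show "\<exists>r>0. ball z r \<subseteq> U \<and> (\<forall>\<^sub>F n in sequentially. analytic_in (ball z r) (F n)) \<and>
      uniform_limit (ball z r) F (dirderiv f v) sequentially"
    using r(1) by blast
qed

lemma dirderiv_expand:
  assumes "analytic_in U f" "w \<in> U"
  shows "dirderiv f v w = (\<Sum>i\<in>UNIV. v $ i * dirderiv f (axis i 1) w)"
proof -
  have lin: "linear (\<lambda>v. dirderiv f v w)"
    using has_derivative_bounded_linear[OF analytic_in_derivative(1)[OF assms]] bounded_linear.linear by blast
  have "dirderiv f v w = dirderiv f (\<Sum>i\<in>UNIV. v $ i *s axis i 1) w" by (simp only: basis_expansion)
  also have "\<dots> = (\<Sum>i\<in>UNIV. v $ i * dirderiv f (axis i 1) w)"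
    by (simp add: linear_sum[OF lin] analytic_in_derivative(2)[OF assms])
  finally show ?thesis .
qed

text \<open>
  The component of degree \<open>m\<close> in the expansion of \<open>f\<close> at \<open>0\<close> into homogeneous polynomials. The recursion
  comes from Euler's formula: the derivative of \<open>t \<mapsto> f(t z)\<close> is \<open>\<Sum>\<^sub>i z\<^sub>i \<partial>\<^sub>i f(t z)\<close>, so the component of
  degree \<open>m + 1\<close> of \<open>f\<close> is \<open>1 / (m + 1)\<close> times the sum of \<open>z\<^sub>i\<close> times the component of
  degree \<open>m\<close> of \<open>\<partial>\<^sub>i f\<close>. Read as a definition, it shows that the components are polynomials.
\<close>

primrec taylor_part :: "nat \<Rightarrow> (complex ^ ('n::finite) \<Rightarrow> complex) \<Rightarrow> 'n cpoly" where
  "taylor_part 0 f = pconst (f 0)"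
| "taylor_part (Suc m) f =
     pconst (1 / of_nat (Suc m)) * (\<Sum>i\<in>UNIV. pvar i * taylor_part m (dirderiv f (axis i 1)))"

lemma taylor_part_homogeneous: "peval (taylor_part m f) (c *s z) = c ^ m * peval (taylor_part m f) z"
proof (induction m arbitrary: f)
  case (Suc m)
  show ?case by (simp add: Suc.IH sum_distrib_left mult_ac)
qed simp

lemma higher_deriv_sum:
  assumes "\<And>i. i \<in> A \<Longrightarrow> g i holomorphic_on S" "open S" "z \<in> S"
  shows "(deriv ^^ n) (\<lambda>w. \<Sum>i\<in>A. g i w) z = (\<Sum>i\<in>A. (deriv ^^ n) (g i) z)"
  using assms(1)
proof (induction A rule: infinite_finite_induct)
  case (insert i A)
  then show ?case
    using higher_deriv_add[of "g i" S "\<lambda>w. \<Sum>i\<in>A. g i w" z n] assms(2,3)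
    by (simp add: holomorphic_on_sum)
qed auto

lemma slice_higher_deriv:
  assumes "analytic_in (ball 0 1) f"
  shows "(deriv ^^ m) (\<lambda>t. f (t *s z)) 0 = fact m * peval (taylor_part m f) z"
  using assms
proof (induction m arbitrary: f)
  case (Suc m)
  define T where "T = {t::complex. norm (t *s z) < 1}"
  have T: "open T" "0 \<in> T" unfolding T_def by (auto intro!: open_Collect_less continuous_intros)
  have TB: "0 + t *s z \<in> ball 0 1" if "t \<in> T" for t using that by (simp add: T_def)
  have pc: "analytic_in (ball 0 1) (dirderiv f (axis i 1))" for i
    by (rule analytic_in_dirderiv[OF open_ball Suc.prems])
  have hol: "(\<lambda>t. g (t *s z)) holomorphic_on T" if "analytic_in (ball 0 1) g" for g
    using analytic_in_slice_holomorphic[OF that TB] by simp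
  have der: "deriv (\<lambda>t. f (t *s z)) t = (\<Sum>i\<in>UNIV. z $ i * dirderiv f (axis i 1) (t *s z))"
    if "t \<in> T" for t
    using DERIV_imp_deriv[OF analytic_in_slice[OF Suc.prems TB[OF that]]]
      dirderiv_expand[OF Suc.prems TB[OF that], of z] by simp
  have "(deriv ^^ Suc m) (\<lambda>t. f (t *s z)) 0 = (deriv ^^ m) (deriv (\<lambda>t. f (t *s z))) 0"
    by (simp only: funpow_Suc_right o_def)
  also have "\<dots> = (deriv ^^ m) (\<lambda>t. \<Sum>i\<in>UNIV. z $ i * dirderiv f (axis i 1) (t *s z)) 0"
    using der T hol[OF Suc.prems] hol[OF pc]
    by (intro higher_deriv_transform_within_open[of _ T])
       (auto intro!: holomorphic_intros holomorphic_deriv)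
  also have "\<dots> = (\<Sum>i\<in>UNIV. (deriv ^^ m) (\<lambda>t. z $ i * dirderiv f (axis i 1) (t *s z)) 0)"
    using T hol[OF pc] by (intro higher_deriv_sum[of _ _ T]) (auto intro!: holomorphic_intros)
  also have "\<dots> = (\<Sum>i\<in>UNIV. z $ i * (fact m * peval (taylor_part m (dirderiv f (axis i 1))) z))"
    by (intro sum.cong refl) (simp add: higher_deriv_cmult[OF hol[OF pc] T(2,1)] Suc.IH[OF pc])
  also have "\<dots> = fact (Suc m) * peval (taylor_part (Suc m) f) z"
    by (simp add: sum_distrib_left mult_ac del: of_nat_Suc)
  finally show ?case .
qed simp

lemma taylor_part_sums:
  assumes f: "analytic_in (ball 0 1) f" and z: "norm z < 1"
  shows "(\<lambda>m. peval (taylor_part m f) z) sums f z"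
proof -
  \<comment> \<open>A radius larger than \<open>1\<close> with \<open>r |z| < 1\<close>.\<close>
  define r where "r = 2 / (1 + norm z)"
  have pos: "1 + norm z > 0" by (simp add: add_pos_nonneg)
  have r: "r > 1" using z pos by (simp add: r_def)
  have "0 + t *s z \<in> ball 0 1" if "t \<in> ball 0 r" for t
  proof -
    have "cmod t * norm z \<le> r * norm z" using that by (auto intro!: mult_right_mono)
    also have "\<dots> < 1" using z pos by (simp add: r_def divide_simps)
    finally show ?thesis by simp
  qed
  then have "(\<lambda>t. f (0 + t *s z)) holomorphic_on ball 0 r" by (rule analytic_in_slice_holomorphic[OF f])
  then have "(\<lambda>t. f (t *s z)) holomorphic_on ball 0 r" by simp
  from holomorphic_power_series[OF this, of 1] r
  show ?thesis by (simp add: slice_higher_deriv[OF f])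
qed

text \<open>
  Cauchy's inequality for \<open>t \<mapsto> f(t z)\<close> on the disc of radius \<open>s' / s\<close>.
\<close>

lemma taylor_part_bound:
  assumes f: "analytic_in (ball 0 1) f" and s: "0 < s" "s < s'" "s' < 1" and z: "norm z \<le> s"
    and M: "\<And>w. w \<in> cball 0 s' \<Longrightarrow> cmod (f w) \<le> M"
  shows "cmod (peval (taylor_part m f) z) \<le> M * (s / s') ^ m"
proof -
  define r where "r = s' / s"
  have r: "r > 0" using s by (simp add: r_def)
  have inb: "t *s z \<in> cball 0 s'" if "cmod t \<le> r" for t
  proof -
    have "cmod t * norm z \<le> r * s" using that z r by (intro mult_mono) auto
    then show ?thesis using s by (simp add: r_def)
  qed
  have "0 + t *s z \<in> ball 0 1" if "t \<in> cball 0 r" for t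
    using inb[of t] that s by auto
  then have "(\<lambda>t. f (0 + t *s z)) holomorphic_on cball 0 r" by (rule analytic_in_slice_holomorphic[OF f])
  then have hol: "(\<lambda>t. f (t *s z)) holomorphic_on cball 0 r" by simp
  have "cmod ((deriv ^^ m) (\<lambda>t. f (t *s z)) 0) \<le> fact m * M / r ^ m"
  proof (rule Cauchy_inequality)
    show "(\<lambda>t. f (t *s z)) holomorphic_on ball 0 r"
      using hol ball_subset_cball holomorphic_on_subset by blast
    show "continuous_on (cball 0 r) (\<lambda>t. f (t *s z))" using hol by (rule holomorphic_on_imp_continuous_on)
    show "cmod (f (x *s z)) \<le> M" if "cmod (0 - x) = r" for x using that by (intro M inb) auto
  qed (fact r)
  then have "fact m * cmod (peval (taylor_part m f) z) \<le> fact m * (M / r ^ m)"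
    by (simp add: slice_higher_deriv[OF f] norm_mult)
  then have "cmod (peval (taylor_part m f) z) \<le> M / r ^ m"
    by (rule mult_left_le_imp_le[OF _ fact_gt_zero])
  then show ?thesis using s by (simp add: r_def power_divide)
qed


section \<open>Rotation invariance of Lebesgue measure on the ball\<close>

lemma nn_integral_lborel_translate:
  fixes b :: "'a::euclidean_space"
  assumes [measurable]: "f \<in> borel_measurable borel"
  shows "(\<integral>\<^sup>+x. f (x + b) \<partial>lborel) = (\<integral>\<^sup>+x. f x \<partial>lborel)"
proof -
  have "(\<integral>\<^sup>+x. f x \<partial>lborel) = (\<integral>\<^sup>+x. f x \<partial>distr lborel borel ((+) b))"
    by (simp add: lborel_distr_plus)
  also have "\<dots> = (\<integral>\<^sup>+x. f (b + x) \<partial>lborel)" by (simp add: nn_integral_distr)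
  finally show ?thesis by (simp add: add.commute)
qed

lemma emeasure_lborel_ball_nonzero:
  "r > 0 \<Longrightarrow> emeasure lborel (ball (c::'a::euclidean_space) r) \<noteq> 0"
proof -
  assume r: "r > 0"
  have "unit_ball_vol (real DIM('a)) > 0" by (rule unit_ball_vol_pos) simp
  then have "unit_ball_vol (real DIM('a)) \<noteq> 0" by linarith
  then show ?thesis using r by (simp add: emeasure_ball)
qed

text \<open>
  The argument for the uniqueness of Haar measure: integrate \<open>1\<^sub>A(T x + y) 1\<^sub>B(y)\<close>, where \<open>B\<close>
  is the unit ball, in both orders.
\<close>

lemma lborel_distr_isometry:
  fixes T :: "'a::euclidean_space \<Rightarrow> 'a"
  assumes lin: "linear T" and iso: "\<And>x. norm (T x) = norm x"
  shows "distr lborel borel T = lborel"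
proof (rule measure_eqI)
  have "continuous_on UNIV T" using lin linear_continuous_on linear_conv_bounded_linear by blast
  then have mT [measurable]: "T \<in> borel_measurable borel"
    by (rule borel_measurable_continuous_onI)
  have "inj T" using iso lin by (metis linear_injective_0 norm_eq_zero)
  then have "surj T" using lin linear_injective_imp_surjective by blast
  fix A assume "A \<in> sets (distr lborel borel T)"
  then have A [measurable]: "A \<in> sets borel" by simp
  define B where "B = ball (0::'a) 1"
  have B [measurable]: "B \<in> sets borel" by (simp add: B_def)
  have Bc: "emeasure lborel (ball b 1) = emeasure lborel B" for b :: 'a
    by (simp add: B_def emeasure_ball)
  have B0: "emeasure lborel B \<noteq> 0" "emeasure lborel B \<noteq> \<infinity>"
    using emeasure_lborel_ball_finite[of "0::'a" 1] emeasure_lborel_ball_nonzero[of 1 "0::'a"] by (auto simp: B_def)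
  have "emeasure lborel (T -` A) * emeasure lborel B =
      (\<integral>\<^sup>+y. (\<integral>\<^sup>+x. indicator A (T x) \<partial>lborel) * indicator B y \<partial>lborel)"
  proof -
    have "(\<integral>\<^sup>+x. indicator A (T x) \<partial>lborel) = (\<integral>\<^sup>+x. indicator (T -` A) x \<partial>lborel)"
      by (simp add: indicator_def)
    also have "\<dots> = emeasure lborel (T -` A)"
      using measurable_sets[OF mT A] by simp
    finally show ?thesis by (simp add: nn_integral_cmult_indicator)
  qed
  also have "\<dots> = (\<integral>\<^sup>+y. (\<integral>\<^sup>+x. indicator A (T x + y) \<partial>lborel) * indicator B y \<partial>lborel)"
  proof (rule nn_integral_cong)
    fix y
    obtain b where b: "y = T b" using \<open>surj T\<close> by blast
    have "(\<integral>\<^sup>+x. indicator A (T x + y) \<partial>lborel) = (\<integral>\<^sup>+x. indicator A (T (x + b)) \<partial>lborel)"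
      by (simp add: b linear_add[OF lin])
    also have "\<dots> = (\<integral>\<^sup>+x. indicator A (T x) \<partial>lborel)"
      by (rule nn_integral_lborel_translate) simp
    finally show "(\<integral>\<^sup>+x. indicator A (T x) \<partial>lborel) * indicator B y =
        (\<integral>\<^sup>+x. indicator A (T x + y) \<partial>lborel) * indicator B y" by simp
  qed
  also have "\<dots> = (\<integral>\<^sup>+y. (\<integral>\<^sup>+x. indicator A (T x + y) * indicator B y \<partial>lborel) \<partial>lborel)"
    by (simp add: nn_integral_multc)
  also have "\<dots> = (\<integral>\<^sup>+x. (\<integral>\<^sup>+y. indicator A (T x + y) * indicator B y \<partial>lborel) \<partial>lborel)"
    by (rule lborel_pair.Fubini') measurable
  also have "\<dots> = (\<integral>\<^sup>+x. (\<integral>\<^sup>+y. indicator A y * indicator B (y - T x) \<partial>lborel) \<partial>lborel)"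
  proof (rule nn_integral_cong)
    fix x
    show "(\<integral>\<^sup>+y. indicator A (T x + y) * indicator B y \<partial>lborel) =
        (\<integral>\<^sup>+y. indicator A y * indicator B (y - T x) \<partial>lborel)"
      using nn_integral_lborel_translate[of "\<lambda>y. indicator A y * indicator B (y - T x)" "T x"]
      by (simp add: add.commute)
  qed
  also have "\<dots> = (\<integral>\<^sup>+y. (\<integral>\<^sup>+x. indicator A y * indicator B (y - T x) \<partial>lborel) \<partial>lborel)"
    by (rule lborel_pair.Fubini'[symmetric]) measurable
  also have "\<dots> = (\<integral>\<^sup>+y. indicator A y * emeasure lborel B \<partial>lborel)"
  proof (rule nn_integral_cong)
    fix y
    obtain b where b: "y = T b" using \<open>surj T\<close> by blast
    have "indicator B (y - T x) = (indicator (ball b 1) x :: ennreal)" for x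
      by (simp add: b linear_diff[OF lin, symmetric] iso indicator_def dist_norm B_def)
    then have "(\<integral>\<^sup>+x. indicator B (y - T x) \<partial>lborel) = emeasure lborel B"
      by (simp add: Bc)
    then show "(\<integral>\<^sup>+x. indicator A y * indicator B (y - T x) \<partial>lborel) = indicator A y * emeasure lborel B"
      by (simp add: nn_integral_cmult)
  qed
  also have "\<dots> = emeasure lborel A * emeasure lborel B" by (simp add: nn_integral_multc)
  finally have "emeasure lborel (T -` A) = emeasure lborel A"
    using B0 by (simp add: ennreal_mult_cancel_left mult.commute[of _ "emeasure lborel B"])
  then show "emeasure (distr lborel borel T) A = emeasure lborel A"
    by (simp add: emeasure_distr)
qed simp

lemma sets_ball_measure [simp, measurable_cong]: "sets ball_measure = sets borel"
  by (simp add: ball_measure_def)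

lemma space_ball_measure [simp]: "space ball_measure = UNIV"
  by (simp add: ball_measure_def)

lemma emeasure_ball_measure_UNIV: "emeasure ball_measure (UNIV :: (complex ^ 'n::finite) set) = 1"
  using emeasure_lborel_ball_pos emeasure_lborel_ball_finite[of "0 :: complex ^ 'n" 1]
  unfolding ball_measure_def by (subst emeasure_uniform_measure) (auto intro!: ennreal_divide_self)

lemma finite_measure_ball_measure: "finite_measure (ball_measure :: (complex ^ 'n::finite) measure)"
  by (rule finite_measureI) (simp add: emeasure_ball_measure_UNIV)

lemma nn_integral_ball_measure:
  fixes f :: "complex ^ ('n::finite) \<Rightarrow> ennreal"
  assumes "f \<in> borel_measurable borel"
  shows "(\<integral>\<^sup>+z. f z \<partial>ball_measure) =
    (\<integral>\<^sup>+z. f z * indicator (ball 0 1) z \<partial>lborel) / emeasure lborel (ball (0::complex ^ 'n) 1)"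
  unfolding ball_measure_def using assms by (intro nn_integral_uniform_measure) auto

lemma ball_measure_isometry:
  fixes T :: "complex ^ ('n::finite) \<Rightarrow> complex ^ 'n"
  assumes lin: "linear T" and iso: "\<And>x. norm (T x) = norm x"
  shows "distr ball_measure borel T = ball_measure"
proof (rule measure_eqI)
  have "continuous_on UNIV T" using lin linear_continuous_on linear_conv_bounded_linear by blast
  then have mT [measurable]: "T \<in> borel_measurable borel"
    by (rule borel_measurable_continuous_onI)
  fix A assume "A \<in> sets (distr ball_measure borel T)"
  then have A [measurable]: "A \<in> sets borel" by simp
  have pre: "ball 0 1 \<inter> T -` A = T -` (ball 0 1 \<inter> A)" using iso by auto
  have "emeasure lborel (T -` (ball 0 1 \<inter> A)) = emeasure (distr lborel borel T) (ball 0 1 \<inter> A)"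
    by (subst emeasure_distr) auto
  then have "emeasure lborel (T -` (ball 0 1 \<inter> A)) = emeasure lborel (ball 0 1 \<inter> A)"
    by (simp add: lborel_distr_isometry[OF assms])
  then show "emeasure (distr ball_measure borel T) A = emeasure ball_measure A"
    using measurable_sets[OF mT A]
    by (subst emeasure_distr) (auto simp: ball_measure_def pre)
qed simp

lemma integral_ball_measure_isometry:
  fixes T :: "complex ^ ('n::finite) \<Rightarrow> complex ^ 'n" and f :: "complex ^ 'n \<Rightarrow> complex"
  assumes lin: "linear T" and iso: "\<And>x. norm (T x) = norm x" and f: "f \<in> borel_measurable borel"
  shows "(LINT z|ball_measure. f (T z)) = (LINT z|ball_measure. f z)"
proof -
  have "continuous_on UNIV T" using lin linear_continuous_on linear_conv_bounded_linear by blast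
  then have mT: "T \<in> borel_measurable ball_measure"
    using borel_measurable_continuous_onI by (simp cong: measurable_cong_sets)
  show ?thesis
    using integral_distr[OF mT f] by (simp add: ball_measure_isometry[OF lin iso])
qed

text \<open>
  A function that a unitary multiplies by a factor other than \<open>1\<close> has integral \<open>0\<close>. This is the
  source of all orthogonality relations below.
\<close>

lemma integral_ball_measure_eigen:
  fixes T :: "complex ^ ('n::finite) \<Rightarrow> complex ^ 'n" and f :: "complex ^ 'n \<Rightarrow> complex"
  assumes "linear T" "\<And>x. norm (T x) = norm x" "f \<in> borel_measurable borel"
    and "\<And>z. f (T z) = c * f z" "c \<noteq> 1"
  shows "(LINT z|ball_measure. f z) = 0"
proof -
  have "(LINT z|ball_measure. f z) = c * (LINT z|ball_measure. f z)"
    using integral_ball_measure_isometry[OF assms(1-3)] assms(4) by simp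
  then show ?thesis using assms(5) by simp
qed

lemma continuous_on_peval [continuous_intros]: "continuous_on A (peval p)"
  unfolding peval_def by (intro continuous_intros)

lemma borel_measurable_peval [measurable]: "peval p \<in> borel_measurable borel"
  by (intro borel_measurable_continuous_onI continuous_intros)

text \<open>The rotation by the angle \<open>\<pi> / (j - k)\<close>.\<close>

lemma exists_rotation_separating_degrees:
  assumes "j \<noteq> k"
  shows "\<exists>c. cmod c = 1 \<and> c ^ j * cnj (c ^ k) = -1"
proof -
  define \<theta> where "\<theta> = pi / (real j - real k)"
  have \<theta>: "(real j - real k) * \<theta> = pi" using assms by (simp add: \<theta>_def)
  have "cis \<theta> ^ j * cnj (cis \<theta> ^ k) = cis (real j * \<theta>) * cis (- (real k * \<theta>))"
    by (simp only: complex_cnj_power cis_cnj Complex.DeMoivre mult_minus_right)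
  also have "\<dots> = cis pi" by (simp add: cis_mult \<theta>[symmetric] algebra_simps)
  finally show ?thesis by (intro exI[of _ "cis \<theta>"]) simp
qed

lemma integral_homogeneous_orthogonal:
  fixes p q :: "('n::finite) cpoly"
  assumes p: "\<And>c z. peval p (c *s z) = c ^ j * peval p z"
    and q: "\<And>c z. peval q (c *s z) = c ^ k * peval q z" and jk: "j \<noteq> k"
  shows "(LINT z|ball_measure. indicator (ball 0 s) z *\<^sub>R (peval p z * cnj (peval q z))) = 0"
proof -
  obtain c :: complex where c: "cmod c = 1" and cj: "c ^ j * cnj (c ^ k) = -1"
    using exists_rotation_separating_degrees[OF jk] by blast
  show ?thesis
  proof (rule integral_ball_measure_eigen[where T = "\<lambda>z. c *s z" and c = "-1"])
    show "linear (\<lambda>z. c *s (z :: complex ^ 'n))"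
      using bounded_linear_vec_scalar_mult_right bounded_linear.linear by blast
    have "(c ^ j * peval p z) * cnj (c ^ k * peval q z) = - (peval p z * cnj (peval q z))" for z
    proof -
      have "(c ^ j * peval p z) * cnj (c ^ k * peval q z) =
          (c ^ j * cnj (c ^ k)) * (peval p z * cnj (peval q z))" by simp
      then show ?thesis unfolding cj by simp
    qed
    then show "indicator (ball 0 s) (c *s z) *\<^sub>R (peval p (c *s z) * cnj (peval q (c *s z))) =
        -1 * (indicator (ball 0 s) z *\<^sub>R (peval p z * cnj (peval q z)))" for z
      unfolding p q by (simp add: indicator_def c)
    show "(\<lambda>z. indicator (ball 0 s) z *\<^sub>R (peval p z * cnj (peval q z))) \<in> borel_measurable borel"
      by (intro borel_measurable_continuous_on_indicator continuous_intros) auto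
  qed (auto simp: c)
qed

text \<open>
  On a smaller concentric ball the homogeneous expansion converges uniformly, and integration against
  a homogeneous polynomial selects the component of the same degree.
\<close>

lemma integral_against_homogeneous:
  fixes f :: "complex ^ ('n::finite) \<Rightarrow> complex"
  assumes f: "analytic_in (ball 0 1) f" and s: "0 < s" "s < 1"
    and q: "\<And>c z. peval q (c *s z) = c ^ k * peval q z"
  shows "integrable ball_measure (\<lambda>z. indicator (ball 0 s) z *\<^sub>R (f z * cnj (peval q z)))" (is ?int)
    and "(LINT z|ball_measure. indicator (ball 0 s) z *\<^sub>R (f z * cnj (peval q z))) =
      (LINT z|ball_measure. indicator (ball 0 s) z *\<^sub>R (peval (taylor_part k f) z * cnj (peval q z)))"
      (is ?eq)
proof -
  interpret finite_measure "ball_measure :: (complex ^ 'n) measure"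
    by (rule finite_measure_ball_measure)
  \<comment> \<open>The series is dominated by a geometric series with ratio \<open>s / s'\<close>.\<close>
  define s' where "s' = (s + 1) / 2"
  have s': "s < s'" "s' < 1" using s by (simp_all add: s'_def)
  have sub: "cball 0 s' \<subseteq> (ball 0 1 :: (complex ^ 'n) set)" using s' by auto
  have "compact (f ` cball 0 s')"
    using analytic_in_continuous_on[OF f] sub by (intro compact_continuous_image) (auto intro: continuous_on_subset)
  then obtain M where M: "\<And>w. w \<in> cball 0 s' \<Longrightarrow> cmod (f w) \<le> M"
    using compact_imp_bounded bounded_iff by (metis (no_types, lifting) imageI)
  have "cmod (f 0) \<le> M" using s s' by (intro M) auto
  then have M0: "M \<ge> 0" by (rule order_trans[OF norm_ge_zero])
  obtain B where B: "\<And>z. z \<in> ball 0 1 \<Longrightarrow> cmod (peval q z) \<le> B" using bounded_peval by blast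
  have "cmod (peval q 0) \<le> B" by (intro B) auto
  then have B0: "B \<ge> 0" by (rule order_trans[OF norm_ge_zero])
  define P where "P m z = peval (taylor_part m f) z" for m z
  define h where "h z = indicator (ball 0 s) z *\<^sub>R (f z * cnj (peval q z))" for z
  define S where "S N z = indicator (ball 0 s) z *\<^sub>R ((\<Sum>m<N. P m z) * cnj (peval q z))" for N z
  define \<kappa> where "\<kappa> = s / s'"
  have \<kappa>: "0 < \<kappa>" "\<kappa> < 1" using s s' by (simp_all add: \<kappa>_def)
  have Pb: "cmod (P m z) \<le> M * \<kappa> ^ m" if "z \<in> ball 0 s" for m z
    unfolding P_def \<kappa>_def using taylor_part_bound[OF f s(1) s' _ M] that by simp
  have meas_h: "h \<in> borel_measurable ball_measure"
  proof -
    have "continuous_on (ball 0 s) f"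
      using analytic_in_continuous_on[OF f] s by (auto intro: continuous_on_subset)
    then have "(\<lambda>z. indicator (ball 0 s) z *\<^sub>R (f z * cnj (peval q z))) \<in> borel_measurable borel"
      by (intro borel_measurable_continuous_on_indicator continuous_intros) auto
    then show ?thesis unfolding h_def by (simp cong: measurable_cong_sets)
  qed
  have meas1: "(\<lambda>z. indicator (ball 0 s) z *\<^sub>R (P m z * cnj (peval q z))) \<in> borel_measurable ball_measure" for m
  proof -
    have "(\<lambda>z. indicator (ball 0 s) z *\<^sub>R (P m z * cnj (peval q z))) \<in> borel_measurable borel"
      unfolding P_def by (intro borel_measurable_continuous_on_indicator continuous_intros) auto
    then show ?thesis by (simp cong: measurable_cong_sets)
  qed
  have int1: "integrable ball_measure (\<lambda>z. indicator (ball 0 s) z *\<^sub>R (P m z * cnj (peval q z)))" for m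
  proof (rule integrable_const_bound[of _ "M * B"])
    have "norm (indicator (ball 0 s) z *\<^sub>R (P m z * cnj (peval q z))) \<le> M * B" for z
    proof (cases "z \<in> ball 0 s")
      case True
      have "cmod (P m z) \<le> M * \<kappa> ^ m" by (rule Pb[OF True])
      also have "\<dots> \<le> M * 1" using M0 \<kappa> by (intro mult_left_mono power_le_one) auto
      finally have "cmod (P m z) * cmod (peval q z) \<le> M * B"
        using B[of z] True s M0 by (intro mult_mono) auto
      then show ?thesis using True by (simp add: norm_mult)
    qed (use M0 B0 in auto)
    then show "AE z in ball_measure. norm (indicator (ball 0 s) z *\<^sub>R (P m z * cnj (peval q z))) \<le> M * B"
      by blast
  qed (rule meas1)
  have Ssum: "S N z = (\<Sum>m<N. indicator (ball 0 s) z *\<^sub>R (P m z * cnj (peval q z)))" for N z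
    by (simp add: S_def sum_distrib_right scaleR_sum_right)
  have lim: "(\<lambda>N. S N z) \<longlonglongrightarrow> h z" for z
  proof (cases "z \<in> ball 0 s")
    case True
    have "(\<lambda>N. \<Sum>m<N. P m z) \<longlonglongrightarrow> f z"
      using taylor_part_sums[OF f, of z] True s unfolding P_def sums_def by simp
    then have "(\<lambda>N. (\<Sum>m<N. P m z) * cnj (peval q z)) \<longlonglongrightarrow> f z * cnj (peval q z)"
      by (intro tendsto_intros)
    then show ?thesis using True by (simp add: S_def h_def)
  qed (simp add: S_def h_def)
  define C where "C = M * (1 / (1 - \<kappa>)) * B"
  have C0: "C \<ge> 0" using M0 B0 \<kappa> by (simp add: C_def)
  have Sb: "norm (S N z) \<le> C" for N z
  proof (cases "z \<in> ball 0 s")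
    case True
    have "cmod (\<Sum>m<N. P m z) \<le> (\<Sum>m<N. M * \<kappa> ^ m)"
      by (intro sum_norm_le Pb True)
    also have "\<dots> = M * (\<Sum>m<N. \<kappa> ^ m)" by (simp add: sum_distrib_left)
    also have "\<dots> \<le> M * suminf ((^) \<kappa>)"
      using M0 \<kappa> by (intro mult_left_mono sum_le_suminf summable_geometric) auto
    also have "suminf ((^) \<kappa>) = 1 / (1 - \<kappa>)" using \<kappa> by (intro suminf_geometric) auto
    finally have "cmod (\<Sum>m<N. P m z) * cmod (peval q z) \<le> M * (1 / (1 - \<kappa>)) * B"
      using B[of z] True s M0 \<kappa> by (intro mult_mono) auto
    then show ?thesis using True by (simp add: S_def C_def norm_mult)
  qed (simp add: S_def C0)
  have intC: "integrable ball_measure (\<lambda>z::complex ^ 'n. C)" by simp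
  have measS: "S N \<in> borel_measurable ball_measure" for N
    unfolding Ssum using meas1 by measurable
  have AElim: "AE z in ball_measure. (\<lambda>N. S N z) \<longlonglongrightarrow> h z" using lim by simp
  have AEb: "AE z in ball_measure. norm (S N z) \<le> C" for N using Sb by simp
  show ?int
    using integrable_dominated_convergence[OF meas_h measS intC AElim AEb] unfolding h_def .
  have conv: "(\<lambda>N. LINT z|ball_measure. S N z) \<longlonglongrightarrow> (LINT z|ball_measure. h z)"
    by (rule integral_dominated_convergence[OF meas_h measS intC AElim AEb])
  have comp: "(LINT z|ball_measure. indicator (ball 0 s) z *\<^sub>R (P m z * cnj (peval q z))) = 0"
    if "m \<noteq> k" for m
    unfolding P_def using that by (intro integral_homogeneous_orthogonal[OF taylor_part_homogeneous q])
  have "(LINT z|ball_measure. S N z) =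
      (LINT z|ball_measure. indicator (ball 0 s) z *\<^sub>R (P k z * cnj (peval q z)))" if "N > k" for N
  proof -
    have "(LINT z|ball_measure. S N z) =
        (\<Sum>m<N. LINT z|ball_measure. indicator (ball 0 s) z *\<^sub>R (P m z * cnj (peval q z)))"
      unfolding Ssum by (rule Bochner_Integration.integral_sum) (rule int1)
    also have "\<dots> = (\<Sum>m\<in>{k}. LINT z|ball_measure. indicator (ball 0 s) z *\<^sub>R (P m z * cnj (peval q z)))"
      using that comp by (intro sum.mono_neutral_right) auto
    finally show ?thesis by simp
  qed
  then have "(\<lambda>N. LINT z|ball_measure. S N z) \<longlonglongrightarrow>
      (LINT z|ball_measure. indicator (ball 0 s) z *\<^sub>R (P k z * cnj (peval q z)))"
    by (intro tendsto_eventually eventually_sequentiallyI[of "Suc k"]) auto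
  from LIMSEQ_unique[OF conv this] show ?eq by (simp only: h_def P_def)
qed

section \<open>Mean value property and point evaluations\<close>

lemma measure_small_ball_pos:
  assumes "0 < s"
  shows "measure ball_measure (ball (0::complex ^ ('n::finite)) s) > 0"
proof -
  interpret finite_measure "ball_measure :: (complex ^ 'n) measure"
    by (rule finite_measure_ball_measure)
  have "ball 0 1 \<inter> ball (0::complex ^ 'n) s = ball 0 (min 1 s)" by auto
  then have "emeasure ball_measure (ball (0::complex ^ 'n) s) =
      emeasure lborel (ball (0::complex ^ 'n) (min 1 s)) / emeasure lborel (ball (0::complex ^ 'n) 1)"
    by (simp add: ball_measure_def)
  also have "\<dots> \<noteq> 0"
    using assms emeasure_lborel_ball_nonzero[of "min 1 s" "0::complex ^ 'n"]
      emeasure_lborel_ball_finite[of "0::complex ^ 'n" 1]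
    by (auto simp: ennreal_divide_eq_0_iff)
  finally show ?thesis by (simp add: emeasure_eq_measure zero_less_measure_iff)
qed

text \<open>
  The mean value property: only the constant term of the homogeneous expansion has a nonzero integral over
  the ball of radius \<open>s\<close>.
\<close>

lemma mean_value_bound:
  fixes f :: "complex ^ ('n::finite) \<Rightarrow> complex"
  assumes f: "analytic_in (ball 0 1) f" and s: "0 < s" "s < 1"
  shows "ennreal (cmod (f 0) * measure ball_measure (ball (0::complex ^ 'n) s)) \<le>
    (\<integral>\<^sup>+z. ennreal (cmod (f z)) * indicator (ball 0 s) z \<partial>ball_measure)"
proof -
  interpret finite_measure "ball_measure :: (complex ^ 'n) measure"
    by (rule finite_measure_ball_measure)
  have one: "peval 1 (c *s z) = c ^ 0 * peval 1 z" for c :: complex and z :: "complex ^ 'n" by simp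
  note I = integral_against_homogeneous[OF f s one]
  have "(LINT z|ball_measure. indicator (ball 0 s) z *\<^sub>R f z) =
      (LINT z|(ball_measure :: (complex ^ 'n) measure). indicator (ball 0 s) z *\<^sub>R f 0)"
    using I(2) by simp
  also have "\<dots> = of_real (measure ball_measure (ball (0::complex ^ 'n) s)) * f 0"
    by (simp add: scaleR_conv_of_real)
  finally have "cmod (f 0) * measure ball_measure (ball (0::complex ^ 'n) s) =
      norm (LINT z|ball_measure. indicator (ball 0 s) z *\<^sub>R f z)"
    by (simp add: norm_mult)
  also have "ennreal \<dots> \<le> (\<integral>\<^sup>+z. norm (indicator (ball 0 s) z *\<^sub>R f z) \<partial>ball_measure)"
    using I(1) by (intro integral_norm_bound_ennreal) simp
  also have "\<dots> = (\<integral>\<^sup>+z. ennreal (cmod (f z)) * indicator (ball 0 s) z \<partial>ball_measure)"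
    by (intro nn_integral_cong) (simp add: indicator_def)
  finally show ?thesis .
qed

lemma analytic_in_mult: "analytic_in (ball 0 1) f \<Longrightarrow> analytic_in (ball 0 1) g \<Longrightarrow> analytic_in (ball 0 1) (\<lambda>z. f z * g z)"
  using analytic_on_ball_mult by (simp add: analytic_on_ball_iff_analytic_in)

lemma nn_integral_bergman:
  "(\<integral>\<^sup>+z. ennreal ((cmod (Rep_bergman f z))\<^sup>2) \<partial>ball_measure) = ennreal ((norm f)\<^sup>2)"
  unfolding norm_bergman_sq by (rule nn_integral_eq_integral[OF Rep_bergman_sq_integrable]) auto

lemma Rep_bergman_borel [measurable]: "Rep_bergman f \<in> borel_measurable borel"
  using Rep_bergman_measurable[of f] by (simp cong: measurable_cong_sets)

lemma nn_integral_lborel_affine: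
  fixes f :: "'a::euclidean_space \<Rightarrow> ennreal"
  assumes [measurable]: "f \<in> borel_measurable borel" and r: "r > 0"
  shows "ennreal (r ^ DIM('a)) * (\<integral>\<^sup>+z. f (w + r *\<^sub>R z) \<partial>lborel) = (\<integral>\<^sup>+z. f z \<partial>lborel)"
proof -
  have "(\<integral>\<^sup>+z. f z \<partial>lborel) =
      (\<integral>\<^sup>+z. f z \<partial>density (distr lborel borel (\<lambda>x. w + r *\<^sub>R x)) (\<lambda>_. ennreal (\<bar>r\<bar> ^ DIM('a))))"
    using lborel_affine[of r w] r by simp
  then show ?thesis using r by (simp add: nn_integral_density nn_integral_distr nn_integral_cmult)
qed

text \<open>
  The mean value property is applied to the square of \<open>f\<close>, which is analytic itself, and this bounds \<open>|f(w)|\<^sup>2\<close> by the integral of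
  \<open>|f|\<^sup>2\<close> over a small ball around \<open>w\<close>.
\<close>

lemma evaluation_bound:
  assumes \<rho>: "0 \<le> \<rho>" "\<rho> < 1"
  shows "\<exists>C. \<forall>f :: ('n::finite) bergman. \<forall>w \<in> cball 0 \<rho>. cmod (Rep_bergman f w) \<le> C * norm f"
proof -
  define r where "r = 1 - \<rho>"
  have r: "r > 0" using \<rho> by (simp add: r_def)
  define \<mu> where "\<mu> = measure ball_measure (ball (0::complex ^ 'n) (1/2))"
  have \<mu>: "\<mu> > 0" unfolding \<mu>_def by (rule measure_small_ball_pos) simp
  \<comment> \<open>The Jacobian of the dilation that maps the unit ball to the ball of radius \<open>r\<close> around \<open>w\<close>.\<close>
  define R where "R = r ^ DIM(complex ^ 'n)"
  have R: "R > 0" using r by (simp add: R_def)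
  let ?V = "emeasure lborel (ball (0::complex ^ 'n) 1)"
  have sq: "(cmod (Rep_bergman f w))\<^sup>2 \<le> 1 / (\<mu> * R) * (norm f)\<^sup>2"
    if w: "w \<in> cball 0 \<rho>" for f :: "'n bergman" and w
  proof -
    have in_ball: "w + of_real r *s z \<in> ball 0 1" if "z \<in> ball 0 1" for z
    proof -
      have "norm (w + of_real r *s z) \<le> norm w + r * norm z"
        using norm_triangle_ineq[of w "of_real r *s z"] r by simp
      also have "\<dots> < \<rho> + r * 1" using w that r by (intro add_le_less_mono mult_strict_left_mono) auto
      finally show ?thesis by (simp add: r_def)
    qed
    define F where "F z = (Rep_bergman f (w + of_real r *s z))\<^sup>2" for z
    have "analytic_in (ball 0 1) (\<lambda>z. Rep_bergman f (w + of_real r *s z))"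
      using Rep_bergman_analytic[of f] in_ball unfolding analytic_on_ball_iff_analytic_in by (rule analytic_in_affine)
    then have "analytic_in (ball 0 1) F" unfolding F_def power2_eq_square by (intro analytic_in_mult)
    from mean_value_bound[OF this, of "1/2"]
    have "ennreal (cmod (F 0) * \<mu>) \<le> (\<integral>\<^sup>+z. ennreal (cmod (F z)) * indicator (ball 0 (1/2)) z \<partial>ball_measure)"
      by (simp add: \<mu>_def)
    also have "\<dots> \<le> (\<integral>\<^sup>+z. ennreal ((cmod (Rep_bergman f (w + r *\<^sub>R z)))\<^sup>2) \<partial>ball_measure)"
      by (intro nn_integral_mono) (auto simp: F_def norm_power indicator_def scaleR_vec_def vector_scalar_mult_def scaleR_conv_of_real)
    also have "\<dots> = (\<integral>\<^sup>+z. ennreal ((cmod (Rep_bergman f (w + r *\<^sub>R z)))\<^sup>2) * indicator (ball 0 1) z \<partial>lborel) / ?V"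
      by (rule nn_integral_ball_measure) measurable
    also have "\<dots> \<le> (\<integral>\<^sup>+z. ennreal ((cmod (Rep_bergman f (w + r *\<^sub>R z)))\<^sup>2) \<partial>lborel) / ?V"
      by (intro divide_right_mono_ennreal nn_integral_mono) (auto simp: indicator_def)
    finally have "ennreal R * ennreal (cmod (F 0) * \<mu>) \<le>
        ennreal R * ((\<integral>\<^sup>+z. ennreal ((cmod (Rep_bergman f (w + r *\<^sub>R z)))\<^sup>2) \<partial>lborel) / ?V)"
      by (intro mult_left_mono) auto
    also have "\<dots> = (\<integral>\<^sup>+z. ennreal ((cmod (Rep_bergman f z))\<^sup>2) \<partial>lborel) / ?V"
      unfolding R_def ennreal_times_divide
      using nn_integral_lborel_affine[of "\<lambda>z. ennreal ((cmod (Rep_bergman f z))\<^sup>2)" r w] r by simp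
    also have "(\<integral>\<^sup>+z. ennreal ((cmod (Rep_bergman f z))\<^sup>2) \<partial>lborel) =
        (\<integral>\<^sup>+z. ennreal ((cmod (Rep_bergman f z))\<^sup>2) * indicator (ball 0 1) z \<partial>lborel)"
      by (intro nn_integral_cong) (auto simp: indicator_def Rep_bergman_outside)
    also have "\<dots> / ?V = (\<integral>\<^sup>+z. ennreal ((cmod (Rep_bergman f z))\<^sup>2) \<partial>ball_measure)"
      by (rule nn_integral_ball_measure[symmetric]) measurable
    also have "\<dots> = ennreal ((norm f)\<^sup>2)" by (rule nn_integral_bergman)
    finally have "ennreal (R * (cmod (F 0) * \<mu>)) \<le> ennreal ((norm f)\<^sup>2)"
      using R by (subst ennreal_mult') auto
    then have "R * (cmod (F 0) * \<mu>) \<le> (norm f)\<^sup>2" by (subst (asm) ennreal_le_iff) auto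
    then show ?thesis using R \<mu> by (simp add: F_def norm_power field_simps)
  qed
  have "cmod (Rep_bergman f w) \<le> sqrt (1 / (\<mu> * R)) * norm f"
    if "w \<in> cball 0 \<rho>" for f :: "'n bergman" and w
  proof (rule power2_le_imp_le)
    show "(cmod (Rep_bergman f w))\<^sup>2 \<le> (sqrt (1 / (\<mu> * R)) * norm f)\<^sup>2"
      unfolding power_mult_distrib using sq[OF that, of f] R \<mu> by simp
  qed (use R \<mu> in simp)
  then show ?thesis by blast
qed


section \<open>Completeness, reproducing kernels and density of the polynomials\<close>

lemma liminf_le_of_eventually_le:
  fixes u :: "nat \<Rightarrow> ennreal"
  assumes "\<And>n. n \<ge> N \<Longrightarrow> u n \<le> c"
  shows "liminf u \<le> c"
proof -
  have "liminf u \<le> liminf (\<lambda>n. c)"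
    by (rule Liminf_mono) (use assms in \<open>auto simp: eventually_sequentially\<close>)
  then show ?thesis by (simp add: Liminf_const)
qed

lemma Rep_bergman_diff_bound:
  assumes "\<forall>f :: ('n::finite) bergman. \<forall>w \<in> cball 0 \<rho>. cmod (Rep_bergman f w) \<le> C * norm f" "w \<in> cball 0 \<rho>"
  shows "cmod (Rep_bergman f w - Rep_bergman (g :: 'n bergman) w) \<le> C * norm (f - g)"
  using assms by (metis Rep_bergman_diff)

text \<open>
  A Cauchy sequence converges locally uniformly by \<open>evaluation_bound\<close>, so the limit is analytic;
  Fatou's lemma shows that it is the limit in norm.
\<close>

instance bergman :: (finite) complete_space
proof
  fix X :: "nat \<Rightarrow> 'a bergman" assume X: "Cauchy X"
  let ?F = "\<lambda>n. Rep_bergman (X n)"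
  have unif: "\<exists>N. \<forall>m\<ge>N. \<forall>n\<ge>N. \<forall>w\<in>cball 0 \<rho>. cmod (?F m w - ?F n w) < e"
    if \<rho>: "0 \<le> \<rho>" "\<rho> < 1" and e: "e > 0" for \<rho> e
  proof -
    obtain C where C: "\<forall>f :: 'a bergman. \<forall>w \<in> cball 0 \<rho>. cmod (Rep_bergman f w) \<le> C * norm f"
      using evaluation_bound[OF \<rho>] by blast
    define C' where "C' = \<bar>C\<bar> + 1"
    have C': "C' > 0" by (simp add: C'_def)
    obtain N where N: "\<And>m n. m \<ge> N \<Longrightarrow> n \<ge> N \<Longrightarrow> norm (X m - X n) < e / C'"
      using CauchyD[OF X] e C' by (meson divide_pos_pos)
    have "cmod (?F m w - ?F n w) < e" if "m \<ge> N" "n \<ge> N" "w \<in> cball 0 \<rho>" for m n w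
    proof -
      have "cmod (?F m w - ?F n w) \<le> C * norm (X m - X n)"
        by (rule Rep_bergman_diff_bound[OF C that(3)])
      also have "\<dots> \<le> C' * norm (X m - X n)" by (intro mult_right_mono) (auto simp: C'_def)
      also have "\<dots> < C' * (e / C')" using C' N[OF that(1,2)] by (intro mult_strict_left_mono)
      finally show ?thesis using C' by simp
    qed
    then show ?thesis by blast
  qed
  have "Cauchy (\<lambda>n. ?F n z)" for z
  proof (cases "z \<in> ball 0 1")
    case True
    show ?thesis
    proof (rule CauchyI)
      fix e :: real assume "e > 0"
      from unif[OF _ _ this, of "norm z"] True
      show "\<exists>M. \<forall>m\<ge>M. \<forall>n\<ge>M. norm (?F m z - ?F n z) < e" by fastforce
    qed
  next
    case False
    then show ?thesis by (simp add: Rep_bergman_outside Cauchy_def)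
  qed
  then have "\<exists>l. (\<lambda>n. ?F n z) \<longlonglongrightarrow> l" for z
    using Cauchy_convergent convergent_def by blast
  then obtain f where f: "\<And>z. (\<lambda>n. ?F n z) \<longlonglongrightarrow> f z" by metis
  have outside: "f z = 0" if "z \<notin> ball 0 1" for z
    using f[of z] that LIMSEQ_unique[of "\<lambda>n. 0" "f z" 0] by (simp add: Rep_bergman_outside)
  have "analytic_in (ball 0 1) f"
  proof (rule analytic_in_uniform_limit[OF open_ball])
    fix z :: "complex ^ 'a" assume z: "z \<in> ball 0 1"
    define r where "r = (1 - norm z) / 2"
    define \<rho> where "\<rho> = (1 + norm z) / 2"
    have r: "r > 0" "0 \<le> \<rho>" "\<rho> < 1" using z by (simp_all add: r_def \<rho>_def)
    have sub: "w \<in> cball 0 \<rho>" if "w \<in> ball z r" for w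
    proof -
      have "norm w \<le> norm z + norm (w - z)" using norm_triangle_ineq[of z "w - z"] by simp
      also have "\<dots> \<le> norm z + r" using that by (simp add: dist_norm norm_minus_commute)
      finally show ?thesis by (simp add: r_def \<rho>_def field_simps)
    qed
    have "ball z r \<subseteq> ball 0 1" using sub r(3) by force
    moreover have "\<forall>\<^sub>F n in sequentially. analytic_in (ball z r) (?F n)"
      using analytic_in_subset[OF _ \<open>ball z r \<subseteq> ball 0 1\<close>] Rep_bergman_analytic analytic_on_ball_iff_analytic_in
      by (intro always_eventually) blast
    moreover have "uniform_limit (ball z r) ?F f sequentially"
      unfolding uniform_limit_iff
    proof (intro allI impI)
      fix e :: real assume "e > 0"
      then have "e / 2 > 0" by simp
      from unif[OF r(2,3) this] obtain N where
        N: "\<And>m n w. m \<ge> N \<Longrightarrow> n \<ge> N \<Longrightarrow> w \<in> cball 0 \<rho> \<Longrightarrow> cmod (?F m w - ?F n w) < e / 2" by blast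
      have "dist (?F n w) (f w) < e" if "n \<ge> N" "w \<in> ball z r" for n w
      proof -
        have "cmod (?F n w - f w) \<le> e / 2"
        proof (rule tendsto_upperbound)
          show "(\<lambda>m. cmod (?F n w - ?F m w)) \<longlonglongrightarrow> cmod (?F n w - f w)" by (intro tendsto_intros f)
          show "\<forall>\<^sub>F m in sequentially. cmod (?F n w - ?F m w) \<le> e / 2"
            using N[OF that(1) _ sub[OF that(2)]] by (intro eventually_sequentiallyI[of N]) (auto intro: less_imp_le)
        qed simp
        then show ?thesis using \<open>e > 0\<close> by (simp add: dist_norm)
      qed
      then show "\<forall>\<^sub>F n in sequentially. \<forall>w\<in>ball z r. dist (?F n w) (f w) < e"
        by (intro eventually_sequentiallyI[of N]) blast
    qed
    ultimately show "\<exists>r>0. ball z r \<subseteq> ball 0 1 \<and> (\<forall>\<^sub>F n in sequentially. analytic_in (ball z r) (?F n)) \<and>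
      uniform_limit (ball z r) ?F f sequentially" using r(1) by blast
  qed
  then have an: "analytic_on_ball f" by (simp add: analytic_on_ball_iff_analytic_in)
  have meas: "f \<in> borel_measurable ball_measure"
    by (rule analytic_on_ball_measurable[OF an outside])
  then have [measurable]: "f \<in> borel_measurable borel" by (simp cong: measurable_cong_sets)
  have fatou: "(\<integral>\<^sup>+z. ennreal ((cmod (?F n z - f z))\<^sup>2) \<partial>ball_measure) \<le> ennreal (e\<^sup>2)"
    if e: "\<And>m. m \<ge> N \<Longrightarrow> norm (X n - X m) \<le> e" for n N e
  proof -
    have "(\<lambda>m. ennreal ((cmod (?F n z - ?F m z))\<^sup>2)) \<longlonglongrightarrow> ennreal ((cmod (?F n z - f z))\<^sup>2)" for z
      by (intro tendsto_intros f tendsto_ennrealI)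
    then have "(\<integral>\<^sup>+z. ennreal ((cmod (?F n z - f z))\<^sup>2) \<partial>ball_measure) =
        (\<integral>\<^sup>+z. liminf (\<lambda>m. ennreal ((cmod (?F n z - ?F m z))\<^sup>2)) \<partial>ball_measure)"
      by (intro nn_integral_cong lim_imp_Liminf[symmetric]) auto
    also have "\<dots> \<le> liminf (\<lambda>m. \<integral>\<^sup>+z. ennreal ((cmod (?F n z - ?F m z))\<^sup>2) \<partial>ball_measure)"
      by (rule nn_integral_liminf) (use Rep_bergman_measurable in measurable)
    also have "\<dots> = liminf (\<lambda>m. ennreal ((norm (X n - X m))\<^sup>2))"
      by (simp add: nn_integral_bergman[symmetric] Rep_bergman_diff)
    also have "\<dots> \<le> ennreal (e\<^sup>2)"
      using e by (intro liminf_le_of_eventually_le[of N] ennreal_leI power_mono) auto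
    finally show ?thesis .
  qed
  have sqint: "integrable ball_measure (\<lambda>z. (cmod (f z))\<^sup>2)"
  proof -
    obtain N where N: "\<And>m n. m \<ge> N \<Longrightarrow> n \<ge> N \<Longrightarrow> norm (X m - X n) < 1"
      using CauchyD[OF X] by (meson zero_less_one)
    have "(\<integral>\<^sup>+z. ennreal ((cmod (?F N z - f z))\<^sup>2) \<partial>ball_measure) \<le> ennreal (1\<^sup>2)"
      using N by (intro fatou[of N]) (auto intro: less_imp_le)
    then have "(\<integral>\<^sup>+z. ennreal (norm ((cmod (?F N z - f z))\<^sup>2)) \<partial>ball_measure) < \<infinity>"
      by (simp add: le_less_trans)
    then have "integrable ball_measure (\<lambda>z. (cmod (?F N z - f z))\<^sup>2)"
      using Rep_bergman_measurable[of "X N"] meas by (intro integrableI_bounded) measurable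
    then have 1: "integrable ball_measure (\<lambda>z. (cmod (f z - ?F N z))\<^sup>2)"
      by (simp add: norm_minus_commute)
    have "integrable ball_measure (\<lambda>z. (cmod ((f z - ?F N z) + ?F N z))\<^sup>2)"
      using Rep_bergman_measurable[of "X N"] meas
      by (intro integrable_sq_add 1 Rep_bergman_sq_integrable) measurable
    then show ?thesis by simp
  qed
  define g where "g = Abs_bergman f"
  have Rg: "Rep_bergman g = f"
    unfolding g_def using an outside sqint by (intro Abs_bergman_inverse) auto
  have "X \<longlonglongrightarrow> g"
  proof (rule LIMSEQ_I)
    fix e :: real assume "e > 0"
    then have e2: "e / 2 > 0" by simp
    obtain N where N: "\<And>m n. m \<ge> N \<Longrightarrow> n \<ge> N \<Longrightarrow> norm (X m - X n) < e / 2"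
      using CauchyD[OF X e2] by blast
    have "norm (X n - g) < e" if "n \<ge> N" for n
    proof -
      have "ennreal ((norm (X n - g))\<^sup>2) = (\<integral>\<^sup>+z. ennreal ((cmod (?F n z - f z))\<^sup>2) \<partial>ball_measure)"
        by (simp add: nn_integral_bergman[symmetric] Rep_bergman_diff Rg)
      also have "\<dots> \<le> ennreal ((e / 2)\<^sup>2)"
        using N[OF that] by (intro fatou[of N]) (auto intro: less_imp_le)
      finally have "(norm (X n - g))\<^sup>2 \<le> (e / 2)\<^sup>2" by (subst (asm) ennreal_le_iff) auto
      then have "norm (X n - g) \<le> e / 2" by (rule power2_le_imp_le) (use e2 in simp)
      then show ?thesis using e2 by simp
    qed
    then show "\<exists>N. \<forall>n\<ge>N. norm (X n - g) < e" by blast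
  qed
  then show "convergent X" by (rule convergentI)
qed

instance bergman :: (finite) banach ..

text \<open>
  The real part of the evaluation is represented by some \<open>K\<close>; complex linearity recovers the imaginary part.
\<close>

lemma kernel_exists:
  assumes w: "w \<in> ball (0 :: complex ^ 'n::finite) 1"
  shows "\<exists>K. \<forall>f. Rep_bergman f w = bergman_cinner f K"
proof -
  obtain C where C: "\<forall>f :: 'n bergman. \<forall>v \<in> cball 0 (norm w). cmod (Rep_bergman f v) \<le> C * norm f"
    using evaluation_bound[of "norm w"] w by auto
  have "bounded_linear (\<lambda>f :: 'n bergman. Re (Rep_bergman f w))"
  proof (rule bounded_linear_intro[where K = C])
    fix f :: "'n bergman"
    have "\<bar>Re (Rep_bergman f w)\<bar> \<le> cmod (Rep_bergman f w)" by (rule abs_Re_le_cmod)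
    also have "\<dots> \<le> norm f * C" using C by (simp add: mult.commute)
    finally show "norm (Re (Rep_bergman f w)) \<le> norm f * C" by simp
  qed (auto simp: bergman_rep)
  then obtain K where K: "\<And>f. Re (Rep_bergman f w) = inner f K"
    using riesz_representation by blast
  have "Rep_bergman f w = bergman_cinner f K" for f
  proof (rule complex_eqI)
    show "Re (Rep_bergman f w) = Re (bergman_cinner f K)" by (simp add: K inner_bergman_def)
    show "Im (Rep_bergman f w) = Im (bergman_cinner f K)"
      using K[of "bergman_cscale (-\<i>) f"] by (simp add: bergman_rep inner_bergman_def cinner_cscale_left)
  qed
  then show ?thesis by blast
qed

definition kernel_at :: "complex ^ ('n::finite) \<Rightarrow> 'n bergman" where
  "kernel_at w = (SOME K. \<forall>f. Rep_bergman f w = bergman_cinner f K)"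

lemma cinner_kernel: "w \<in> ball 0 1 \<Longrightarrow> bergman_cinner f (kernel_at w) = Rep_bergman f w"
  using someI_ex[OF kernel_exists[of w]] unfolding kernel_at_def by metis

lemma kernel_nonzero: "w \<in> ball 0 1 \<Longrightarrow> kernel_at w \<noteq> 0"
  using cinner_kernel[of w bergman_one] by (auto simp: bergman_one.rep_eq)

definition clinear_op :: "('n::finite) operator \<Rightarrow> bool" where
  "clinear_op T \<longleftrightarrow> (\<forall>c h. blinfun_apply T (bergman_cscale c h) = bergman_cscale c (blinfun_apply T h))"

lemma clinear_mult_op: "clinear_op (mult_op f)"
  by (simp add: clinear_op_def mult_op_cscale)

lemma cinner_adjointI:
  assumes "clinear_op T" "\<And>x. inner (blinfun_apply T x) y = inner x y'"
  shows "bergman_cinner (blinfun_apply T x) y = bergman_cinner x y'"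
proof (rule complex_eqI)
  show "Re (bergman_cinner (blinfun_apply T x) y) = Re (bergman_cinner x y')"
    using assms(2) by (simp add: inner_bergman_def)
  show "Im (bergman_cinner (blinfun_apply T x) y) = Im (bergman_cinner x y')"
    using assms(2)[of "bergman_cscale (-\<i>) x"] assms(1)
    by (simp add: clinear_op_def inner_bergman_def cinner_cscale_left)
qed

lemma cinner_hadj:
  "clinear_op T \<Longrightarrow> bergman_cinner (blinfun_apply T x) y = bergman_cinner x (blinfun_apply (hadj T) y)"
  by (rule cinner_adjointI[OF _ inner_hadj])

lemma cinner_eqI: "(\<And>x. bergman_cinner x a = bergman_cinner x b) \<Longrightarrow> a = b"
  by (rule inner_eqI) (simp add: inner_bergman_def)

lemma clinear_hadj: "clinear_op T \<Longrightarrow> clinear_op (hadj T)"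
  unfolding clinear_op_def[of "hadj T"]
proof (intro allI)
  fix c h assume T: "clinear_op T"
  show "blinfun_apply (hadj T) (bergman_cscale c h) = bergman_cscale c (blinfun_apply (hadj T) h)"
    by (rule cinner_eqI) (simp add: cinner_hadj[OF T, symmetric] cinner_cscale_right)
qed

text \<open>By the reproducing property both sides have the inner product \<open>f(w) x(w)\<close> with every \<open>x\<close>.\<close>

lemma hadj_mult_op_kernel:
  assumes "w \<in> ball 0 1"
  shows "blinfun_apply (hadj (mult_op f)) (kernel_at w) = bergman_cscale (cnj (peval f w)) (kernel_at w)"
  by (rule cinner_eqI)
     (simp add: cinner_hadj[OF clinear_mult_op, symmetric] cinner_cscale_right cinner_kernel[OF assms] bergman_rep)

lemma integral_exhaust_ball:
  fixes g :: "complex ^ ('n::finite) \<Rightarrow> complex"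
  assumes g: "integrable ball_measure g"
  shows "(\<lambda>n. LINT z|ball_measure. indicator (ball 0 (1 - 1 / real (Suc (Suc n)))) z *\<^sub>R g z)
    \<longlonglongrightarrow> (LINT z|ball_measure. indicator (ball 0 1) z *\<^sub>R g z)"
proof (rule integral_dominated_convergence[where w = "\<lambda>z. norm (g z)"])
  have gm: "g \<in> borel_measurable ball_measure" using g by simp
  show "(\<lambda>z. indicator (ball 0 1) z *\<^sub>R g z) \<in> borel_measurable ball_measure"
    by (intro borel_measurable_scaleR borel_measurable_indicator gm) auto
  show "(\<lambda>z. indicator (ball 0 (1 - 1 / real (Suc (Suc n)))) z *\<^sub>R g z) \<in> borel_measurable ball_measure" for n
    by (intro borel_measurable_scaleR borel_measurable_indicator gm) auto
  show "integrable ball_measure (\<lambda>z. norm (g z))" using g by simp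
  have "(\<lambda>n. indicator (ball 0 (1 - 1 / real (Suc (Suc n)))) z *\<^sub>R g z) \<longlonglongrightarrow> indicator (ball 0 1) z *\<^sub>R g z" for z
  proof (rule tendsto_eventually)
    show "\<forall>\<^sub>F n in sequentially. indicator (ball 0 (1 - 1 / real (Suc (Suc n)))) z *\<^sub>R g z = indicator (ball 0 1) z *\<^sub>R g z"
    proof (cases "norm z < 1")
      case True
      have "(\<lambda>n. 1 - 1 / real (Suc (Suc n))) \<longlonglongrightarrow> 1 - 0"
        by (intro tendsto_intros LIMSEQ_Suc[OF LIMSEQ_Suc[OF lim_1_over_n]])
      then have "\<forall>\<^sub>F n in sequentially. norm z < 1 - 1 / real (Suc (Suc n))"
        using True by (intro order_tendstoD) auto
      then show ?thesis by eventually_elim (use True in \<open>simp add: indicator_def\<close>)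
    next
      case False
      have "z \<notin> ball 0 (1 - 1 / real (Suc (Suc n)))" for n
      proof -
        have "1 / real (Suc (Suc n)) > 0" by simp
        then show ?thesis using False unfolding mem_ball_0 by linarith
      qed
      then show ?thesis using False by (intro always_eventually) (simp add: indicator_def)
    qed
  qed
  then show "AE z in ball_measure. (\<lambda>n. indicator (ball 0 (1 - 1 / real (Suc (Suc n)))) z *\<^sub>R g z)
      \<longlonglongrightarrow> indicator (ball 0 1) z *\<^sub>R g z" by blast
  show "AE z in ball_measure. norm (indicator (ball 0 (1 - 1 / real (Suc (Suc n)))) z *\<^sub>R g z) \<le> norm (g z)" for n
    by (auto simp: indicator_def)
qed

lemma cinner_indicator:
  "bergman_cinner f g = (LINT z|ball_measure. indicator (ball 0 1) z *\<^sub>R (Rep_bergman f z * cnj (Rep_bergman g z)))"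
  unfolding bergman_cinner.rep_eq
  by (intro Bochner_Integration.integral_cong) (auto simp: indicator_def Rep_bergman_outside)

text \<open>
  If \<open>f\<close> is orthogonal to all polynomials then it is orthogonal to each of its homogeneous components,
  and the inner product of the two is the squared norm of the component.
\<close>

lemma orthogonal_to_polynomials_imp_zero:
  fixes f :: "('n::finite) bergman"
  assumes orth: "\<And>q. bergman_cinner f (poly_fun q) = 0"
  shows "f = 0"
proof -
  have hol: "analytic_in (ball 0 1) (Rep_bergman f)"
    using Rep_bergman_analytic analytic_on_ball_iff_analytic_in by blast
  have "peval (taylor_part k (Rep_bergman f)) z = 0" if z: "z \<in> ball 0 1" for k z
  proof -
    define q where "q = taylor_part k (Rep_bergman f)"
    \<comment> \<open>Shifting the index by two keeps the radii positive.\<close>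
    define s where "s n = 1 - 1 / real (Suc (Suc n))" for n
    have s: "0 < s n" "s n < 1" for n by (simp_all add: s_def)
    have eq: "(LINT z|ball_measure. indicator (ball 0 (s n)) z *\<^sub>R (Rep_bergman f z * cnj (Rep_bergman (poly_fun q) z))) =
        (LINT z|ball_measure. indicator (ball 0 (s n)) z *\<^sub>R (Rep_bergman (poly_fun q) z * cnj (Rep_bergman (poly_fun q) z)))"
      (is "?L = ?R") for n
    proof -
      have in1: "z \<in> ball 0 1" if "z \<in> ball 0 (s n)" for z :: "complex ^ 'n" using that s(2)[of n] by simp
      have "?L = (LINT z|ball_measure. indicator (ball 0 (s n)) z *\<^sub>R (Rep_bergman f z * cnj (peval q z)))"
        using in1 by (intro Bochner_Integration.integral_cong) (auto simp: indicator_def Rep_poly_fun)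
      also have "\<dots> = (LINT z|ball_measure. indicator (ball 0 (s n)) z *\<^sub>R (peval q z * cnj (peval q z)))"
        unfolding q_def by (rule integral_against_homogeneous(2)[OF hol s taylor_part_homogeneous])
      also have "\<dots> = ?R"
        using in1 by (intro Bochner_Integration.integral_cong) (auto simp: indicator_def Rep_poly_fun)
      finally show ?thesis .
    qed
    have 1: "(\<lambda>n. LINT z|ball_measure. indicator (ball 0 (s n)) z *\<^sub>R (Rep_bergman f z * cnj (Rep_bergman (poly_fun q) z)))
        \<longlonglongrightarrow> bergman_cinner f (poly_fun q)"
      unfolding cinner_indicator s_def by (intro integral_exhaust_ball Rep_bergman_mult_cnj_integrable)
    have 2: "(\<lambda>n. LINT z|ball_measure. indicator (ball 0 (s n)) z *\<^sub>R (Rep_bergman f z * cnj (Rep_bergman (poly_fun q) z)))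
        \<longlonglongrightarrow> bergman_cinner (poly_fun q) (poly_fun q)"
      unfolding eq unfolding cinner_indicator s_def
      by (intro integral_exhaust_ball Rep_bergman_mult_cnj_integrable)
    have "bergman_cinner (poly_fun q) (poly_fun q) = 0"
      using LIMSEQ_unique[OF 2 1] orth by simp
    then have "poly_fun q = 0" by (simp add: cinner_self)
    then show ?thesis using Rep_poly_fun[OF z, of q] by (simp add: bergman_rep q_def)
  qed
  then have "Rep_bergman f z = 0" if "z \<in> ball 0 1" for z
    using taylor_part_sums[OF hol, of z] that sums_unique2[of "\<lambda>m. 0" _ 0] by simp
  then show ?thesis by (intro bergman_eqI) (simp add: bergman_rep)
qed

lemma subspace_closure:
  fixes S :: "'a::real_normed_vector set"
  assumes "subspace S"
  shows "subspace (closure S)"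
proof (rule subspaceI)
  show "0 \<in> closure S" using subspace_0[OF assms] closure_subset by blast
next
  fix x y assume "x \<in> closure S" "y \<in> closure S"
  then obtain u v where "\<And>n. u n \<in> S" "u \<longlonglongrightarrow> x" "\<And>n. v n \<in> S" "v \<longlonglongrightarrow> y"
    unfolding closure_sequential by blast
  then show "x + y \<in> closure S"
    unfolding closure_sequential using subspace_add[OF assms]
    by (intro exI[of _ "\<lambda>n. u n + v n"]) (auto intro: tendsto_add)
next
  fix c x assume "x \<in> closure S"
  then obtain u where "\<And>n. u n \<in> S" "u \<longlonglongrightarrow> x" unfolding closure_sequential by blast
  then show "c *\<^sub>R x \<in> closure S"
    unfolding closure_sequential using subspace_scale[OF assms]
    by (intro exI[of _ "\<lambda>n. c *\<^sub>R u n"]) (auto intro: tendsto_scaleR)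
qed

lemma poly_fun_add: "poly_fun (p + q) = poly_fun p + poly_fun q"
  by (simp add: poly_fun_def bergman_mult_add)

lemma poly_fun_cscale: "bergman_cscale c (poly_fun p) = poly_fun (pconst c * p)"
  by (simp add: poly_fun_def bergman_mult_mult bergman_mult_const)

lemma poly_fun_mult: "poly_fun (p * q) = bergman_mult p (poly_fun q)"
  by (simp add: poly_fun_def bergman_mult_mult)

lemma poly_fun_zero: "poly_fun 0 = 0"
  by (rule bergman_eqI) (simp add: Rep_poly_fun bergman_rep)

lemma polynomials_dense: "closure (range (poly_fun :: ('n::finite) cpoly \<Rightarrow> 'n bergman)) = UNIV"
proof -
  let ?R = "range (poly_fun :: 'n cpoly \<Rightarrow> 'n bergman)"
  have "subspace ?R"
  proof (rule subspaceI)
    show "0 \<in> ?R" by (metis poly_fun_zero rangeI)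
    show "x + y \<in> ?R" if "x \<in> ?R" "y \<in> ?R" for x y
      using that by (auto simp: poly_fun_add[symmetric])
    show "c *\<^sub>R x \<in> ?R" if "x \<in> ?R" for c x
      using that by (auto simp: cscale_scaleR poly_fun_cscale)
  qed
  then have S: "subspace (closure ?R)" "closed (closure ?R)" by (auto intro: subspace_closure)
  have "x \<in> closure ?R" for x
  proof -
    obtain y where y: "y \<in> closure ?R" "\<And>s. s \<in> closure ?R \<Longrightarrow> inner (x - y) s = 0"
      using orthogonal_projection_exists[OF S] by blast
    have "\<forall>s\<in>?R. inner (x - y) s = 0" using y(2) closure_subset by blast
    then have "\<forall>s\<in>?R. bergman_cinner (x - y) s = 0"
      by (subst cinner_zero_iff_inner) (auto simp: poly_fun_cscale)
    then have "x - y = 0" by (intro orthogonal_to_polynomials_imp_zero) auto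
    then show ?thesis using y(1) by simp
  qed
  then show ?thesis by blast
qed


section \<open>Norms of the monomials\<close>

definition mono_fun :: "('n::finite \<Rightarrow>\<^sub>0 nat) \<Rightarrow> 'n bergman" where
  "mono_fun \<alpha> = poly_fun (Poly_Mapping.single \<alpha> 1)"

lemma Rep_mono_fun: "z \<in> ball 0 1 \<Longrightarrow> Rep_bergman (mono_fun \<alpha>) z = mono_eval \<alpha> z"
  by (simp add: mono_fun_def Rep_poly_fun)

definition mono_degree :: "('n::finite \<Rightarrow>\<^sub>0 nat) \<Rightarrow> nat" where
  "mono_degree \<alpha> = (\<Sum>i\<in>UNIV. Poly_Mapping.lookup \<alpha> i)"

definition coord_scale :: "'n \<Rightarrow> complex \<Rightarrow> complex ^ 'n \<Rightarrow> complex ^ ('n::finite)" where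
  "coord_scale i c z = (\<chi> j. if j = i then c * z $ j else z $ j)"

lemma norm_sq_coord: "(norm (z :: complex ^ ('n::finite)))\<^sup>2 = (\<Sum>j\<in>UNIV. (cmod (z $ j))\<^sup>2)"
  by (simp add: norm_vec_def L2_set_def sum_nonneg)

lemma norm_coord_scale:
  "(norm (coord_scale i c z))\<^sup>2 = (norm z)\<^sup>2 + ((cmod c)\<^sup>2 - 1) * (cmod (z $ i))\<^sup>2"
proof -
  have "(norm (coord_scale i c z))\<^sup>2 = (\<Sum>j\<in>UNIV. (cmod (z $ j))\<^sup>2 + (if j = i then ((cmod c)\<^sup>2 - 1) * (cmod (z $ j))\<^sup>2 else 0))"
    unfolding norm_sq_coord coord_scale_def
    by (intro sum.cong) (auto simp: norm_mult power_mult_distrib algebra_simps)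
  then show ?thesis by (simp add: sum.distrib norm_sq_coord)
qed

lemma linear_coord_scale: "linear (coord_scale i c)"
  by (rule linearI) (auto simp: coord_scale_def vec_eq_iff algebra_simps)

lemma mono_eval_coord_scale: "mono_eval \<alpha> (coord_scale i c z) = c ^ Poly_Mapping.lookup \<alpha> i * mono_eval \<alpha> z"
proof -
  have "mono_eval \<alpha> (coord_scale i c z) =
      (\<Prod>j\<in>UNIV. (if j = i then c ^ Poly_Mapping.lookup \<alpha> j else 1) * (z $ j) ^ Poly_Mapping.lookup \<alpha> j)"
    unfolding mono_eval_def coord_scale_def by (intro prod.cong) (auto simp: power_mult_distrib)
  then show ?thesis by (simp add: prod.distrib mono_eval_def)
qed

lemma mono_eval_scale: "mono_eval \<alpha> (c *s z) = c ^ mono_degree \<alpha> * mono_eval \<alpha> z"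
  by (simp add: mono_eval_def mono_degree_def power_mult_distrib prod.distrib power_sum)

lemma continuous_on_mono_eval [continuous_intros]: "continuous_on A (mono_eval \<alpha>)"
  unfolding mono_eval_def by (intro continuous_intros)

lemma borel_measurable_mono_eval [measurable]: "mono_eval \<alpha> \<in> borel_measurable borel"
  by (intro borel_measurable_continuous_onI continuous_intros)

lemma borel_measurable_coord [measurable]: "(\<lambda>z :: complex ^ ('n::finite). z $ i) \<in> borel_measurable borel"
  by (intro borel_measurable_continuous_onI continuous_intros)

text \<open>Distinct monomials are separated by the rotations of a single coordinate.\<close>

lemma mono_fun_orthogonal:
  assumes "\<alpha> \<noteq> (\<beta> :: 'n::finite \<Rightarrow>\<^sub>0 nat)"
  shows "bergman_cinner (mono_fun \<alpha>) (mono_fun \<beta>) = 0"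
proof -
  obtain i where i: "Poly_Mapping.lookup \<alpha> i \<noteq> Poly_Mapping.lookup \<beta> i"
    using assms by (auto simp: poly_mapping_eq_iff fun_eq_iff)
  define a where "a = Poly_Mapping.lookup \<alpha> i"
  define b where "b = Poly_Mapping.lookup \<beta> i"
  obtain c :: complex where c: "cmod c = 1" and cj: "c ^ a * cnj (c ^ b) = -1"
    using exists_rotation_separating_degrees[of a b] i by (auto simp: a_def b_def)
  have norm_T: "norm (coord_scale i c z) = norm z" for z
    by (rule power2_eq_imp_eq) (simp_all add: norm_coord_scale c)
  have "bergman_cinner (mono_fun \<alpha>) (mono_fun \<beta>) =
      (LINT z|ball_measure. indicator (ball 0 1) z *\<^sub>R (mono_eval \<alpha> z * cnj (mono_eval \<beta> z)))"
    unfolding cinner_indicator by (intro Bochner_Integration.integral_cong) (auto simp: indicator_def Rep_mono_fun)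
  also have "\<dots> = 0"
  proof (rule integral_ball_measure_eigen[where T = "coord_scale i c" and c = "-1"])
    show "(\<lambda>z. indicator (ball 0 1) z *\<^sub>R (mono_eval \<alpha> z * cnj (mono_eval \<beta> z))) \<in> borel_measurable borel"
      by (intro borel_measurable_continuous_on_indicator continuous_intros) auto
    show "indicator (ball 0 1) (coord_scale i c z) *\<^sub>R
        (mono_eval \<alpha> (coord_scale i c z) * cnj (mono_eval \<beta> (coord_scale i c z))) =
        -1 * (indicator (ball 0 1) z *\<^sub>R (mono_eval \<alpha> z * cnj (mono_eval \<beta> z)))" for z
    proof -
      have "mono_eval \<alpha> (coord_scale i c z) * cnj (mono_eval \<beta> (coord_scale i c z)) =
          (c ^ a * cnj (c ^ b)) * (mono_eval \<alpha> z * cnj (mono_eval \<beta> z))"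
        by (simp add: mono_eval_coord_scale a_def b_def)
      then show ?thesis unfolding cj by (simp add: indicator_def norm_T)
    qed
  qed (auto simp: linear_coord_scale norm_T)
  finally show ?thesis .
qed

lemma nn_integral_coord_scale:
  fixes f :: "complex ^ ('n::finite) \<Rightarrow> ennreal"
  assumes [measurable]: "f \<in> borel_measurable borel" and c: "c > 0"
  shows "ennreal (c\<^sup>2) * (\<integral>\<^sup>+z. f (coord_scale i (of_real c) z) \<partial>lborel) = (\<integral>\<^sup>+z. f z \<partial>lborel)"
proof -
  define \<kappa> where "\<kappa> b = (if b $ i \<noteq> 0 then c else 1)" for b :: "complex ^ 'n"
  have T: "(\<lambda>x. 0 + (\<Sum>b\<in>Basis. (\<kappa> b * (x \<bullet> b)) *\<^sub>R b)) = coord_scale i (of_real c)"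
  proof
    fix x :: "complex ^ 'n"
    have "coord_scale i (of_real c) x \<bullet> b = \<kappa> b * (x \<bullet> b)" if "b \<in> Basis" for b
    proof -
      obtain k u where b: "b = axis k u" and u: "u \<in> Basis" using \<open>b \<in> Basis\<close> by (auto simp: Basis_vec_def)
      have "u \<noteq> 0" using u by auto
      then show ?thesis
        unfolding b inner_axis by (simp add: coord_scale_def \<kappa>_def axis_def scaleR_conv_of_real[symmetric])
    qed
    then have "(\<Sum>b\<in>Basis. (\<kappa> b * (x \<bullet> b)) *\<^sub>R b) = (\<Sum>b\<in>Basis. (coord_scale i (of_real c) x \<bullet> b) *\<^sub>R b)"
      by (intro sum.cong) auto
    then show "0 + (\<Sum>b\<in>Basis. (\<kappa> b * (x \<bullet> b)) *\<^sub>R b) = coord_scale i (of_real c) x"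
      by (simp only: euclidean_representation add_0)
  qed
  have "(\<Prod>b\<in>(Basis :: (complex ^ 'n) set). \<bar>\<kappa> b\<bar>) = c\<^sup>2"
  proof -
    have S: "{b \<in> (Basis :: (complex ^ 'n) set). b $ i \<noteq> 0} = {axis i 1, axis i \<i>}"
    proof (intro equalityI subsetI)
      fix b :: "complex ^ 'n" assume "b \<in> {b \<in> Basis. b $ i \<noteq> 0}"
      then obtain k u where b: "b = axis k u" "u \<in> Basis" and nz: "b $ i \<noteq> 0" by (auto simp: Basis_vec_def)
      have "k = i" using nz unfolding b(1) by (rule contrapos_np) (simp add: axis_def)
      then show "b \<in> {axis i 1, axis i \<i>}" using b by (auto simp: Basis_complex_def)
    next
      fix b :: "complex ^ 'n" assume "b \<in> {axis i 1, axis i \<i>}"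
      then obtain u where "b = axis i u" "u \<in> Basis" "u \<noteq> 0" by (auto simp: Basis_complex_def)
      then show "b \<in> {b \<in> Basis. b $ i \<noteq> 0}" by (auto simp: Basis_vec_def)
    qed
    have ne: "axis i 1 \<noteq> (axis i \<i> :: complex ^ 'n)" by (simp add: axis_eq_axis complex_eq_iff)
    have "(\<Prod>b\<in>(Basis :: (complex ^ 'n) set). \<bar>\<kappa> b\<bar>) = (\<Prod>b\<in>{b \<in> (Basis :: (complex ^ 'n) set). b $ i \<noteq> 0}. c)"
      using c by (intro prod.mono_neutral_cong_right) (auto simp: \<kappa>_def)
    also have "\<dots> = c\<^sup>2" unfolding S using ne by (simp add: power2_eq_square)
    finally show ?thesis .
  qed
  then have "lborel = density (distr lborel borel (coord_scale i (of_real c))) (\<lambda>_. ennreal (c\<^sup>2))"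
    using lborel_affine_euclidean[of \<kappa> "0 :: complex ^ 'n"] c unfolding T by (simp add: \<kappa>_def)
  then have "(\<integral>\<^sup>+z. f z \<partial>lborel) =
      (\<integral>\<^sup>+z. f z \<partial>density (distr lborel borel (coord_scale i (of_real c))) (\<lambda>_. ennreal (c\<^sup>2)))"
    by simp
  moreover have [measurable]: "coord_scale i (of_real c) \<in> borel_measurable borel"
    using linear_coord_scale linear_continuous_on linear_conv_bounded_linear
    by (intro borel_measurable_continuous_onI) blast
  ultimately show ?thesis by (simp add: nn_integral_density nn_integral_distr nn_integral_cmult)
qed

text \<open>
  The squared norm of a monomial before normalization of the measure. It is extended real, so that Tonelli's
  theorem applies without integrability conditions.
\<close>

definition moment :: "('n::finite \<Rightarrow>\<^sub>0 nat) \<Rightarrow> ennreal" where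
  "moment \<alpha> = (\<integral>\<^sup>+z. ennreal ((cmod (mono_eval \<alpha> z))\<^sup>2) * indicator {z. (norm z)\<^sup>2 < 1} z \<partial>lborel)"

lemma norm_mono_fun_moment:
  fixes \<alpha> :: "'n::finite \<Rightarrow>\<^sub>0 nat"
  shows "ennreal ((norm (mono_fun \<alpha>))\<^sup>2) = moment \<alpha> / emeasure lborel (ball (0 :: complex ^ 'n) 1)"
proof -
  have "ennreal ((norm (mono_fun \<alpha>))\<^sup>2) =
      (\<integral>\<^sup>+z. ennreal ((cmod (Rep_bergman (mono_fun \<alpha>) z))\<^sup>2) * indicator (ball 0 1) z \<partial>lborel)
      / emeasure lborel (ball (0 :: complex ^ 'n) 1)"
    unfolding nn_integral_bergman[symmetric] by (rule nn_integral_ball_measure) measurable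
  also have "(\<integral>\<^sup>+z. ennreal ((cmod (Rep_bergman (mono_fun \<alpha>) z))\<^sup>2) * indicator (ball 0 1) z \<partial>lborel) = moment \<alpha>"
    unfolding moment_def
    by (intro nn_integral_cong) (auto simp: indicator_def Rep_mono_fun abs_square_less_1 Rep_bergman_outside)
  finally show ?thesis .
qed

lemma AE_coord_nonzero:
  fixes i :: "'n::finite"
  shows "AE z in lborel. z $ i \<noteq> (0 :: complex)"
proof -
  have "negligible {z :: complex ^ 'n. axis i 1 \<bullet> z = 0}"
    by (rule negligible_hyperplane) (auto simp: axis_eq_0_iff)
  moreover have "{z :: complex ^ 'n. z $ i = 0} \<subseteq> {z. axis i 1 \<bullet> z = 0}" by (auto simp: inner_axis')
  ultimately have "negligible {z :: complex ^ 'n. z $ i = 0}" by (rule negligible_subset)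
  moreover have "closed {z :: complex ^ 'n. z $ i = 0}"
    by (intro closed_Collect_eq continuous_intros)
  ultimately have null: "{z :: complex ^ 'n. z $ i = 0} \<in> null_sets lborel"
    by (auto simp: negligible_iff_null_sets null_sets_completion_iff)
  show ?thesis by (rule AE_I'[OF null]) auto
qed

text \<open>
  For \<open>z\<^sub>i \<noteq> 0\<close> the set of all \<open>u \<ge> 0\<close> with \<open>|z|\<^sup>2 + u |z\<^sub>i|\<^sup>2 < 1\<close> has length
  \<open>(1 - |z|\<^sup>2) / |z\<^sub>i|\<^sup>2\<close>, and for fixed \<open>u\<close> scaling the coordinate \<open>z\<^sub>i\<close> maps the ellipsoid
  to the unit ball.
\<close>

lemma moment_coordinate:
  fixes \<alpha> :: "'n::finite \<Rightarrow>\<^sub>0 nat" and i :: 'n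
  defines "\<alpha>' \<equiv> \<alpha> + Poly_Mapping.single i 1"
  shows "ennreal (1 / real (Suc (Poly_Mapping.lookup \<alpha> i))) * moment \<alpha>' =
    (\<integral>\<^sup>+z. ennreal ((cmod (mono_eval \<alpha> z))\<^sup>2) * ennreal (1 - (norm z)\<^sup>2) * indicator {z. (norm z)\<^sup>2 < 1} z \<partial>lborel)"
    (is "_ = ?R")
proof -
  define k where "k = Poly_Mapping.lookup \<alpha> i"
  define E where "E u z \<longleftrightarrow> (norm z)\<^sup>2 + u * (cmod (z $ i))\<^sup>2 < 1 \<and> 0 \<le> u" for u :: real and z :: "complex ^ 'n"
  define h where "h z u = ennreal ((cmod (mono_eval \<alpha>' z))\<^sup>2) * (if E u z then 1 else 0)" for z u
  have \<alpha>': "mono_eval \<alpha>' z = mono_eval \<alpha> z * z $ i" for z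
    by (simp add: \<alpha>'_def mono_eval_add mono_eval_single)
  have "(\<lambda>(z, u). h z u) \<in> borel_measurable (borel \<Otimes>\<^sub>M borel)"
    unfolding h_def E_def by measurable
  then have meas: "(\<lambda>(z, u). h z u) \<in> borel_measurable (lborel \<Otimes>\<^sub>M lborel)"
    by (simp cong: measurable_cong_sets sets_pair_measure_cong)
  have slice: "(\<integral>\<^sup>+z. h z u \<partial>lborel) = ennreal (1 / (1 + u) ^ (k + 2)) * indicator {0..} u * moment \<alpha>'" for u
  proof (cases "u \<ge> 0")
    case True
    \<comment> \<open>The factor that turns \<open>(1 + u) |z\<^sub>i|\<^sup>2\<close> back into \<open>|z\<^sub>i|\<^sup>2\<close>.\<close>
    define c where "c = 1 / sqrt (1 + u)"
    have c: "c > 0" "c\<^sup>2 = 1 / (1 + u)" using True by (simp_all add: c_def power_divide)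
    have c1: "(1 + u) * c\<^sup>2 = 1" using True unfolding c by simp
    have "(\<integral>\<^sup>+z. h z u \<partial>lborel) = ennreal (c\<^sup>2) * (\<integral>\<^sup>+z. h (coord_scale i (of_real c) z) u \<partial>lborel)"
    proof (rule nn_integral_coord_scale[symmetric, OF _ c(1)])
      show "(\<lambda>z. h z u) \<in> borel_measurable borel" unfolding h_def E_def by measurable
    qed
    also have "(\<lambda>z. h (coord_scale i (of_real c) z) u) =
        (\<lambda>z. ennreal ((c\<^sup>2) ^ (k + 1)) * (ennreal ((cmod (mono_eval \<alpha>' z))\<^sup>2) * indicator {z. (norm z)\<^sup>2 < 1} z))"
    proof
      fix z
      have "(norm (coord_scale i (of_real c) z))\<^sup>2 + u * (cmod (coord_scale i (of_real c) z $ i))\<^sup>2 =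
          (norm z)\<^sup>2 + ((1 + u) * c\<^sup>2 - 1) * (cmod (z $ i))\<^sup>2"
        unfolding norm_coord_scale by (simp add: coord_scale_def norm_mult power_mult_distrib algebra_simps)
      then have "E u (coord_scale i (of_real c) z) \<longleftrightarrow> (norm z)\<^sup>2 < 1" using True by (simp add: E_def c1)
      moreover have "(cmod (mono_eval \<alpha>' (coord_scale i (of_real c) z)))\<^sup>2 = (c\<^sup>2) ^ (k + 1) * (cmod (mono_eval \<alpha>' z))\<^sup>2"
        using c(1) by (simp add: mono_eval_coord_scale \<alpha>'_def lookup_add k_def norm_mult norm_power
            power_mult_distrib power_mult[symmetric] mult.commute)
      ultimately show "h (coord_scale i (of_real c) z) u =
          ennreal ((c\<^sup>2) ^ (k + 1)) * (ennreal ((cmod (mono_eval \<alpha>' z))\<^sup>2) * indicator {z. (norm z)\<^sup>2 < 1} z)"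
        by (simp add: h_def ennreal_mult' indicator_def)
    qed
    also have "(\<integral>\<^sup>+z. ennreal ((c\<^sup>2) ^ (k + 1)) * (ennreal ((cmod (mono_eval \<alpha>' z))\<^sup>2) * indicator {z. (norm z)\<^sup>2 < 1} z) \<partial>lborel)
        = ennreal ((c\<^sup>2) ^ (k + 1)) * moment \<alpha>'"
      unfolding moment_def by (rule nn_integral_cmult) measurable
    also have "ennreal (c\<^sup>2) * (ennreal ((c\<^sup>2) ^ (k + 1)) * moment \<alpha>') = ennreal ((c\<^sup>2) ^ (k + 2)) * moment \<alpha>'"
      by (simp add: mult.assoc[symmetric] ennreal_mult'[symmetric])
    also have "(c\<^sup>2) ^ (k + 2) = 1 / (1 + u) ^ (k + 2)" unfolding c by (simp add: power_one_over)
    finally show ?thesis using True by simp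
  next
    case False
    then have "h z u = 0" for z by (simp add: h_def E_def)
    then show ?thesis using False by simp
  qed
  have "(\<integral>\<^sup>+u. ennreal (1 / (1 + u) ^ (k + 2)) * indicator {0..} u \<partial>lborel) =
      ennreal (0 - (- 1 / (real (Suc k) * (1 + 0) ^ (k + 1))))"
  proof (rule nn_integral_FTC_atLeast)
    fix u :: real assume u: "0 \<le> u"
    show "((\<lambda>u. - 1 / (real (Suc k) * (1 + u) ^ (k + 1))) has_real_derivative 1 / (1 + u) ^ (k + 2)) (at u)"
      using u by (auto intro!: derivative_eq_intros simp: divide_simps power2_eq_square) (cases k, auto simp: algebra_simps)
    show "0 \<le> 1 / (1 + u) ^ (k + 2)" using u by simp
  next
    show "((\<lambda>u. - 1 / (real (Suc k) * (1 + u) ^ (k + 1))) \<longlongrightarrow> 0) at_top"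
      by real_asymp
  qed measurable
  then have uint: "(\<integral>\<^sup>+u. ennreal (1 / (1 + u) ^ (k + 2)) * indicator {0..} u \<partial>lborel) = ennreal (1 / real (Suc k))"
    by simp
  have "ennreal (1 / real (Suc k)) * moment \<alpha>' =
      (\<integral>\<^sup>+u. ennreal (1 / (1 + u) ^ (k + 2)) * indicator {0..} u * moment \<alpha>' \<partial>lborel)"
    unfolding uint[symmetric] by (rule nn_integral_multc[symmetric]) measurable
  also have "\<dots> = (\<integral>\<^sup>+u. (\<integral>\<^sup>+z. h z u \<partial>lborel) \<partial>lborel)" by (simp add: slice)
  also have "\<dots> = (\<integral>\<^sup>+z. (\<integral>\<^sup>+u. h z u \<partial>lborel) \<partial>lborel)"
    by (rule lborel_pair.Fubini'[OF meas])
  also have "\<dots> = ?R"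
  proof (rule nn_integral_cong_AE)
    have "(\<integral>\<^sup>+u. h z u \<partial>lborel) = ennreal ((cmod (mono_eval \<alpha> z))\<^sup>2) * ennreal (1 - (norm z)\<^sup>2) * indicator {z. (norm z)\<^sup>2 < 1} z"
      if z: "z $ i \<noteq> 0" for z
    proof (cases "(norm z)\<^sup>2 < 1")
      case True
      define a where "a = (cmod (z $ i))\<^sup>2"
      have a: "a > 0" using z by (simp add: a_def)
      have "h z u = ennreal ((cmod (mono_eval \<alpha>' z))\<^sup>2) * indicator {0 ..< (1 - (norm z)\<^sup>2) / a} u" for u
        using a by (auto simp: h_def E_def indicator_def a_def[symmetric] pos_less_divide_eq)
      then have "(\<integral>\<^sup>+u. h z u \<partial>lborel) = ennreal ((cmod (mono_eval \<alpha>' z))\<^sup>2) * ennreal ((1 - (norm z)\<^sup>2) / a)"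
        using True a by (simp add: nn_integral_cmult_indicator)
      also have "\<dots> = ennreal ((cmod (mono_eval \<alpha> z))\<^sup>2 * (1 - (norm z)\<^sup>2))"
        using a by (simp add: ennreal_mult'[symmetric] \<alpha>' norm_mult power_mult_distrib a_def[symmetric])
      finally show ?thesis using True by (simp add: ennreal_mult')
    next
      case False
      have "h z u = 0" for u
      proof -
        have "\<not> E u z"
        proof
          assume "E u z"
          then have "(norm z)\<^sup>2 + u * (cmod (z $ i))\<^sup>2 < 1" "0 \<le> u * (cmod (z $ i))\<^sup>2" by (auto simp: E_def)
          then show False using False by linarith
        qed
        then show ?thesis by (simp add: h_def)
      qed
      then show ?thesis using False by simp
    qed
    then show "AE z in lborel. (\<integral>\<^sup>+u. h z u \<partial>lborel) =
        ennreal ((cmod (mono_eval \<alpha> z))\<^sup>2) * ennreal (1 - (norm z)\<^sup>2) * indicator {z. (norm z)\<^sup>2 < 1} z"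
      using AE_coord_nonzero[of i] by (auto elim!: eventually_mono)
  qed
  finally show ?thesis by (simp add: k_def)
qed

text \<open>
  The factor \<open>1 - |z|\<^sup>2\<close> is the length of the interval of all \<open>s\<close> with \<open>|z|\<^sup>2 < s \<le> 1\<close>, and the integral of a
  homogeneous function over the ball of radius \<open>sqrt s\<close> is a power of \<open>s\<close> times the integral over the
  unit ball.
\<close>

lemma moment_radial:
  fixes \<alpha> :: "'n::finite \<Rightarrow>\<^sub>0 nat"
  shows "ennreal (1 / real (CARD('n) + mono_degree \<alpha> + 1)) * moment \<alpha> =
    (\<integral>\<^sup>+z. ennreal ((cmod (mono_eval \<alpha> z))\<^sup>2) * ennreal (1 - (norm z)\<^sup>2) * indicator {z. (norm z)\<^sup>2 < 1} z \<partial>lborel)"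
    (is "_ = ?R")
proof -
  define d where "d = CARD('n) + mono_degree \<alpha>"
  define h where "h z s = ennreal ((cmod (mono_eval \<alpha> z))\<^sup>2) * (if (norm z)\<^sup>2 < s \<and> s \<le> 1 then 1 else 0)"
    for s :: real and z :: "complex ^ 'n"
  have meas: "(\<lambda>(z, s). h z s) \<in> borel_measurable (lborel \<Otimes>\<^sub>M lborel)"
    unfolding h_def by measurable
  have slice: "(\<integral>\<^sup>+z. h z s \<partial>lborel) = ennreal (s ^ d) * indicator {0..1} s * moment \<alpha>" for s
  proof (cases "0 < s \<and> s \<le> 1")
    case True
    then have s: "s > 0" "s \<le> 1" by auto
    define r where "r = sqrt s"
    have r: "r > 0" "r\<^sup>2 = s" using s by (simp_all add: r_def)
    have "(\<integral>\<^sup>+z. h z s \<partial>lborel) = ennreal (r ^ DIM(complex ^ 'n)) * (\<integral>\<^sup>+z. h (0 + r *\<^sub>R z) s \<partial>lborel)"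
      by (rule nn_integral_lborel_affine[symmetric, OF _ r(1)]) (auto simp: h_def)
    also have "(\<lambda>z. h (0 + r *\<^sub>R z) s) =
        (\<lambda>z. ennreal (s ^ mono_degree \<alpha>) * (ennreal ((cmod (mono_eval \<alpha> z))\<^sup>2) * indicator {z. (norm z)\<^sup>2 < 1} z))"
    proof
      fix z :: "complex ^ 'n"
      have rz: "r *\<^sub>R z = of_real r *s z" by (simp add: vec_eq_iff scaleR_conv_of_real[symmetric])
      have "(norm (r *\<^sub>R z))\<^sup>2 < s \<longleftrightarrow> (norm z)\<^sup>2 < 1"
        using s by (simp add: power_mult_distrib r(2))
      moreover have "(cmod (mono_eval \<alpha> (r *\<^sub>R z)))\<^sup>2 = s ^ mono_degree \<alpha> * (cmod (mono_eval \<alpha> z))\<^sup>2"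
        unfolding rz mono_eval_scale using r
        by (simp add: norm_mult norm_power power_mult_distrib power_mult[symmetric] mult.commute[of _ 2])
           (simp add: power_mult)
      ultimately show "h (0 + r *\<^sub>R z) s =
          ennreal (s ^ mono_degree \<alpha>) * (ennreal ((cmod (mono_eval \<alpha> z))\<^sup>2) * indicator {z. (norm z)\<^sup>2 < 1} z)"
        using s by (simp add: h_def ennreal_mult' indicator_def)
    qed
    also have "(\<integral>\<^sup>+z. ennreal (s ^ mono_degree \<alpha>) * (ennreal ((cmod (mono_eval \<alpha> z))\<^sup>2) * indicator {z. (norm z)\<^sup>2 < 1} z) \<partial>lborel)
        = ennreal (s ^ mono_degree \<alpha>) * moment \<alpha>"
      unfolding moment_def by (rule nn_integral_cmult) measurable
    also have "r ^ DIM(complex ^ 'n) = s ^ CARD('n)"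
      unfolding r(2)[symmetric] by (simp add: power_mult[symmetric] mult.commute)
    also have "ennreal (s ^ CARD('n)) * (ennreal (s ^ mono_degree \<alpha>) * moment \<alpha>) = ennreal (s ^ d) * moment \<alpha>"
      using s by (simp add: d_def power_add ennreal_mult' mult.assoc)
    finally show ?thesis using s by simp
  next
    case False
    have "h z s = 0" for z
    proof -
      have "\<not> ((norm z)\<^sup>2 < s \<and> s \<le> 1)" using False zero_le_power2[of "norm z"] by linarith
      then show ?thesis by (auto simp: h_def)
    qed
    \<comment> \<open>Positivity of the exponent matters at \<open>s = 0\<close>, where the indicator on the right is \<open>1\<close>.\<close>
    moreover have "d > 0" by (simp add: d_def)
    then have "ennreal (s ^ d) * indicator {0..1} s = 0" using False by (cases "s = 0") (auto simp: indicator_def)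
    ultimately show ?thesis by simp
  qed
  have "(\<integral>\<^sup>+s. ennreal (s ^ d) * indicator {0..1} s \<partial>lborel) = ennreal (1 ^ Suc d / real (Suc d) - 0 ^ Suc d / real (Suc d))"
  proof (rule nn_integral_FTC_Icc)
    show "((\<lambda>s. s ^ Suc d / real (Suc d)) has_real_derivative s ^ d) (at s)" for s :: real
      by (auto intro!: derivative_eq_intros simp del: of_nat_Suc power_Suc)
  qed auto
  then have sint: "(\<integral>\<^sup>+s. ennreal (s ^ d) * indicator {0..1} s \<partial>lborel) = ennreal (1 / real (Suc d))"
    by simp
  have "ennreal (1 / real (Suc d)) * moment \<alpha> = (\<integral>\<^sup>+s. ennreal (s ^ d) * indicator {0..1} s * moment \<alpha> \<partial>lborel)"
    unfolding sint[symmetric] by (rule nn_integral_multc[symmetric]) measurable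
  also have "\<dots> = (\<integral>\<^sup>+s. (\<integral>\<^sup>+z. h z s \<partial>lborel) \<partial>lborel)" by (simp add: slice)
  also have "\<dots> = (\<integral>\<^sup>+z. (\<integral>\<^sup>+s. h z s \<partial>lborel) \<partial>lborel)"
    by (rule lborel_pair.Fubini'[OF meas])
  also have "\<dots> = ?R"
  proof (rule nn_integral_cong)
    fix z :: "complex ^ 'n"
    have hz: "h z s = ennreal ((cmod (mono_eval \<alpha> z))\<^sup>2) * indicator {(norm z)\<^sup>2 <.. 1} s" for s
      by (auto simp: h_def indicator_def)
    show "(\<integral>\<^sup>+s. h z s \<partial>lborel) =
        ennreal ((cmod (mono_eval \<alpha> z))\<^sup>2) * ennreal (1 - (norm z)\<^sup>2) * indicator {z. (norm z)\<^sup>2 < 1} z"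
      unfolding hz by (cases "(norm z)\<^sup>2 < 1") (auto simp: nn_integral_cmult_indicator)
  qed
  finally show ?thesis by (simp add: d_def)
qed

text \<open>
  Both previous lemmas compute the integral of \<open>|z\<^sup>\<alpha>|\<^sup>2 (1 - |z|\<^sup>2)\<close> over the ball.
\<close>

lemma norm_mono_fun_recursion:
  fixes \<alpha> :: "'n::finite \<Rightarrow>\<^sub>0 nat"
  shows "real (CARD('n) + mono_degree \<alpha> + 1) * (norm (mono_fun (\<alpha> + Poly_Mapping.single i 1)))\<^sup>2 =
    real (Suc (Poly_Mapping.lookup \<alpha> i)) * (norm (mono_fun \<alpha>))\<^sup>2"
proof -
  let ?V = "emeasure lborel (ball (0 :: complex ^ 'n) 1)"
  have "ennreal (1 / real (Suc (Poly_Mapping.lookup \<alpha> i)) * (norm (mono_fun (\<alpha> + Poly_Mapping.single i 1)))\<^sup>2) =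
      ennreal (1 / real (Suc (Poly_Mapping.lookup \<alpha> i))) * moment (\<alpha> + Poly_Mapping.single i 1) / ?V"
    by (subst ennreal_mult') (simp_all add: norm_mono_fun_moment ennreal_times_divide)
  also have "\<dots> = ennreal (1 / real (CARD('n) + mono_degree \<alpha> + 1)) * moment \<alpha> / ?V"
    unfolding moment_coordinate moment_radial ..
  also have "\<dots> = ennreal (1 / real (CARD('n) + mono_degree \<alpha> + 1) * (norm (mono_fun \<alpha>))\<^sup>2)"
    by (subst ennreal_mult') (simp_all add: norm_mono_fun_moment ennreal_times_divide)
  finally have "1 / real (Suc (Poly_Mapping.lookup \<alpha> i)) * (norm (mono_fun (\<alpha> + Poly_Mapping.single i 1)))\<^sup>2 =
      1 / real (CARD('n) + mono_degree \<alpha> + 1) * (norm (mono_fun \<alpha>))\<^sup>2"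
    by (subst (asm) ennreal_inj) simp_all
  then show ?thesis by (simp add: field_simps)
qed

lemma mono_fun_nonzero: "mono_fun \<alpha> \<noteq> (0 :: 'n::finite bergman)"
proof
  assume "mono_fun \<alpha> = (0 :: 'n bergman)"
  define w :: "complex ^ 'n" where "w = (\<chi> i. 1)"
  have w0: "norm w > 0" by (auto simp: w_def vec_eq_iff)
  define c where "c = 1 / (2 * norm w)"
  have "norm (of_real c *s w) = \<bar>c\<bar> * norm w" by simp
  also have "\<dots> < 1" using w0 by (simp add: c_def)
  finally have "norm (of_real c *s w) < 1" .
  then have "mono_eval \<alpha> (of_real c *s w) = 0"
    using Rep_mono_fun[of "of_real c *s w" \<alpha>] \<open>mono_fun \<alpha> = 0\<close> by (simp add: bergman_rep)
  moreover have "mono_eval \<alpha> w = 1" by (simp add: mono_eval_def w_def)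
  ultimately show False using w0 by (simp add: mono_eval_scale c_def)
qed


section \<open>The row of adjoint multiplication operators is bounded below\<close>

lemma cinner_sum_left: "bergman_cinner (\<Sum>i\<in>A. f i) g = (\<Sum>i\<in>A. bergman_cinner (f i) g)"
  by (induction A rule: infinite_finite_induct) (auto simp: cinner_add_left)

lemma cinner_sum_right: "bergman_cinner g (\<Sum>i\<in>A. f i) = (\<Sum>i\<in>A. bergman_cinner g (f i))"
  by (induction A rule: infinite_finite_induct) (auto simp: cinner_add_right)

definition mono_proj :: "('n::finite \<Rightarrow>\<^sub>0 nat) set \<Rightarrow> 'n bergman \<Rightarrow> 'n bergman" where
  "mono_proj F f = (\<Sum>\<alpha>\<in>F. bergman_cscale (bergman_cinner f (mono_fun \<alpha>) / of_real ((norm (mono_fun \<alpha>))\<^sup>2)) (mono_fun \<alpha>))"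

text \<open>
  The contribution of the exponent \<open>\<alpha>\<close> to the squared norm of \<open>f\<close>.
\<close>

definition mono_weight :: "('n::finite \<Rightarrow>\<^sub>0 nat) \<Rightarrow> 'n bergman \<Rightarrow> real" where
  "mono_weight \<alpha> f = (cmod (bergman_cinner f (mono_fun \<alpha>)))\<^sup>2 / (norm (mono_fun \<alpha>))\<^sup>2"

lemma mono_weight_nonneg: "mono_weight \<alpha> f \<ge> 0"
  by (simp add: mono_weight_def)

lemma norm_mono_fun_pos: "norm (mono_fun \<alpha>) > 0"
  by (simp add: mono_fun_nonzero)

lemma cinner_mono_proj:
  assumes "finite F" "\<beta> \<in> F"
  shows "bergman_cinner (mono_proj F f) (mono_fun \<beta>) = bergman_cinner f (mono_fun \<beta>)"
proof -
  have "bergman_cinner (mono_proj F f) (mono_fun \<beta>) = (\<Sum>\<alpha>\<in>F. if \<alpha> = \<beta> then bergman_cinner f (mono_fun \<beta>) else 0)"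
    unfolding mono_proj_def cinner_sum_left cinner_cscale_left
    using norm_mono_fun_pos[of \<beta>] by (intro sum.cong) (auto simp: mono_fun_orthogonal cinner_self)
  then show ?thesis using assms by simp
qed

lemma mono_proj_residual_orthogonal:
  assumes "finite F" "\<beta> \<in> F"
  shows "bergman_cinner (f - mono_proj F f) (mono_fun \<beta>) = 0"
  using cinner_mono_proj[OF assms] by (simp add: cinner_diff_left)

lemma norm_mono_proj: "finite F \<Longrightarrow> (norm (mono_proj F f))\<^sup>2 = (\<Sum>\<alpha>\<in>F. mono_weight \<alpha> f)"
proof -
  assume F: "finite F"
  have "bergman_cinner (mono_proj F f) (mono_proj F f) =
      (\<Sum>\<alpha>\<in>F. cnj (bergman_cinner f (mono_fun \<alpha>) / of_real ((norm (mono_fun \<alpha>))\<^sup>2)) * bergman_cinner (mono_proj F f) (mono_fun \<alpha>))"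
    unfolding mono_proj_def[of F f] cinner_sum_right cinner_cscale_right ..
  also have "\<dots> = (\<Sum>\<alpha>\<in>F. complex_of_real (mono_weight \<alpha> f))"
  proof (intro sum.cong refl)
    fix \<alpha> assume \<alpha>: "\<alpha> \<in> F"
    have "cnj (a / of_real r) * a = of_real ((cmod a)\<^sup>2 / r)" for a :: complex and r :: real
    proof -
      have "cnj (a / of_real r) * a = (a * cnj a) / of_real r" by simp
      also have "\<dots> = of_real ((cmod a)\<^sup>2) / of_real r" by (simp only: complex_norm_square)
      finally show ?thesis by (simp only: of_real_divide)
    qed
    then show "cnj (bergman_cinner f (mono_fun \<alpha>) / of_real ((norm (mono_fun \<alpha>))\<^sup>2)) *
        bergman_cinner (mono_proj F f) (mono_fun \<alpha>) = complex_of_real (mono_weight \<alpha> f)"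
      by (simp only: cinner_mono_proj[OF F \<alpha>] mono_weight_def)
  qed
  finally have "complex_of_real ((norm (mono_proj F f))\<^sup>2) = complex_of_real (\<Sum>\<alpha>\<in>F. mono_weight \<alpha> f)"
    by (simp only: cinner_self of_real_sum)
  then show ?thesis by (simp only: of_real_eq_iff)
qed

lemma cinner_zero_pythagoras:
  assumes "bergman_cinner f g = 0"
  shows "(norm (f + g))\<^sup>2 = (norm f)\<^sup>2 + (norm g)\<^sup>2"
proof -
  have "inner f g = 0" using assms by (simp add: inner_bergman_def)
  then show ?thesis by (simp add: power2_norm_eq_inner inner_add inner_commute)
qed

lemma cinner_comb_zero:
  "(\<And>\<alpha>. \<alpha> \<in> F \<Longrightarrow> bergman_cinner g (mono_fun \<alpha>) = 0) \<Longrightarrow>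
    bergman_cinner g (\<Sum>\<alpha>\<in>F. bergman_cscale (b \<alpha>) (mono_fun \<alpha>)) = 0"
  by (simp add: cinner_sum_right cinner_cscale_right)

lemma bessel:
  assumes "finite F"
  shows "(\<Sum>\<alpha>\<in>F. mono_weight \<alpha> f) \<le> (norm f)\<^sup>2"
proof -
  have "bergman_cinner (f - mono_proj F f) (mono_proj F f) = 0"
    unfolding mono_proj_def[of F f, THEN arg_cong[where f = "bergman_cinner _"]]
    by (rule cinner_comb_zero) (rule mono_proj_residual_orthogonal[OF assms])
  then have "(norm ((f - mono_proj F f) + mono_proj F f))\<^sup>2 = (norm (f - mono_proj F f))\<^sup>2 + (norm (mono_proj F f))\<^sup>2"
    by (rule cinner_zero_pythagoras)
  then show ?thesis using assms by (simp add: norm_mono_proj)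
qed

lemma poly_fun_expand:
  "poly_fun q = (\<Sum>\<alpha>\<in>Poly_Mapping.keys q. bergman_cscale (Poly_Mapping.lookup q \<alpha>) (mono_fun \<alpha>))"
proof (rule bergman_eqI)
  fix z :: "complex ^ 'a" assume z: "z \<in> ball 0 1"
  have R: "Rep_bergman (\<Sum>i\<in>A. g i) z = (\<Sum>i\<in>A. Rep_bergman (g i) z)" for A and g :: "('a \<Rightarrow>\<^sub>0 nat) \<Rightarrow> 'a bergman"
    by (induction A rule: infinite_finite_induct) (auto simp: bergman_rep)
  show "Rep_bergman (poly_fun q) z =
      Rep_bergman (\<Sum>\<alpha>\<in>Poly_Mapping.keys q. bergman_cscale (Poly_Mapping.lookup q \<alpha>) (mono_fun \<alpha>)) z"
    unfolding R by (simp add: bergman_rep Rep_poly_fun[OF z] Rep_mono_fun[OF z] peval_superset[of "Poly_Mapping.keys q"])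
qed

text \<open>
  If a polynomial with exponents in \<open>F\<close> is close to \<open>f\<close>, then so is the best approximation
  \<open>mono_proj F f\<close>, and its distance to \<open>f\<close> is computed by Pythagoras' theorem.
\<close>

lemma parseval_approx:
  fixes f :: "('n::finite) bergman"
  assumes "e > 0"
  shows "\<exists>F. finite F \<and> (norm f)\<^sup>2 - e < (\<Sum>\<alpha>\<in>F. mono_weight \<alpha> f)"
proof -
  have "f \<in> closure (range poly_fun)" by (simp add: polynomials_dense)
  then obtain q where q: "dist (poly_fun q) f < sqrt e"
    unfolding closure_approachable using assms by (metis rangeE real_sqrt_gt_zero)
  define F where "F = Poly_Mapping.keys q"
  have F: "finite F" by (simp add: F_def)
  define b where "b \<alpha> = bergman_cinner f (mono_fun \<alpha>) / of_real ((norm (mono_fun \<alpha>))\<^sup>2)" for \<alpha>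
  have "mono_proj F f - poly_fun q = (\<Sum>\<alpha>\<in>F. bergman_cscale (b \<alpha> - Poly_Mapping.lookup q \<alpha>) (mono_fun \<alpha>))"
    unfolding poly_fun_expand[of q] mono_proj_def F_def[symmetric] b_def[symmetric]
    by (simp add: cscale_diff_left sum_subtractf)
  then have "bergman_cinner (f - mono_proj F f) (mono_proj F f - poly_fun q) = 0"
    using cinner_comb_zero[OF mono_proj_residual_orthogonal[OF F]] by simp
  from cinner_zero_pythagoras[OF this]
  have 1: "(norm (f - mono_proj F f))\<^sup>2 \<le> (norm (f - poly_fun q))\<^sup>2"
    using zero_le_power2[of "norm (mono_proj F f - poly_fun q)"] by simp
  have "bergman_cinner (f - mono_proj F f) (mono_proj F f) = 0"
    unfolding mono_proj_def[of F f, THEN arg_cong[where f = "bergman_cinner _"]]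
    by (rule cinner_comb_zero) (rule mono_proj_residual_orthogonal[OF F])
  from cinner_zero_pythagoras[OF this]
  have 2: "(norm f)\<^sup>2 = (norm (f - mono_proj F f))\<^sup>2 + (\<Sum>\<alpha>\<in>F. mono_weight \<alpha> f)"
    using F by (simp add: norm_mono_proj)
  have "(norm (f - poly_fun q))\<^sup>2 < (sqrt e)\<^sup>2"
    using q by (intro power_strict_mono) (auto simp: dist_norm norm_minus_commute)
  moreover have "(sqrt e)\<^sup>2 = e" using assms by simp
  ultimately have "(norm f)\<^sup>2 - e < (\<Sum>\<alpha>\<in>F. mono_weight \<alpha> f)" using 1 2 by linarith
  then show ?thesis using F by blast
qed

lemma bergman_mult_pvar_mono_fun:
  "bergman_mult (pvar i) (mono_fun \<alpha>) = mono_fun (\<alpha> + Poly_Mapping.single i 1)"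
  by (rule bergman_eqI) (simp add: bergman_rep Rep_mono_fun mono_eval_add mono_eval_single)

abbreviation coord_adj :: "'n \<Rightarrow> ('n::finite) bergman \<Rightarrow> 'n bergman" where
  "coord_adj i f \<equiv> blinfun_apply (hadj (mult_op (pvar i))) f"

lemma mono_weight_coord_adj:
  fixes f :: "('n::finite) bergman"
  shows "mono_weight \<alpha> (coord_adj i f) =
    mono_weight (\<alpha> + Poly_Mapping.single i 1) f *
      (real (Poly_Mapping.lookup (\<alpha> + Poly_Mapping.single i 1) i) / real (CARD('n) + mono_degree (\<alpha> + Poly_Mapping.single i 1)))"
proof -
  let ?\<beta> = "\<alpha> + Poly_Mapping.single i 1"
  have "bergman_cinner (coord_adj i f) (mono_fun \<alpha>) = bergman_cinner f (mono_fun ?\<beta>)"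
    by (subst (1 2) cinner_cnj)
       (simp add: cinner_hadj[OF clinear_mult_op, symmetric] bergman_mult_pvar_mono_fun)
  moreover have "mono_degree ?\<beta> = mono_degree \<alpha> + 1"
  proof -
    have "(\<Sum>j\<in>UNIV. Poly_Mapping.lookup (Poly_Mapping.single i (1::nat)) j) = (\<Sum>j\<in>UNIV. if j = i then 1 else 0)"
      by (intro sum.cong) (auto simp: lookup_single when_def)
    then show ?thesis by (simp add: mono_degree_def lookup_add sum.distrib)
  qed
  moreover have "Poly_Mapping.lookup ?\<beta> i = Suc (Poly_Mapping.lookup \<alpha> i)" by (simp add: lookup_add)
  moreover note norm_mono_fun_recursion[of \<alpha> i] norm_mono_fun_pos[of \<alpha>] norm_mono_fun_pos[of ?\<beta>]
  moreover have "a / I = a / I' * (k / N)" if "N * I' = k * I" "I > 0" "I' > 0" "N > 0" for a I I' k N :: real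
  proof -
    have "k / N = I' / I" using that by (simp add: field_simps)
    then show ?thesis using that by simp
  qed
  ultimately show ?thesis unfolding mono_weight_def by simp
qed

text \<open>
  Bessel's inequality for \<open>M\<^sub>i\<^sup>* f\<close>, where the shift of exponents by the \<open>i\<close>-th unit vector reindexes the sum.
  The factors \<open>\<beta>\<^sub>i / (n + |\<beta>|)\<close> add up to \<open>|\<beta>| / (n + |\<beta>|)\<close>.
\<close>

lemma coord_adj_lower_bound:
  fixes f :: "('n::finite) bergman"
  assumes F: "finite F"
  shows "(\<Sum>\<beta>\<in>F. mono_weight \<beta> f * (real (mono_degree \<beta>) / real (CARD('n) + mono_degree \<beta>))) \<le> (\<Sum>i\<in>UNIV. (norm (coord_adj i f))\<^sup>2)"
proof -
  have "(\<Sum>\<beta>\<in>F. mono_weight \<beta> f * (real (Poly_Mapping.lookup \<beta> i) / real (CARD('n) + mono_degree \<beta>))) \<le> (norm (coord_adj i f))\<^sup>2" for i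
  proof -
    define t where "t \<beta> = mono_weight \<beta> f * (real (Poly_Mapping.lookup \<beta> i) / real (CARD('n) + mono_degree \<beta>))" for \<beta>
    define s where "s \<alpha> = \<alpha> + Poly_Mapping.single i (1::nat)" for \<alpha>
    have inj: "inj_on s A" for A unfolding s_def by (intro inj_onI) simp
    define G where "G = s -` F"
    have G: "finite G" unfolding G_def by (rule finite_vimageI[OF F inj])
    have "(\<Sum>\<beta>\<in>F. t \<beta>) = (\<Sum>\<beta>\<in>s ` G. t \<beta>)"
    proof (rule sum.mono_neutral_right[OF F])
      show "s ` G \<subseteq> F" by (auto simp: G_def)
      show "\<forall>\<beta>\<in>F - s ` G. t \<beta> = 0"
      proof
        fix \<beta> assume \<beta>: "\<beta> \<in> F - s ` G"
        \<comment> \<open>An exponent outside the range of the shift has \<open>\<beta>\<^sub>i = 0\<close>.\<close>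
        show "t \<beta> = 0"
        proof (cases "Poly_Mapping.lookup \<beta> i = 0")
          case False
          have "s (\<beta> - Poly_Mapping.single i 1) = \<beta>"
            unfolding s_def using False
            by (intro poly_mapping_eqI) (auto simp: lookup_add lookup_minus lookup_single when_def)
          then have "\<beta> \<in> s ` G" using \<beta> unfolding G_def by (metis DiffD1 imageI vimageI)
          then show ?thesis using \<beta> by blast
        qed (simp add: t_def)
      qed
    qed
    also have "\<dots> = (\<Sum>\<alpha>\<in>G. t (s \<alpha>))" by (rule sum.reindex[OF inj, unfolded o_def])
    also have "\<dots> = (\<Sum>\<alpha>\<in>G. mono_weight \<alpha> (coord_adj i f))"
      unfolding t_def s_def mono_weight_coord_adj ..
    also have "\<dots> \<le> (norm (coord_adj i f))\<^sup>2" by (rule bessel[OF G])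
    finally show ?thesis by (simp only: t_def)
  qed
  then have "(\<Sum>i\<in>UNIV. \<Sum>\<beta>\<in>F. mono_weight \<beta> f * (real (Poly_Mapping.lookup \<beta> i) / real (CARD('n) + mono_degree \<beta>))) \<le>
      (\<Sum>i\<in>UNIV. (norm (coord_adj i f))\<^sup>2)"
    by (intro sum_mono)
  moreover have "(\<Sum>i\<in>UNIV. \<Sum>\<beta>\<in>F. mono_weight \<beta> f * (real (Poly_Mapping.lookup \<beta> i) / real (CARD('n) + mono_degree \<beta>))) =
      (\<Sum>\<beta>\<in>F. mono_weight \<beta> f * (real (mono_degree \<beta>) / real (CARD('n) + mono_degree \<beta>)))"
    by (subst sum.swap) (simp add: mono_degree_def sum_distrib_left[symmetric] sum_divide_distrib[symmetric])
  ultimately show ?thesis by simp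
qed

definition low_monos :: "nat \<Rightarrow> ('n::finite \<Rightarrow>\<^sub>0 nat) set" where
  "low_monos N = {\<alpha>. mono_degree \<alpha> < N}"

lemma finite_low_monos: "finite (low_monos N :: ('n::finite \<Rightarrow>\<^sub>0 nat) set)"
proof -
  have "Poly_Mapping.lookup ` (low_monos N :: ('n \<Rightarrow>\<^sub>0 nat) set) \<subseteq> {f. \<forall>i. f i \<in> {..N}}"
  proof (rule image_subsetI, rule CollectI, rule allI)
    fix \<alpha> :: "'n \<Rightarrow>\<^sub>0 nat" and i assume "\<alpha> \<in> low_monos N"
    moreover have "Poly_Mapping.lookup \<alpha> i \<le> mono_degree \<alpha>" unfolding mono_degree_def by (rule member_le_sum) auto
    ultimately show "Poly_Mapping.lookup \<alpha> i \<in> {..N}" by (simp add: low_monos_def)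
  qed
  moreover have "finite {f :: 'n \<Rightarrow> nat. \<forall>i. f i \<in> {..N}}"
  proof -
    have "{f :: 'n \<Rightarrow> nat. \<forall>i. f i \<in> {..N}} = PiE UNIV (\<lambda>_. {..N})" by (simp add: PiE_def Pi_def)
    then show ?thesis by (simp add: finite_PiE)
  qed
  ultimately have "finite (Poly_Mapping.lookup ` (low_monos N :: ('n \<Rightarrow>\<^sub>0 nat) set))" by (rule finite_subset)
  then show ?thesis by (rule finite_imageD) (rule inj_onI, rule poly_mapping_eqI, simp)
qed

text \<open>
  \<open>\<Sum>\<^sub>i M\<^sub>i M\<^sub>i\<^sup>*\<close> multiplies a monomial of degree \<open>m\<close> by \<open>m / (n + m)\<close>, so it is
  close to the identity on functions that vanish to high order at \<open>0\<close>.
\<close>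

lemma coord_adj_high_order:
  fixes f :: "('n::finite) bergman"
  assumes orth: "\<And>\<alpha>. \<alpha> \<in> low_monos N \<Longrightarrow> bergman_cinner f (mono_fun \<alpha>) = 0"
  shows "real N / real (CARD('n) + N) * (norm f)\<^sup>2 \<le> (\<Sum>i\<in>UNIV. (norm (coord_adj i f))\<^sup>2)"
proof -
  define c where "c = real N / real (CARD('n) + N)"
  have c: "0 \<le> c" "c \<le> 1" by (simp_all add: c_def divide_simps)
  have "c * (norm f)\<^sup>2 \<le> (\<Sum>i\<in>UNIV. (norm (coord_adj i f))\<^sup>2) + e" if e: "e > 0" for e
  proof -
    obtain F where F: "finite F" "(norm f)\<^sup>2 - e < (\<Sum>\<alpha>\<in>F. mono_weight \<alpha> f)"
      using parseval_approx[OF e] by blast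
    have "c * (norm f)\<^sup>2 - c * e \<le> c * (\<Sum>\<alpha>\<in>F. mono_weight \<alpha> f)"
      using mult_left_mono[OF less_imp_le[OF F(2)] c(1)] by (simp add: algebra_simps)
    also have "\<dots> = (\<Sum>\<beta>\<in>F. mono_weight \<beta> f * c)" by (simp add: sum_distrib_left mult.commute)
    also have "\<dots> \<le> (\<Sum>\<beta>\<in>F. mono_weight \<beta> f * (real (mono_degree \<beta>) / real (CARD('n) + mono_degree \<beta>)))"
    proof (rule sum_mono)
      fix \<beta>
      show "mono_weight \<beta> f * c \<le> mono_weight \<beta> f * (real (mono_degree \<beta>) / real (CARD('n) + mono_degree \<beta>))"
      proof (cases "mono_degree \<beta> < N")
        case True
        then show ?thesis using orth by (simp add: mono_weight_def low_monos_def)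
      next
        case False
        have "a / (x + a) \<le> b / (x + b)" if "0 < x" "0 \<le> a" "a \<le> b" for a b x :: real
        proof -
          have "u / (x + u) = 1 - x / (x + u)" if "0 \<le> u" for u
            using that \<open>0 < x\<close> by (simp add: field_simps)
          moreover have "x / (x + b) \<le> x / (x + a)" using that by (intro divide_left_mono) auto
          ultimately show ?thesis using that by simp
        qed
        then have "c \<le> real (mono_degree \<beta>) / real (CARD('n) + mono_degree \<beta>)" using False by (simp add: c_def)
        then show ?thesis by (intro mult_left_mono mono_weight_nonneg)
      qed
    qed
    also have "\<dots> \<le> (\<Sum>i\<in>UNIV. (norm (coord_adj i f))\<^sup>2)" by (rule coord_adj_lower_bound[OF F(1)])
    finally have "c * (norm f)\<^sup>2 \<le> (\<Sum>i\<in>UNIV. (norm (coord_adj i f))\<^sup>2) + c * e" by simp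
    moreover have "c * e \<le> e" using c e mult_right_mono[of c 1 e] by simp
    ultimately show ?thesis by linarith
  qed
  then show ?thesis unfolding c_def[symmetric] by (rule field_le_epsilon)
qed


lemma mult_op_add: "mult_op (f + g) = mult_op f + mult_op g"
  by (rule blinfun_eqI) (simp add: bergman_mult_add blinfun.add_left)

lemma mult_op_mult: "mult_op (f * g) = mult_op f o\<^sub>L mult_op g"
  by (rule blinfun_eqI) (simp add: bergman_mult_mult)

lemma hadj_mult_op_const: "blinfun_apply (hadj (mult_op (pconst c))) h = bergman_cscale (cnj c) h"
  by (rule cinner_eqI)
     (simp add: cinner_hadj[OF clinear_mult_op, symmetric] bergman_mult_const cinner_cscale_left cinner_cscale_right)

abbreviation shift_var :: "complex ^ ('n::finite) \<Rightarrow> 'n \<Rightarrow> 'n cpoly" where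
  "shift_var w i \<equiv> pvar i + pconst (- (w $ i))"

lemma hadj_shift_var:
  "blinfun_apply (hadj (mult_op (shift_var w i))) h = coord_adj i h - bergman_cscale (cnj (w $ i)) h"
  unfolding mult_op_add hadj_add blinfun.add_left hadj_mult_op_const
  by (rule bergman_eqI) (simp add: bergman_rep)

text \<open>
  The eigenvalue equations determine the inner products of \<open>h\<close> with all polynomials up to a common factor, and
  polynomials are dense.
\<close>

lemma joint_eigenvector_is_kernel:
  fixes h :: "('n::finite) bergman"
  assumes w: "w \<in> ball 0 1" and eig: "\<And>i. coord_adj i h = bergman_cscale (cnj (w $ i)) h"
  shows "\<exists>c. h = bergman_cscale c (kernel_at w)"
proof -
  have M: "blinfun_apply (hadj (mult_op q)) h = bergman_cscale (cnj (peval q w)) h" for q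
  proof (induction q rule: cpoly_induct)
    case (const c)
    then show ?case by (simp add: hadj_mult_op_const)
  next
    case (var i)
    then show ?case by (simp add: eig)
  next
    case (add f g)
    then show ?case
      by (simp add: mult_op_add hadj_add blinfun.add_left)
         (rule bergman_eqI, simp add: bergman_rep algebra_simps)
  next
    case (mult f g)
    have "blinfun_apply (hadj (mult_op g)) (bergman_cscale c x) = bergman_cscale c (blinfun_apply (hadj (mult_op g)) x)" for c x
      using clinear_hadj[OF clinear_mult_op] unfolding clinear_op_def by blast
    then show ?case using mult by (simp add: mult_op_mult hadj_compose mult.commute)
  qed
  define c where "c = cnj (bergman_cinner bergman_one h)"
  have "bergman_cinner (h - bergman_cscale c (kernel_at w)) (poly_fun q) = 0" for q
  proof -
    have "bergman_cinner (poly_fun q) h = peval q w * bergman_cinner bergman_one h"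
      using cinner_hadj[OF clinear_mult_op, of q bergman_one h] by (simp add: M poly_fun_def cinner_cscale_right)
    moreover have "bergman_cinner (poly_fun q) (bergman_cscale c (kernel_at w)) = cnj c * peval q w"
      by (simp add: cinner_cscale_right cinner_kernel[OF w] Rep_poly_fun[OF w])
    ultimately have "bergman_cinner (poly_fun q) (h - bergman_cscale c (kernel_at w)) = 0"
      by (simp add: cinner_diff_right c_def)
    then show ?thesis by (subst cinner_cnj) simp
  qed
  then have "h - bergman_cscale c (kernel_at w) = 0" by (rule orthogonal_to_polynomials_imp_zero)
  then show ?thesis by auto
qed

text \<open>
  The Bolzano-Weierstrass theorem, applied to one coefficient after the other.
\<close>

lemma bounded_seq_coefficients_converge:
  fixes h :: "nat \<Rightarrow> ('n::finite) bergman"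
  assumes S: "finite S" and b: "\<And>m. norm (h m) \<le> 1"
  shows "\<exists>r. strict_mono (r :: nat \<Rightarrow> nat) \<and> (\<forall>s\<in>S. convergent (\<lambda>m. bergman_cinner (h (r m)) s))"
  using S
proof induction
  case empty
  show ?case by (intro exI[of _ id]) (auto simp: strict_mono_def)
next
  case (insert s S)
  then obtain r where r: "strict_mono r" "\<And>s. s \<in> S \<Longrightarrow> convergent (\<lambda>m. bergman_cinner (h (r m)) s)" by blast
  have "cmod (bergman_cinner (h (r m)) s) \<le> norm s" for m
  proof -
    have "cmod (bergman_cinner (h (r m)) s) \<le> norm (h (r m)) * norm s" by (rule cinner_cauchy_schwarz)
    also have "\<dots> \<le> 1 * norm s" by (intro mult_right_mono b) auto
    finally show ?thesis by simp
  qed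
  then have "\<forall>m. bergman_cinner (h (r m)) s \<in> cball 0 (norm s)" by simp
  moreover have "seq_compact (cball (0::complex) (norm s))"
    by (simp add: compact_imp_seq_compact)
  ultimately obtain l r' where r': "strict_mono r'" "((\<lambda>m. bergman_cinner (h (r m)) s) \<circ> r') \<longlonglongrightarrow> l"
    unfolding seq_compact_def by metis
  have "convergent (\<lambda>m. bergman_cinner (h ((r \<circ> r') m)) u)" if "u \<in> insert s S" for u
  proof (cases "u = s")
    case True
    then show ?thesis using r'(2) by (auto simp: o_def convergent_def)
  next
    case False
    then have "convergent (\<lambda>m. bergman_cinner (h (r m)) u)" using that r(2) by blast
    then show ?thesis
      using convergent_subseq_convergent[of "\<lambda>m. bergman_cinner (h (r m)) u" r'] r'(1) by (simp add: o_def)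
  qed
  then show ?case using r(1) r'(1) strict_mono_o by blast
qed


text \<open>
  Choose \<open>N\<close> with \<open>|w|\<^sup>2 < N / (n + N)\<close> and use the triangle inequality in the \<open>n\<close>-fold Hilbert sum.
\<close>

lemma shift_adj_high_order:
  fixes w :: "complex ^ ('n::finite)"
  assumes w: "w \<in> ball 0 1"
  shows "\<exists>N. \<exists>\<delta>>0. \<forall>k. (\<forall>\<alpha>\<in>low_monos N. bergman_cinner k (mono_fun \<alpha>) = 0) \<longrightarrow>
    \<delta> * norm k \<le> (\<Sum>i\<in>UNIV. norm (blinfun_apply (hadj (mult_op (shift_var w i))) k))"
proof -
  have "(\<lambda>N. 1 - real CARD('n) / real (CARD('n) + N)) \<longlonglongrightarrow> 1 - 0"
    by (intro tendsto_intros tendsto_divide_0[OF tendsto_const] filterlim_at_top_imp_at_infinity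
        filterlim_compose[OF filterlim_real_sequentially] filterlim_tendsto_add_at_top filterlim_add_const_nat_at_top)
       (simp add: add.commute[of "CARD('n)"] filterlim_add_const_nat_at_top)
  moreover have "1 - real CARD('n) / real (CARD('n) + N) = real N / real (CARD('n) + N)" for N
  proof -
    define d where "d = real (CARD('n) + N)"
    have d: "d \<noteq> 0" "d - real CARD('n) = real N" by (simp_all add: d_def add_nonneg_eq_0_iff)
    have "(d - real CARD('n)) / d = 1 - real CARD('n) / d" using d(1) by (simp add: diff_divide_distrib)
    then show ?thesis unfolding d(2) d_def by simp
  qed
  ultimately have "(\<lambda>N. real N / real (CARD('n) + N)) \<longlonglongrightarrow> 1" by simp
  moreover have "(norm w)\<^sup>2 < 1" using w by (simp add: abs_square_less_1)
  ultimately have "\<forall>\<^sub>F N in sequentially. (norm w)\<^sup>2 < real N / real (CARD('n) + N)"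
    by (intro order_tendstoD)
  then obtain N where N: "(norm w)\<^sup>2 < real N / real (CARD('n) + N)"
    by (auto simp: eventually_sequentially)
  define c where "c = real N / real (CARD('n) + N)"
  define \<delta> where "\<delta> = sqrt c - norm w"
  have \<delta>: "\<delta> > 0" using N unfolding \<delta>_def c_def[symmetric] by (simp add: real_less_rsqrt)
  have "\<delta> * norm k \<le> (\<Sum>i\<in>UNIV. norm (blinfun_apply (hadj (mult_op (shift_var w i))) k))"
    if k: "\<forall>\<alpha>\<in>low_monos N. bergman_cinner k (mono_fun \<alpha>) = 0" for k
  proof -
    let ?R = "\<lambda>i. blinfun_apply (hadj (mult_op (shift_var w i))) k"
    have "c * (norm k)\<^sup>2 \<le> (\<Sum>i\<in>UNIV. (norm (coord_adj i k))\<^sup>2)"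
      unfolding c_def using k by (intro coord_adj_high_order) blast
    then have "sqrt c * norm k \<le> L2_set (\<lambda>i. norm (coord_adj i k)) UNIV"
      unfolding L2_set_def using real_sqrt_le_mono real_sqrt_mult real_sqrt_abs abs_norm_cancel by metis
    also have "\<dots> \<le> L2_set (\<lambda>i. norm (?R i) + cmod (w $ i) * norm k) UNIV"
    proof (rule L2_set_mono)
      fix i
      have "coord_adj i k = ?R i + bergman_cscale (cnj (w $ i)) k" by (simp add: hadj_shift_var)
      then show "norm (coord_adj i k) \<le> norm (?R i) + cmod (w $ i) * norm k"
        using norm_triangle_ineq[of "?R i" "bergman_cscale (cnj (w $ i)) k"] by (simp add: norm_bergman_cscale)
    qed simp
    also have "\<dots> \<le> L2_set (\<lambda>i. norm (?R i)) UNIV + L2_set (\<lambda>i. cmod (w $ i) * norm k) UNIV"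
      by (rule L2_set_triangle_ineq)
    also have "L2_set (\<lambda>i. cmod (w $ i) * norm k) UNIV = norm w * norm k"
      by (simp add: norm_vec_def L2_set_left_distrib)
    also have "L2_set (\<lambda>i. norm (?R i)) UNIV \<le> (\<Sum>i\<in>UNIV. norm (?R i))"
      by (rule L2_set_le_sum) auto
    finally show ?thesis by (simp add: \<delta>_def algebra_simps)
  qed
  then show ?thesis using \<delta> by blast
qed

lemma norm_mono_proj_le:
  "norm (mono_proj F h) \<le> (\<Sum>\<alpha>\<in>F. cmod (bergman_cinner h (mono_fun \<alpha>)) / norm (mono_fun \<alpha>))"
proof -
  have "norm (mono_proj F h) \<le> (\<Sum>\<alpha>\<in>F. norm (bergman_cscale (bergman_cinner h (mono_fun \<alpha>) /
      of_real ((norm (mono_fun \<alpha>))\<^sup>2)) (mono_fun \<alpha>)))"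
    unfolding mono_proj_def by (rule norm_sum)
  also have "\<dots> = (\<Sum>\<alpha>\<in>F. cmod (bergman_cinner h (mono_fun \<alpha>)) / norm (mono_fun \<alpha>))"
    by (intro sum.cong) (auto simp: norm_bergman_cscale norm_divide norm_power norm_mult power2_eq_square)
  finally show ?thesis .
qed

text \<open>
  The estimate on functions that vanish to high order leaves a finite-dimensional defect; a
  compactness argument removes it, because by \<open>joint_eigenvector_is_kernel\<close> the row of adjoints
  has no kernel besides the multiples of \<open>kernel_at w\<close>.
\<close>

proposition shift_adj_bounded_below:
  fixes w :: "complex ^ ('n::finite)"
  assumes w: "w \<in> ball 0 1"
  shows "\<exists>\<delta>>0. \<forall>h. bergman_cinner h (kernel_at w) = 0 \<longrightarrow>
    \<delta> * norm h \<le> (\<Sum>i\<in>UNIV. norm (blinfun_apply (hadj (mult_op (shift_var w i))) h))"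
proof (rule ccontr)
  assume contra: "\<not> ?thesis"
  define R where "R i = hadj (mult_op (shift_var w i))" for i
  define N1 where "N1 h = (\<Sum>i\<in>UNIV. norm (blinfun_apply (R i) h))" for h
  have N1_scale: "N1 (c *\<^sub>R h) = \<bar>c\<bar> * N1 h" for c h
    by (simp add: N1_def blinfun.scaleR_right sum_distrib_left)
  have N1_diff: "N1 (g - h) \<le> N1 g + N1 h" for g h
    unfolding N1_def sum.distrib[symmetric] blinfun.diff_right by (intro sum_mono norm_triangle_ineq4)
  define C where "C = (\<Sum>i\<in>UNIV. norm (R i))"
  have C: "C \<ge> 0" unfolding C_def by (intro sum_nonneg) auto
  have N1_bound: "N1 h \<le> C * norm h" for h
    unfolding N1_def C_def sum_distrib_right by (intro sum_mono norm_blinfun)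
  obtain N \<delta> where \<delta>: "\<delta> > 0" and high: "\<And>k. (\<And>\<alpha>. \<alpha> \<in> low_monos N \<Longrightarrow> bergman_cinner k (mono_fun \<alpha>) = 0) \<Longrightarrow> \<delta> * norm k \<le> N1 k"
    using shift_adj_high_order[OF w] unfolding N1_def R_def by blast
  let ?S = "low_monos N :: ('n \<Rightarrow>\<^sub>0 nat) set"
  define W where "W h = (\<Sum>\<alpha>\<in>?S. cmod (bergman_cinner h (mono_fun \<alpha>)) / norm (mono_fun \<alpha>))" for h
  have est: "norm h \<le> N1 h / \<delta> + (1 + C / \<delta>) * W h" for h
  proof -
    define g where "g = mono_proj ?S h"
    have gW: "norm g \<le> W h" unfolding g_def W_def by (rule norm_mono_proj_le)
    have "\<delta> * norm (h - g) \<le> N1 (h - g)"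
      unfolding g_def by (intro high mono_proj_residual_orthogonal finite_low_monos)
    also have "\<dots> \<le> N1 h + C * norm g" using N1_diff[of h g] N1_bound[of g] by linarith
    finally have "norm (h - g) \<le> (N1 h + C * norm g) / \<delta>"
      using \<delta> by (simp add: pos_le_divide_eq mult.commute)
    then have "norm h \<le> N1 h / \<delta> + (1 + C / \<delta>) * norm g"
      using norm_triangle_ineq[of "h - g" g] by (simp add: add_divide_distrib algebra_simps)
    also have "\<dots> \<le> N1 h / \<delta> + (1 + C / \<delta>) * W h"
      using gW C \<delta> by (intro add_left_mono mult_left_mono) auto
    finally show ?thesis .
  qed
  have "\<exists>h. norm h = 1 \<and> bergman_cinner h (kernel_at w) = 0 \<and> N1 h < 1 / real (Suc m)" for m
  proof -
    have "1 / real (Suc m) > 0" by simp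
    then obtain h where h: "bergman_cinner h (kernel_at w) = 0" "\<not> 1 / real (Suc m) * norm h \<le> N1 h"
      using contra unfolding N1_def R_def by blast
    have "N1 h \<ge> 0" unfolding N1_def by (intro sum_nonneg) auto
    then have h0: "norm h > 0" using h(2) by (cases "norm h = 0") auto
    define h' where "h' = (1 / norm h) *\<^sub>R h"
    have "norm h' = 1" using h0 by (simp add: h'_def)
    moreover have "bergman_cinner h' (kernel_at w) = 0" using h(1) by (simp add: h'_def cscale_scaleR cinner_cscale_left)
    moreover have "N1 h' < 1 / real (Suc m)"
      using h(2) h0 by (simp add: h'_def N1_scale pos_divide_less_eq)
    ultimately show ?thesis by blast
  qed
  then obtain h where h1: "\<And>m. norm (h m) = 1" and hk: "\<And>m. bergman_cinner (h m) (kernel_at w) = 0"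
    and hN: "\<And>m. N1 (h m) < 1 / real (Suc m)" by metis
  have "finite (mono_fun ` ?S)" using finite_low_monos by blast
  then obtain r where r: "strict_mono r"
    and rc: "\<And>\<alpha>. \<alpha> \<in> ?S \<Longrightarrow> convergent (\<lambda>m. bergman_cinner (h (r m)) (mono_fun \<alpha>))"
    using bounded_seq_coefficients_converge[of "mono_fun ` ?S" h] h1 by auto
  define l where "l \<alpha> = lim (\<lambda>m. bergman_cinner (h (r m)) (mono_fun \<alpha>))" for \<alpha>
  have l: "(\<lambda>m. bergman_cinner (h (r m)) (mono_fun \<alpha>)) \<longlonglongrightarrow> l \<alpha>" if "\<alpha> \<in> ?S" for \<alpha>
    using rc[OF that] unfolding l_def by (simp add: convergent_LIMSEQ_iff)
  have N1_0: "(\<lambda>m. N1 (h (r m))) \<longlonglongrightarrow> 0"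
  proof -
    have "(\<lambda>m. N1 (h m)) \<longlonglongrightarrow> 0"
    proof (rule tendsto_sandwich[OF _ _ tendsto_const LIMSEQ_Suc[OF lim_1_over_n]])
      show "\<forall>\<^sub>F m in sequentially. 0 \<le> N1 (h m)"
        unfolding N1_def by (intro always_eventually allI sum_nonneg) auto
      show "\<forall>\<^sub>F m in sequentially. N1 (h m) \<le> 1 / real (Suc m)"
        using hN by (intro always_eventually allI less_imp_le)
    qed
    from LIMSEQ_subseq_LIMSEQ[OF this r] show ?thesis by (simp add: o_def)
  qed
  define t where "t m = N1 (h (r m)) / \<delta> + (1 + C / \<delta>) *
      (\<Sum>\<alpha>\<in>?S. cmod (bergman_cinner (h (r m)) (mono_fun \<alpha>) - l \<alpha>) / norm (mono_fun \<alpha>))" for m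
  have "(\<lambda>m. \<Sum>\<alpha>\<in>?S. cmod (bergman_cinner (h (r m)) (mono_fun \<alpha>) - l \<alpha>) / norm (mono_fun \<alpha>)) \<longlonglongrightarrow> 0"
  proof (rule tendsto_null_sum)
    fix \<alpha> assume "\<alpha> \<in> ?S"
    then have "(\<lambda>m. cmod (bergman_cinner (h (r m)) (mono_fun \<alpha>) - l \<alpha>) / norm (mono_fun \<alpha>)) \<longlonglongrightarrow> cmod (l \<alpha> - l \<alpha>) / norm (mono_fun \<alpha>)"
      by (intro tendsto_intros l) (simp_all add: mono_fun_nonzero)
    then show "(\<lambda>m. cmod (bergman_cinner (h (r m)) (mono_fun \<alpha>) - l \<alpha>) / norm (mono_fun \<alpha>)) \<longlonglongrightarrow> 0" by simp
  qed
  then have "t \<longlonglongrightarrow> 0 / \<delta> + (1 + C / \<delta>) * 0"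
    unfolding t_def using \<delta> by (intro tendsto_intros N1_0) auto
  then have t0: "t \<longlonglongrightarrow> 0" by simp
  have dist_t: "norm (h (r m) - h (r m')) \<le> t m + t m'" for m m'
  proof -
    have "W (h (r m) - h (r m')) \<le>
        (\<Sum>\<alpha>\<in>?S. cmod (bergman_cinner (h (r m)) (mono_fun \<alpha>) - l \<alpha>) / norm (mono_fun \<alpha>)) +
        (\<Sum>\<alpha>\<in>?S. cmod (bergman_cinner (h (r m')) (mono_fun \<alpha>) - l \<alpha>) / norm (mono_fun \<alpha>))"
      unfolding W_def sum.distrib[symmetric]
    proof (rule sum_mono)
      fix \<alpha>
      have "cmod (a - b) \<le> cmod (a - d) + cmod (b - d)" for a b d :: complex
        using norm_triangle_ineq4[of "a - d" "b - d"] by simp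
      then show "cmod (bergman_cinner (h (r m) - h (r m')) (mono_fun \<alpha>)) / norm (mono_fun \<alpha>)
        \<le> cmod (bergman_cinner (h (r m)) (mono_fun \<alpha>) - l \<alpha>) / norm (mono_fun \<alpha>) +
          cmod (bergman_cinner (h (r m')) (mono_fun \<alpha>) - l \<alpha>) / norm (mono_fun \<alpha>)"
        unfolding cinner_diff_left add_divide_distrib[symmetric] by (intro divide_right_mono) auto
    qed
    then have "(1 + C / \<delta>) * W (h (r m) - h (r m')) \<le> (1 + C / \<delta>) *
        ((\<Sum>\<alpha>\<in>?S. cmod (bergman_cinner (h (r m)) (mono_fun \<alpha>) - l \<alpha>) / norm (mono_fun \<alpha>)) +
        (\<Sum>\<alpha>\<in>?S. cmod (bergman_cinner (h (r m')) (mono_fun \<alpha>) - l \<alpha>) / norm (mono_fun \<alpha>)))"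
      using C \<delta> by (intro mult_left_mono) auto
    moreover have "N1 (h (r m) - h (r m')) / \<delta> \<le> N1 (h (r m)) / \<delta> + N1 (h (r m')) / \<delta>"
      unfolding add_divide_distrib[symmetric] using \<delta> by (intro divide_right_mono N1_diff) auto
    ultimately show ?thesis
      using est[of "h (r m) - h (r m')"] unfolding t_def distrib_left by linarith
  qed
  have "Cauchy (\<lambda>m. h (r m))"
  proof (rule CauchyI)
    fix e :: real assume "e > 0"
    then have "\<forall>\<^sub>F m in sequentially. t m < e / 2" using t0 by (intro order_tendstoD) auto
    then obtain M where M: "\<And>m. m \<ge> M \<Longrightarrow> t m < e / 2" by (auto simp: eventually_sequentially)
    have "norm (h (r m) - h (r m')) < e" if "m \<ge> M" "m' \<ge> M" for m m'
      using dist_t[of m m'] M[OF that(1)] M[OF that(2)] by linarith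
    then show "\<exists>M. \<forall>m\<ge>M. \<forall>n\<ge>M. norm (h (r m) - h (r n)) < e" by blast
  qed
  then obtain g where g: "(\<lambda>m. h (r m)) \<longlonglongrightarrow> g" using Cauchy_convergent convergent_def by blast
  have g1: "norm g = 1" using tendsto_norm[OF g] h1 by (simp add: LIMSEQ_const_iff)
  have gk: "bergman_cinner g (kernel_at w) = 0"
    using bounded_linear.tendsto[OF bounded_linear_cinner_left g, of "kernel_at w"] hk by (simp add: LIMSEQ_const_iff)
  have "blinfun_apply (R i) g = 0" for i
  proof -
    have "(\<lambda>m. norm (blinfun_apply (R i) (h (r m)))) \<longlonglongrightarrow> norm (blinfun_apply (R i) g)"
      by (intro tendsto_intros g)
    moreover have "norm (blinfun_apply (R i) (h (r m))) \<le> N1 (h (r m))" for m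
      unfolding N1_def by (rule member_le_sum) auto
    ultimately have "norm (blinfun_apply (R i) g) \<le> 0" by (intro LIMSEQ_le[OF _ N1_0]) auto
    then show ?thesis by simp
  qed
  then have "coord_adj i g = bergman_cscale (cnj (w $ i)) g" for i
    unfolding R_def hadj_shift_var by simp
  then obtain c where c: "g = bergman_cscale c (kernel_at w)" using joint_eigenvector_is_kernel[OF w] by blast
  then have "c = 0" using gk kernel_nonzero[OF w] by (auto simp: cinner_cscale_left cinner_self)
  then show False using c g1 by simp
qed


section \<open>Operators on the quotient module\<close>

definition complex_subspace :: "('n::finite) bergman set \<Rightarrow> bool" where
  "complex_subspace Q \<longleftrightarrow> subspace Q \<and> closed Q \<and> (\<forall>c. \<forall>h\<in>Q. bergman_cscale c h \<in> Q)"

lemma orth_proj_ex1: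
  assumes Q: "complex_subspace Q"
  shows "\<exists>!g. g \<in> Q \<and> (\<forall>k\<in>Q. bergman_cinner (h - g) k = 0)"
proof (rule ex_ex1I)
  obtain g where "g \<in> Q" "\<forall>k\<in>Q. inner (h - g) k = 0"
    using orthogonal_projection_exists[of Q h] Q unfolding complex_subspace_def by blast
  then show "\<exists>g. g \<in> Q \<and> (\<forall>k\<in>Q. bergman_cinner (h - g) k = 0)"
    using cinner_zero_iff_inner[of Q "h - g"] Q unfolding complex_subspace_def by blast
next
  fix g g' assume g: "g \<in> Q \<and> (\<forall>k\<in>Q. bergman_cinner (h - g) k = 0)"
    and g': "g' \<in> Q \<and> (\<forall>k\<in>Q. bergman_cinner (h - g') k = 0)"
  have "g - g' \<in> Q" using g g' Q unfolding complex_subspace_def by (simp add: subspace_diff)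
  then have "bergman_cinner (h - g') (g - g') - bergman_cinner (h - g) (g - g') = 0" using g g' by simp
  then have "bergman_cinner (g - g') (g - g') = 0" by (simp add: cinner_diff_left)
  then show "g = g'" by (simp add: cinner_self)
qed

lemma orth_proj_in: "complex_subspace Q \<Longrightarrow> orth_proj Q h \<in> Q"
  and orth_proj_orth: "complex_subspace Q \<Longrightarrow> k \<in> Q \<Longrightarrow> bergman_cinner (h - orth_proj Q h) k = 0"
  using theI'[OF orth_proj_ex1[of Q h]] unfolding orth_proj_def by blast+

lemma orth_proj_eqI:
  assumes "complex_subspace Q" "g \<in> Q" "\<And>k. k \<in> Q \<Longrightarrow> bergman_cinner (h - g) k = 0"
  shows "orth_proj Q h = g"
  using orth_proj_ex1[OF assms(1), of h] orth_proj_in[OF assms(1)] orth_proj_orth[OF assms(1)] assms(2,3)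
  by blast

lemma orth_proj_id: "complex_subspace Q \<Longrightarrow> h \<in> Q \<Longrightarrow> orth_proj Q h = h"
  by (rule orth_proj_eqI) auto

lemma orth_proj_zero:
  "complex_subspace Q \<Longrightarrow> (\<And>k. k \<in> Q \<Longrightarrow> bergman_cinner h k = 0) \<Longrightarrow> orth_proj Q h = 0"
  by (rule orth_proj_eqI) (auto simp: complex_subspace_def subspace_0)

lemma norm_orth_proj_le: "complex_subspace Q \<Longrightarrow> norm (orth_proj Q h) \<le> norm h"
proof -
  assume Q: "complex_subspace Q"
  have "(norm ((h - orth_proj Q h) + orth_proj Q h))\<^sup>2 = (norm (h - orth_proj Q h))\<^sup>2 + (norm (orth_proj Q h))\<^sup>2"
    by (rule cinner_zero_pythagoras[OF orth_proj_orth[OF Q orth_proj_in[OF Q]]])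
  then have "(norm (orth_proj Q h))\<^sup>2 \<le> (norm h)\<^sup>2" by simp
  then show ?thesis by (rule power2_le_imp_le) simp
qed

lemma orth_proj_cscale: "complex_subspace Q \<Longrightarrow> orth_proj Q (bergman_cscale c h) = bergman_cscale c (orth_proj Q h)"
proof (rule orth_proj_eqI)
  assume Q: "complex_subspace Q"
  show "bergman_cscale c (orth_proj Q h) \<in> Q" using orth_proj_in[OF Q] Q unfolding complex_subspace_def by blast
  show "bergman_cinner (bergman_cscale c h - bergman_cscale c (orth_proj Q h)) k = 0" if "k \<in> Q" for k
    using orth_proj_orth[OF Q that, of h] by (simp add: cscale_diff[symmetric] cinner_cscale_left)
qed

lemma bounded_linear_orth_proj:
  assumes Q: "complex_subspace Q"
  shows "bounded_linear (orth_proj Q)"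
proof (rule bounded_linear_intro[where K = 1])
  fix x y
  show "orth_proj Q (x + y) = orth_proj Q x + orth_proj Q y"
  proof (rule orth_proj_eqI[OF Q])
    show "orth_proj Q x + orth_proj Q y \<in> Q"
      using orth_proj_in[OF Q] Q unfolding complex_subspace_def by (simp add: subspace_add)
    show "bergman_cinner (x + y - (orth_proj Q x + orth_proj Q y)) k = 0" if "k \<in> Q" for k
      using orth_proj_orth[OF Q that, of x] orth_proj_orth[OF Q that, of y]
      by (simp add: cinner_diff_left cinner_add_left)
  qed
next
  fix r x
  show "orth_proj Q (r *\<^sub>R x) = r *\<^sub>R orth_proj Q x"
    unfolding cscale_scaleR by (rule orth_proj_cscale[OF Q])
  show "norm (orth_proj Q x) \<le> norm x * 1" using norm_orth_proj_le[OF Q] by simp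
qed

definition proj_op :: "('n::finite) bergman set \<Rightarrow> 'n operator" where
  "proj_op Q = Blinfun (orth_proj Q)"

lemma proj_op_apply: "complex_subspace Q \<Longrightarrow> blinfun_apply (proj_op Q) h = orth_proj Q h"
  by (simp add: proj_op_def bounded_linear_Blinfun_apply bounded_linear_orth_proj)

lemma hadj_proj_op:
  assumes Q: "complex_subspace Q"
  shows "hadj (proj_op Q) = proj_op Q"
proof (rule hadj_unique)
  fix x y
  have "bergman_cinner (x - orth_proj Q x) (orth_proj Q y) = 0" "bergman_cinner (y - orth_proj Q y) (orth_proj Q x) = 0"
    using orth_proj_orth[OF Q orth_proj_in[OF Q]] by auto
  then have "inner x (orth_proj Q y) = inner (orth_proj Q x) (orth_proj Q y)"
    "inner y (orth_proj Q x) = inner (orth_proj Q y) (orth_proj Q x)"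
    by (simp_all add: inner_bergman_def cinner_diff_left)
  then show "inner (blinfun_apply (proj_op Q) x) y = inner x (blinfun_apply (proj_op Q) y)"
    unfolding proj_op_apply[OF Q] by (simp only: inner_commute[of "orth_proj Q x"])
qed

lemma compression_eq:
  assumes Q: "complex_subspace Q"
  shows "compression Q f = proj_op Q o\<^sub>L mult_op f o\<^sub>L proj_op Q"
proof (rule blinfun_eqI)
  fix h
  have "bounded_linear (\<lambda>h. orth_proj Q (bergman_mult f (orth_proj Q h)))"
    by (intro bounded_linear_compose[OF bounded_linear_orth_proj[OF Q]]
        bounded_linear_compose[OF bounded_linear_bergman_mult] bounded_linear_orth_proj[OF Q])
  then show "blinfun_apply (compression Q f) h = blinfun_apply (proj_op Q o\<^sub>L mult_op f o\<^sub>L proj_op Q) h"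
    unfolding compression_def by (simp add: bounded_linear_Blinfun_apply proj_op_apply[OF Q])
qed

lemma compression_apply:
  "complex_subspace Q \<Longrightarrow> blinfun_apply (compression Q f) h = orth_proj Q (bergman_mult f (orth_proj Q h))"
  by (simp add: compression_eq proj_op_apply)

lemma bounded_opsI:
  assumes "clinear_op T" "\<And>h. h \<in> Q \<Longrightarrow> blinfun_apply T h \<in> Q"
    "\<And>h. (\<And>g. g \<in> Q \<Longrightarrow> bergman_cinner h g = 0) \<Longrightarrow> blinfun_apply T h = 0"
  shows "T \<in> bounded_ops Q"
  using assms unfolding bounded_ops_def clinear_op_def by blast

lemma bounded_opsD:
  assumes "T \<in> bounded_ops Q"
  shows "clinear_op T" "h \<in> Q \<Longrightarrow> blinfun_apply T h \<in> Q"
    "(\<And>g. g \<in> Q \<Longrightarrow> bergman_cinner h g = 0) \<Longrightarrow> blinfun_apply T h = 0"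
  using assms unfolding bounded_ops_def clinear_op_def by blast+

lemma bounded_ops_apply_proj:
  assumes Q: "complex_subspace Q" and T: "T \<in> bounded_ops Q"
  shows "blinfun_apply T h = blinfun_apply T (orth_proj Q h)"
proof -
  have "blinfun_apply T (h - orth_proj Q h) = 0"
    by (rule bounded_opsD(3)[OF T]) (rule orth_proj_orth[OF Q])
  then show ?thesis by (simp add: blinfun.diff_right)
qed

lemma bounded_ops_range: "complex_subspace Q \<Longrightarrow> T \<in> bounded_ops Q \<Longrightarrow> blinfun_apply T h \<in> Q"
  by (subst bounded_ops_apply_proj) (auto intro: bounded_opsD(2) orth_proj_in)

lemma bounded_ops_eqI:
  assumes "complex_subspace Q" "S \<in> bounded_ops Q" "T \<in> bounded_ops Q"
    "\<And>h. h \<in> Q \<Longrightarrow> blinfun_apply S h = blinfun_apply T h"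
  shows "S = T"
  using assms(4)[OF orth_proj_in[OF assms(1)]]
  by (intro blinfun_eqI) (subst bounded_ops_apply_proj[OF assms(1,2)], subst bounded_ops_apply_proj[OF assms(1,3)], simp)

lemma compression_bounded_ops: "complex_subspace Q \<Longrightarrow> compression Q f \<in> bounded_ops Q"
  by (rule bounded_opsI)
     (auto simp: clinear_op_def compression_apply orth_proj_cscale mult_op_cscale orth_proj_in orth_proj_zero
       linear_0[OF bounded_linear.linear[OF bounded_linear_bergman_mult]] orth_proj_id complex_subspace_def subspace_0)

lemma hadj_bounded_ops:
  assumes Q: "complex_subspace Q" and T: "T \<in> bounded_ops Q"
  shows "hadj T \<in> bounded_ops Q"
proof (rule bounded_opsI)
  have cl: "clinear_op T" by (rule bounded_opsD(1)[OF T])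
  show "clinear_op (hadj T)" by (rule clinear_hadj[OF cl])
  show "blinfun_apply (hadj T) h \<in> Q" if "h \<in> Q" for h
  proof -
    let ?g = "blinfun_apply (hadj T) h"
    have "bergman_cinner x ?g = bergman_cinner x (orth_proj Q ?g)" for x
    proof -
      have "bergman_cinner x ?g = bergman_cinner (blinfun_apply T (orth_proj Q x)) h"
        using bounded_ops_apply_proj[OF Q T, of x] by (simp add: cinner_hadj[OF cl, symmetric])
      also have "\<dots> = bergman_cinner (orth_proj Q x) ?g" by (rule cinner_hadj[OF cl])
      also have "\<dots> = bergman_cinner (blinfun_apply (proj_op Q) x) ?g" by (simp add: proj_op_apply[OF Q])
      also have "\<dots> = bergman_cinner x (blinfun_apply (hadj (proj_op Q)) ?g)"
        by (rule cinner_hadj) (simp add: clinear_op_def proj_op_apply[OF Q] orth_proj_cscale[OF Q])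
      finally show ?thesis by (simp add: hadj_proj_op[OF Q] proj_op_apply[OF Q])
    qed
    then have "?g = orth_proj Q ?g" by (rule cinner_eqI)
    then show ?thesis using orth_proj_in[OF Q] by metis
  qed
  show "blinfun_apply (hadj T) h = 0" if h: "\<And>g. g \<in> Q \<Longrightarrow> bergman_cinner h g = 0" for h
  proof (rule cinner_eqI)
    fix x
    have "bergman_cinner x (blinfun_apply (hadj T) h) = cnj (bergman_cinner h (blinfun_apply T x))"
      by (simp add: cinner_hadj[OF cl, symmetric] cinner_cnj[of h])
    then show "bergman_cinner x (blinfun_apply (hadj T) h) = bergman_cinner x 0"
      using h[OF bounded_ops_range[OF Q T]] by simp
  qed
qed

text \<open>
  An operator on \<open>Q\<close>, extended by \<open>0\<close>, has exactly one adjoint among such operators, and this is \<open>hadj\<close>. So the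
  adjoint in the definition may be named.
\<close>

lemma cstar_subalgebra_iff:
  assumes Q: "complex_subspace Q"
  shows "cstar_subalgebra Q A \<longleftrightarrow> A \<subseteq> bounded_ops Q \<and> closed A \<and> 0 \<in> A \<and>
     (\<forall>S\<in>A. \<forall>T\<in>A. S + T \<in> A) \<and> (\<forall>c. \<forall>T\<in>A. op_cscale c T \<in> A) \<and>
     (\<forall>S\<in>A. \<forall>T\<in>A. S o\<^sub>L T \<in> A) \<and> (\<forall>T\<in>A. hadj T \<in> A)"
proof -
  have "(\<exists>T'\<in>A. \<forall>g\<in>Q. \<forall>h\<in>Q. bergman_cinner (blinfun_apply T g) h = bergman_cinner g (blinfun_apply T' h)) \<longleftrightarrow> hadj T \<in> A"
    if A: "A \<subseteq> bounded_ops Q" "T \<in> A" for T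
  proof
    have T: "T \<in> bounded_ops Q" using A by blast
    assume "\<exists>T'\<in>A. \<forall>g\<in>Q. \<forall>h\<in>Q. bergman_cinner (blinfun_apply T g) h = bergman_cinner g (blinfun_apply T' h)"
    then obtain T' where T': "T' \<in> A" "\<And>g h. g \<in> Q \<Longrightarrow> h \<in> Q \<Longrightarrow> bergman_cinner (blinfun_apply T g) h = bergman_cinner g (blinfun_apply T' h)"
      by blast
    have T'b: "T' \<in> bounded_ops Q" using T' A by blast
    have "hadj T = T'"
    proof (rule bounded_ops_eqI[OF Q hadj_bounded_ops[OF Q T] T'b])
      fix h assume h: "h \<in> Q"
      let ?d = "blinfun_apply (hadj T) h - blinfun_apply T' h"
      have "?d \<in> Q"
        using bounded_ops_range[OF Q hadj_bounded_ops[OF Q T]] bounded_ops_range[OF Q T'b] Q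
        unfolding complex_subspace_def by (simp add: subspace_diff)
      then have "bergman_cinner ?d ?d = 0"
        using T'(2)[OF \<open>?d \<in> Q\<close> h] cinner_hadj[OF bounded_opsD(1)[OF T], of ?d h]
        by (simp only: cinner_diff_right[of ?d]) simp
      then show "blinfun_apply (hadj T) h = blinfun_apply T' h" by (simp add: cinner_self)
    qed
    then show "hadj T \<in> A" using T' by simp
  next
    assume "hadj T \<in> A"
    then show "\<exists>T'\<in>A. \<forall>g\<in>Q. \<forall>h\<in>Q. bergman_cinner (blinfun_apply T g) h = bergman_cinner g (blinfun_apply T' h)"
      using cinner_hadj[OF bounded_opsD(1)] A by blast
  qed
  then have "A \<subseteq> bounded_ops Q \<Longrightarrow>
      (\<forall>T\<in>A. \<exists>T'\<in>A. \<forall>g\<in>Q. \<forall>h\<in>Q. bergman_cinner (blinfun_apply T g) h = bergman_cinner g (blinfun_apply T' h))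
      \<longleftrightarrow> (\<forall>T\<in>A. hadj T \<in> A)" by blast
  then show ?thesis unfolding cstar_subalgebra_def by blast
qed

lemma bounded_ops_add: "complex_subspace Q \<Longrightarrow> S \<in> bounded_ops Q \<Longrightarrow> T \<in> bounded_ops Q \<Longrightarrow> S + T \<in> bounded_ops Q"
  unfolding bounded_ops_def complex_subspace_def by (auto simp: blinfun.add_left cscale_add subspace_add)

lemma bounded_ops_cscale: "complex_subspace Q \<Longrightarrow> T \<in> bounded_ops Q \<Longrightarrow> op_cscale c T \<in> bounded_ops Q"
  unfolding bounded_ops_def complex_subspace_def by (auto simp: blinfun_apply_op_cscale mult.commute)

lemma bounded_ops_compose: "S \<in> bounded_ops Q \<Longrightarrow> T \<in> bounded_ops Q \<Longrightarrow> S o\<^sub>L T \<in> bounded_ops Q"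
  unfolding bounded_ops_def by (auto simp: blinfun.zero_right)

lemma bounded_ops_zero: "complex_subspace Q \<Longrightarrow> 0 \<in> bounded_ops Q"
  unfolding bounded_ops_def complex_subspace_def by (auto simp: subspace_0)

lemma op_cscale_minus: "op_cscale (-1) T = - T"
  by (rule blinfun_eqI, rule bergman_eqI) (simp add: blinfun_apply_op_cscale blinfun.minus_left bergman_rep)

lemma bounded_ops_diff: "complex_subspace Q \<Longrightarrow> S \<in> bounded_ops Q \<Longrightarrow> T \<in> bounded_ops Q \<Longrightarrow> S - T \<in> bounded_ops Q"
  using bounded_ops_add[of Q S "- T"] bounded_ops_cscale[of Q T "-1"] by (simp add: op_cscale_minus)

lemma tendsto_cscale:
  fixes f :: "'b \<Rightarrow> ('a::finite) bergman"
  shows "(c \<longlongrightarrow> a) F \<Longrightarrow> (f \<longlongrightarrow> g) F \<Longrightarrow> ((\<lambda>x. bergman_cscale (c x) (f x)) \<longlongrightarrow> bergman_cscale a g) F"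
proof -
  have "bounded_bilinear (bergman_cscale :: complex \<Rightarrow> 'a bergman \<Rightarrow> 'a bergman)"
  proof (rule bounded_bilinear.intro)
    show "\<exists>K. \<forall>a (b :: 'a bergman). norm (bergman_cscale a b) \<le> norm a * norm b * K"
      by (intro exI[of _ 1]) (simp add: norm_bergman_cscale)
    show "bergman_cscale (a + a') b = bergman_cscale a b + bergman_cscale a' b" for a a' and b :: "'a bergman"
      by (rule bergman_eqI) (simp add: bergman_rep algebra_simps)
    show "bergman_cscale (r *\<^sub>R a) b = r *\<^sub>R bergman_cscale a b" for r a and b :: "'a bergman"
      by (rule bergman_eqI) (simp add: bergman_rep scaleR_conv_of_real)
    show "bergman_cscale a (r *\<^sub>R b) = r *\<^sub>R bergman_cscale a b" for r a and b :: "'a bergman"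
      by (rule bergman_eqI) (simp add: bergman_rep)
  qed (rule cscale_add)
  then show "(c \<longlongrightarrow> a) F \<Longrightarrow> (f \<longlongrightarrow> g) F \<Longrightarrow> ((\<lambda>x. bergman_cscale (c x) (f x)) \<longlongrightarrow> bergman_cscale a g) F"
    by (rule bounded_bilinear.tendsto)
qed

lemma closed_bounded_ops:
  assumes Q: "complex_subspace Q"
  shows "closed (bounded_ops Q)"
  unfolding closed_sequential_limits
proof (intro allI impI, elim conjE)
  fix X T assume X: "\<forall>n. X n \<in> bounded_ops Q" and lim: "X \<longlonglongrightarrow> T"
  have app: "(\<lambda>n. blinfun_apply (X n) h) \<longlonglongrightarrow> blinfun_apply T h" for h
    by (intro blinfun.tendsto lim tendsto_const)
  show "T \<in> bounded_ops Q"
  proof (rule bounded_opsI)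
    show "clinear_op T"
      unfolding clinear_op_def
    proof (intro allI)
      fix c h
      have "(\<lambda>n. blinfun_apply (X n) (bergman_cscale c h)) \<longlonglongrightarrow> bergman_cscale c (blinfun_apply T h)"
      proof -
        have "blinfun_apply (X n) (bergman_cscale c h) = bergman_cscale c (blinfun_apply (X n) h)" for n
          using bounded_opsD(1)[of "X n" Q] X unfolding clinear_op_def by blast
        then show ?thesis by (simp only: tendsto_cscale[OF tendsto_const app])
      qed
      then show "blinfun_apply T (bergman_cscale c h) = bergman_cscale c (blinfun_apply T h)"
        using app LIMSEQ_unique by blast
    qed
    show "blinfun_apply T h \<in> Q" if "h \<in> Q" for h
      using closed_sequentially[of Q "\<lambda>n. blinfun_apply (X n) h"] Q X bounded_opsD(2) that app
      unfolding complex_subspace_def by blast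
    show "blinfun_apply T h = 0" if "\<And>g. g \<in> Q \<Longrightarrow> bergman_cinner h g = 0" for h
    proof -
      have "(\<lambda>n. blinfun_apply (X n) h) = (\<lambda>n. 0)" using X bounded_opsD(3) that by blast
      then show ?thesis using app[of h] by (simp add: LIMSEQ_const_iff)
    qed
  qed
qed

lemma cstar_subalgebra_bounded_ops: "complex_subspace Q \<Longrightarrow> cstar_subalgebra Q (bounded_ops Q)"
  by (simp add: cstar_subalgebra_iff closed_bounded_ops bounded_ops_zero bounded_ops_add bounded_ops_cscale
      bounded_ops_compose hadj_bounded_ops)

lemma cinner_zero_sym: "bergman_cinner f g = 0 \<longleftrightarrow> bergman_cinner g f = 0"
  using cinner_cnj[of f g] by auto

lemma quotient_module_iff: "h \<in> quotient_module p \<longleftrightarrow> (\<forall>q. bergman_cinner h (poly_fun (p * q)) = 0)"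
proof
  have "poly_fun (p * q) \<in> submodule p" for q
    unfolding submodule_def poly_fun_def by (rule subsetD[OF closure_subset rangeI])
  moreover assume "h \<in> quotient_module p"
  ultimately show "\<forall>q. bergman_cinner h (poly_fun (p * q)) = 0" by (simp add: quotient_module_def)
next
  assume h: "\<forall>q. bergman_cinner h (poly_fun (p * q)) = 0"
  let ?R = "range (\<lambda>q. bergman_mult (p * q) bergman_one)"
  have "closed {g. bergman_cinner g h = 0}"
    by (intro closed_Collect_eq linear_continuous_on bounded_linear_cinner_left continuous_on_const)
  moreover have "?R \<subseteq> {g. bergman_cinner g h = 0}"
  proof (rule image_subsetI, rule CollectI)
    fix q
    show "bergman_cinner (bergman_mult (p * q) bergman_one) h = 0"
      unfolding cinner_zero_sym[of _ h] using h by (simp add: poly_fun_def)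
  qed
  ultimately have "closure ?R \<subseteq> {g. bergman_cinner g h = 0}" by (rule closure_minimal[rotated])
  then have "bergman_cinner h g = 0" if "g \<in> closure ?R" for g
    using that unfolding cinner_zero_sym[of h g] by (rule subsetD[THEN CollectD])
  then show "h \<in> quotient_module p" by (simp add: quotient_module_def submodule_def)
qed

lemma quotient_subspace: "complex_subspace (quotient_module p)"
  unfolding complex_subspace_def
proof (intro conjI allI ballI)
  show "subspace (quotient_module p)"
    by (rule subspaceI) (auto simp: quotient_module_iff cinner_add_left cscale_scaleR cinner_cscale_left)
  show "bergman_cscale c h \<in> quotient_module p" if "h \<in> quotient_module p" for c h
    using that by (simp add: quotient_module_iff cinner_cscale_left)
  have "quotient_module p = (\<Inter>q. {h. bergman_cinner h (poly_fun (p * q)) = 0})"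
    by (auto simp: quotient_module_iff)
  then show "closed (quotient_module p)"
    by (auto intro!: closed_INT closed_Collect_eq linear_continuous_on bounded_linear_cinner_left)
qed

lemma quotient_module_coinvariant:
  assumes "h \<in> quotient_module p"
  shows "blinfun_apply (hadj (mult_op f)) h \<in> quotient_module p"
  unfolding quotient_module_iff
proof
  fix q
  have "bergman_cinner (poly_fun (p * q)) (blinfun_apply (hadj (mult_op f)) h) = bergman_cinner (poly_fun (p * (f * q))) h"
    by (simp add: cinner_hadj[OF clinear_mult_op, symmetric] poly_fun_mult[symmetric] mult_ac)
  also have "\<dots> = 0" using assms by (simp add: quotient_module_iff cinner_zero_sym[of _ h])
  finally show "bergman_cinner (blinfun_apply (hadj (mult_op f)) h) (poly_fun (p * q)) = 0"
    by (simp only: cinner_zero_sym)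
qed

text \<open>
  The adjoint of a compression needs no projection, because the module is invariant under \<open>M\<^sub>f\<^sup>*\<close>. All algebraic
  rules for compressions are therefore checked on adjoints.
\<close>

lemma hadj_compression_apply:
  assumes "h \<in> quotient_module p"
  shows "blinfun_apply (hadj (compression (quotient_module p) f)) h = blinfun_apply (hadj (mult_op f)) h"
  using assms
  by (simp add: compression_eq[OF quotient_subspace] hadj_compose hadj_proj_op[OF quotient_subspace] proj_op_apply[OF quotient_subspace] orth_proj_id[OF quotient_subspace]
      quotient_module_coinvariant)

lemma compression_eqI:
  assumes "T \<in> bounded_ops (quotient_module p)"
    and "\<And>h. h \<in> quotient_module p \<Longrightarrow> blinfun_apply (hadj T) h = blinfun_apply (hadj (mult_op f)) h"
  shows "compression (quotient_module p) f = T"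
proof -
  have "hadj (compression (quotient_module p) f) = hadj T"
    by (rule bounded_ops_eqI[OF quotient_subspace hadj_bounded_ops[OF quotient_subspace compression_bounded_ops[OF quotient_subspace]] hadj_bounded_ops[OF quotient_subspace assms(1)]])
       (simp add: hadj_compression_apply assms(2))
  then show ?thesis by (metis hadj_hadj)
qed

lemma compression_mult:
  "compression (quotient_module p) (f * g) = compression (quotient_module p) f o\<^sub>L compression (quotient_module p) g"
  by (rule compression_eqI)
     (simp_all add: bounded_ops_compose compression_bounded_ops[OF quotient_subspace] hadj_compose hadj_compression_apply
       quotient_module_coinvariant mult_op_mult)

lemma compression_add:
  "compression (quotient_module p) (f + g) = compression (quotient_module p) f + compression (quotient_module p) g"
  by (rule compression_eqI)
     (simp_all add: bounded_ops_add[OF quotient_subspace] compression_bounded_ops[OF quotient_subspace] hadj_add hadj_compression_apply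
       mult_op_add blinfun.add_left)

lemma bergman_mult_one: "bergman_mult 1 x = x"
  by (rule bergman_eqI) (simp add: bergman_rep)

lemma compression_one_apply:
  "blinfun_apply (compression (quotient_module p) 1) h = orth_proj (quotient_module p) h"
  by (simp add: compression_apply[OF quotient_subspace] bergman_mult_one orth_proj_id[OF quotient_subspace] orth_proj_in[OF quotient_subspace])

lemma compression_const:
  "compression (quotient_module p) (pconst c) = op_cscale c (compression (quotient_module p) 1)"
  by (rule blinfun_eqI)
     (simp add: compression_one_apply blinfun_apply_op_cscale compression_apply[OF quotient_subspace] bergman_mult_one bergman_mult_const
       orth_proj_cscale[OF quotient_subspace] orth_proj_id[OF quotient_subspace] orth_proj_in[OF quotient_subspace])

text \<open>Polynomials are dense, so \<open>p h\<close> lies in \<open>[p]\<close> for every \<open>h\<close> in the Bergman space.\<close>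

lemma compression_self: "compression (quotient_module p) p = 0"
proof (rule compression_eqI[OF bounded_ops_zero[OF quotient_subspace]])
  fix h assume h: "h \<in> quotient_module p"
  have "bergman_cinner (blinfun_apply (hadj (mult_op p)) h) (poly_fun q) = 0" for q
  proof -
    have "bergman_cinner (poly_fun q) (blinfun_apply (hadj (mult_op p)) h) = bergman_cinner (poly_fun (p * q)) h"
      by (simp add: cinner_hadj[OF clinear_mult_op, symmetric] poly_fun_mult)
    also have "\<dots> = 0" using h by (simp add: quotient_module_iff cinner_zero_sym[of _ h])
    finally show ?thesis by (simp only: cinner_zero_sym)
  qed
  then have "blinfun_apply (hadj (mult_op p)) h = 0" by (rule orthogonal_to_polynomials_imp_zero)
  moreover have "hadj (0 :: 'a operator) = 0" by (rule hadj_unique) simp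
  ultimately show "blinfun_apply (hadj 0) h = blinfun_apply (hadj (mult_op p)) h" by simp
qed

lemma kernel_in_quotient_module:
  assumes "w \<in> zero_set p" "w \<in> ball 0 1"
  shows "kernel_at w \<in> quotient_module p"
  unfolding quotient_module_iff
proof
  fix q
  have "bergman_cinner (poly_fun (p * q)) (kernel_at w) = 0"
    using assms(1) by (simp add: cinner_kernel[OF assms(2)] Rep_poly_fun[OF assms(2)] zero_set_def)
  then show "bergman_cinner (kernel_at w) (poly_fun (p * q)) = 0" by (simp only: cinner_zero_sym)
qed

lemma toeplitz_algebra_subset:
  "cstar_subalgebra (quotient_module p) A \<Longrightarrow> range (compression (quotient_module p)) \<subseteq> A \<Longrightarrow> toeplitz_algebra p \<subseteq> A"
  unfolding toeplitz_algebra_def by blast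

lemma compression_in_toeplitz: "compression (quotient_module p) f \<in> toeplitz_algebra p"
  unfolding toeplitz_algebra_def by blast

lemma toeplitz_bounded_ops: "toeplitz_algebra p \<subseteq> bounded_ops (quotient_module p)"
  by (rule toeplitz_algebra_subset[OF cstar_subalgebra_bounded_ops[OF quotient_subspace]])
     (use compression_bounded_ops[OF quotient_subspace] in blast)

lemma cstar_subalgebra_toeplitz: "cstar_subalgebra (quotient_module p) (toeplitz_algebra p)"
  unfolding cstar_subalgebra_iff[OF quotient_subspace]
proof (intro conjI)
  show "toeplitz_algebra p \<subseteq> bounded_ops (quotient_module p)" by (rule toeplitz_bounded_ops)
  show "closed (toeplitz_algebra p)"
    unfolding toeplitz_algebra_def by (rule closed_Inter) (simp add: cstar_subalgebra_iff[OF quotient_subspace])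
qed (unfold toeplitz_algebra_def, auto simp: cstar_subalgebra_iff[OF quotient_subspace])

lemma zero_compact_op: "complex_subspace Q \<Longrightarrow> 0 \<in> compact_ops Q"
proof -
  assume Q: "complex_subspace Q"
  have "blinfun_apply 0 ` (Q \<inter> cball 0 1) \<subseteq> {0}" by auto
  then have "finite (blinfun_apply (0 :: 'a operator) ` (Q \<inter> cball 0 1))" using finite_subset by blast
  then have "compact (blinfun_apply (0 :: 'a operator) ` (Q \<inter> cball 0 1))" by (rule finite_imp_compact)
  then have "compact (closure (blinfun_apply (0 :: 'a operator) ` (Q \<inter> cball 0 1)))"
    by (simp add: closure_closed compact_imp_closed)
  then show ?thesis using bounded_ops_zero[OF Q] by (simp add: compact_ops_def)
qed

lemma calkin_class_self: "complex_subspace Q \<Longrightarrow> T \<in> bounded_ops Q \<Longrightarrow> T \<in> calkin_class Q T"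
  by (simp add: calkin_class_def zero_compact_op)


section \<open>Boundary points of the zero set give characters\<close>

definition approx_eigen :: "(nat \<Rightarrow> ('n::finite) bergman) \<Rightarrow> 'n operator \<Rightarrow> complex \<Rightarrow> bool" where
  "approx_eigen u T \<mu> \<longleftrightarrow> (\<lambda>k. blinfun_apply T (u k) - bergman_cscale \<mu> (u k)) \<longlonglongrightarrow> 0"

lemma approx_eigen_add:
  assumes "approx_eigen u S \<mu>" "approx_eigen u T \<nu>"
  shows "approx_eigen u (S + T) (\<mu> + \<nu>)"
  using tendsto_add[OF assms[unfolded approx_eigen_def]]
  unfolding approx_eigen_def by (simp add: blinfun.add_left cscale_add_left algebra_simps)

lemma approx_eigen_cscale:
  assumes "approx_eigen u T \<nu>"
  shows "approx_eigen u (op_cscale c T) (c * \<nu>)"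
  using tendsto_cscale[OF tendsto_const[of c] assms[unfolded approx_eigen_def]]
  unfolding approx_eigen_def by (simp add: blinfun_apply_op_cscale cscale_diff)

lemma approx_eigen_compose:
  assumes "approx_eigen u S \<mu>" "approx_eigen u T \<nu>" "clinear_op S"
  shows "approx_eigen u (S o\<^sub>L T) (\<mu> * \<nu>)"
proof -
  have "(\<lambda>k. blinfun_apply S (blinfun_apply T (u k) - bergman_cscale \<nu> (u k)) +
      bergman_cscale \<nu> (blinfun_apply S (u k) - bergman_cscale \<mu> (u k))) \<longlonglongrightarrow> blinfun_apply S 0 + bergman_cscale \<nu> 0"
    using assms(1,2) unfolding approx_eigen_def by (intro tendsto_add tendsto_cscale tendsto_const blinfun.tendsto)
  moreover have "blinfun_apply S (blinfun_apply T (u k) - bergman_cscale \<nu> (u k)) +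
      bergman_cscale \<nu> (blinfun_apply S (u k) - bergman_cscale \<mu> (u k)) =
      blinfun_apply (S o\<^sub>L T) (u k) - bergman_cscale (\<mu> * \<nu>) (u k)" for k
    using assms(3) by (simp add: clinear_op_def blinfun.diff_right cscale_diff mult.commute)
  ultimately show ?thesis unfolding approx_eigen_def by (simp add: blinfun.zero_right)
qed

lemma approx_eigen_norm_le:
  assumes u: "\<And>k. norm (u k) = 1" and T: "approx_eigen u T \<nu>"
  shows "cmod \<nu> \<le> norm T"
proof -
  have "cmod \<nu> \<le> norm T + norm (blinfun_apply T (u k) - bergman_cscale \<nu> (u k))" for k
  proof -
    have "cmod \<nu> = norm (bergman_cscale \<nu> (u k))" by (simp add: norm_bergman_cscale u)
    also have "\<dots> \<le> norm (blinfun_apply T (u k)) + norm (blinfun_apply T (u k) - bergman_cscale \<nu> (u k))"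
      using norm_triangle_ineq4[of "blinfun_apply T (u k)" "blinfun_apply T (u k) - bergman_cscale \<nu> (u k)"] by simp
    also have "norm (blinfun_apply T (u k)) \<le> norm T" using norm_blinfun[of T "u k"] by (simp add: u)
    finally show ?thesis by simp
  qed
  moreover have "(\<lambda>k. norm T + norm (blinfun_apply T (u k) - bergman_cscale \<nu> (u k))) \<longlonglongrightarrow> norm T + norm (0 :: 'a bergman)"
    using T unfolding approx_eigen_def by (intro tendsto_intros)
  ultimately have "cmod \<nu> \<le> norm T + norm (0 :: 'a bergman)" by (intro LIMSEQ_le_const) auto
  then show ?thesis by simp
qed

lemma approx_eigen_diff:
  assumes "approx_eigen u S \<mu>" "approx_eigen u T \<nu>"
  shows "approx_eigen u (S - T) (\<mu> - \<nu>)"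
  using approx_eigen_add[OF assms(1) approx_eigen_cscale[OF assms(2), of "-1"]] by (simp add: op_cscale_minus)

lemma approx_eigen_limit:
  assumes u: "\<And>k. norm (u k) = 1" and X: "\<And>n. approx_eigen u (X n) (l n)"
    and lim: "X \<longlonglongrightarrow> T" "l \<longlonglongrightarrow> \<nu>"
  shows "approx_eigen u T \<nu>"
  unfolding approx_eigen_def
proof (rule LIMSEQ_I)
  fix e :: real assume "e > 0"
  then have e3: "e / 3 > 0" by simp
  obtain n where n: "norm (X n - T) < e / 3" "norm (l n - \<nu>) < e / 3"
    using LIMSEQ_D[OF lim(1) e3] LIMSEQ_D[OF lim(2) e3] by (metis linear)
  obtain K where K: "\<And>k. k \<ge> K \<Longrightarrow> norm (blinfun_apply (X n) (u k) - bergman_cscale (l n) (u k)) < e / 3"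
    using LIMSEQ_D[OF X[of n, unfolded approx_eigen_def] e3] by auto
  have "norm (blinfun_apply T (u k) - bergman_cscale \<nu> (u k)) < e" if "k \<ge> K" for k
  proof -
    have "blinfun_apply T (u k) - bergman_cscale \<nu> (u k) =
        (blinfun_apply (X n) (u k) - bergman_cscale (l n) (u k)) - blinfun_apply (X n - T) (u k) +
        bergman_cscale (l n - \<nu>) (u k)"
      by (simp add: blinfun.diff_left cscale_diff_left)
    also have "norm \<dots> \<le> norm (blinfun_apply (X n) (u k) - bergman_cscale (l n) (u k)) +
        norm (blinfun_apply (X n - T) (u k)) + norm (bergman_cscale (l n - \<nu>) (u k))"
      by (meson norm_triangle_ineq norm_triangle_ineq4 add_right_mono order_trans)
    also have "norm (blinfun_apply (X n - T) (u k)) \<le> norm (X n - T)"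
      using norm_blinfun[of "X n - T" "u k"] by (simp add: u)
    also have "norm (bergman_cscale (l n - \<nu>) (u k)) = norm (l n - \<nu>)" by (simp add: norm_bergman_cscale u)
    finally show ?thesis using K[OF that] n by linarith
  qed
  then show "\<exists>K. \<forall>k\<ge>K. norm (blinfun_apply T (u k) - bergman_cscale \<nu> (u k) - 0) < e" by auto
qed

text \<open>
  Multiplication by the coordinates maps the unit ball of the Bergman space into that of its
  \<open>n\<close>-fold sum, because \<open>|z| < 1\<close>. For a normalized kernel at \<open>w\<close> this leaves a defect of
  at most \<open>1 - |w|\<^sup>2\<close> in the eigenvalue equation.
\<close>

lemma coordinate_contraction: "(\<Sum>i\<in>UNIV. (norm (bergman_mult (pvar i) h))\<^sup>2) \<le> (norm (h :: ('n::finite) bergman))\<^sup>2"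
proof -
  have "(\<Sum>i\<in>UNIV. (norm (bergman_mult (pvar i) h))\<^sup>2) =
      (LINT z|ball_measure. (\<Sum>i\<in>UNIV. (cmod (Rep_bergman (bergman_mult (pvar i) h) z))\<^sup>2))"
    unfolding norm_bergman_sq
    by (rule Bochner_Integration.integral_sum[symmetric]) (rule Rep_bergman_sq_integrable)
  also have "\<dots> \<le> (LINT z|ball_measure. (cmod (Rep_bergman h z))\<^sup>2)"
  proof (rule integral_mono)
    show "integrable ball_measure (\<lambda>z. \<Sum>i\<in>UNIV. (cmod (Rep_bergman (bergman_mult (pvar i) h) z))\<^sup>2)"
      by (intro Bochner_Integration.integrable_sum Rep_bergman_sq_integrable)
    show "integrable ball_measure (\<lambda>z. (cmod (Rep_bergman h z))\<^sup>2)" by (rule Rep_bergman_sq_integrable)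
    fix z :: "complex ^ 'n"
    have "(\<Sum>i\<in>UNIV. (cmod (Rep_bergman (bergman_mult (pvar i) h) z))\<^sup>2) = (norm z)\<^sup>2 * (cmod (Rep_bergman h z))\<^sup>2"
      by (simp add: bergman_rep norm_mult power_mult_distrib norm_sq_coord sum_distrib_right)
    also have "\<dots> \<le> (cmod (Rep_bergman h z))\<^sup>2"
    proof (cases "z \<in> ball 0 1")
      case True
      then have "(norm z)\<^sup>2 \<le> 1" by (simp add: abs_square_le_1)
      then show ?thesis using mult_right_mono[of "(norm z)\<^sup>2" 1 "(cmod (Rep_bergman h z))\<^sup>2"] by simp
    qed (simp add: Rep_bergman_outside)
    finally show "(\<Sum>i\<in>UNIV. (cmod (Rep_bergman (bergman_mult (pvar i) h) z))\<^sup>2) \<le> (cmod (Rep_bergman h z))\<^sup>2" .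
  qed
  also have "\<dots> = (norm h)\<^sup>2" by (simp add: norm_bergman_sq)
  finally show ?thesis .
qed

definition unit_kernel :: "complex ^ ('n::finite) \<Rightarrow> 'n bergman" where
  "unit_kernel w = (1 / norm (kernel_at w)) *\<^sub>R kernel_at w"

lemma norm_unit_kernel: "w \<in> ball 0 1 \<Longrightarrow> norm (unit_kernel w) = 1"
  using kernel_nonzero[of w] by (simp add: unit_kernel_def)

lemma hadj_mult_op_unit_kernel:
  "w \<in> ball 0 1 \<Longrightarrow> blinfun_apply (hadj (mult_op f)) (unit_kernel w) = bergman_cscale (cnj (peval f w)) (unit_kernel w)"
  unfolding unit_kernel_def blinfun.scaleR_right
  by (subst hadj_mult_op_kernel) (simp_all add: cscale_scaleR mult.commute)

lemma unit_kernel_almost_eigen: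
  assumes w: "w \<in> ball 0 1"
  shows "(norm (bergman_mult (pvar i) (unit_kernel w) - bergman_cscale (w $ i) (unit_kernel w)))\<^sup>2 \<le> 1 - (norm w)\<^sup>2"
proof -
  let ?u = "unit_kernel w"
  have u1: "norm ?u = 1" by (rule norm_unit_kernel[OF w])
  have d: "(norm (bergman_mult (pvar j) ?u - bergman_cscale (w $ j) ?u))\<^sup>2 = (norm (bergman_mult (pvar j) ?u))\<^sup>2 - (cmod (w $ j))\<^sup>2" for j
  proof -
    let ?m = "bergman_mult (pvar j) ?u"
    have "bergman_cinner ?m ?u = w $ j"
      using cinner_hadj[OF clinear_mult_op, of "pvar j" ?u ?u]
      by (simp add: hadj_mult_op_unit_kernel[OF w] cinner_cscale_right cinner_self u1)
    then have "bergman_cinner (?m - bergman_cscale (w $ j) ?u) (bergman_cscale (w $ j) ?u) = 0"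
      by (simp add: cinner_diff_left cinner_cscale_left cinner_cscale_right cinner_self u1)
    from cinner_zero_pythagoras[OF this] show ?thesis by (simp add: norm_bergman_cscale u1)
  qed
  have "(norm (bergman_mult (pvar i) ?u - bergman_cscale (w $ i) ?u))\<^sup>2 \<le>
      (\<Sum>j\<in>UNIV. (norm (bergman_mult (pvar j) ?u - bergman_cscale (w $ j) ?u))\<^sup>2)"
    by (rule member_le_sum) auto
  also have "\<dots> = (\<Sum>j\<in>UNIV. (norm (bergman_mult (pvar j) ?u))\<^sup>2) - (norm w)\<^sup>2"
    by (simp add: d sum_subtractf norm_sq_coord)
  also have "\<dots> \<le> 1 - (norm w)\<^sup>2" using coordinate_contraction[of ?u] by (simp add: u1)
  finally show ?thesis .
qed

text \<open>
  The defect estimate settles the coordinates, and approximate eigenvalues respect sums and products.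
\<close>

lemma unit_kernel_approx_eigen:
  assumes w: "\<And>k. w k \<in> ball 0 1" and lim: "w \<longlonglongrightarrow> z" and z: "norm z = 1"
  shows "approx_eigen (\<lambda>k. unit_kernel (w k)) (mult_op f) (peval f z)"
proof (induction f rule: cpoly_induct)
  case (const c)
  show ?case by (simp add: approx_eigen_def bergman_mult_const)
next
  case (var i)
  let ?u = "\<lambda>k. unit_kernel (w k)"
  have "(\<lambda>k. bergman_mult (pvar i) (?u k) - bergman_cscale (w k $ i) (?u k)) \<longlonglongrightarrow> 0"
  proof (rule tendsto_norm_zero_cancel)
    have "(\<lambda>k. sqrt (1 - (norm (w k))\<^sup>2)) \<longlonglongrightarrow> sqrt (1 - (norm z)\<^sup>2)" by (intro tendsto_intros lim)
    then have lim0: "(\<lambda>k. sqrt (1 - (norm (w k))\<^sup>2)) \<longlonglongrightarrow> 0" by (simp add: z)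
    show "(\<lambda>k. norm (bergman_mult (pvar i) (?u k) - bergman_cscale (w k $ i) (?u k))) \<longlonglongrightarrow> 0"
      by (rule tendsto_sandwich[OF _ _ tendsto_const lim0])
         (use unit_kernel_almost_eigen[OF w] in \<open>auto intro!: always_eventually real_le_rsqrt\<close>)
  qed
  moreover have "(\<lambda>k. bergman_cscale (w k $ i - z $ i) (?u k)) \<longlonglongrightarrow> 0"
  proof (rule tendsto_norm_zero_cancel)
    have "(\<lambda>k. cmod (w k $ i - z $ i)) \<longlonglongrightarrow> cmod (z $ i - z $ i)" by (intro tendsto_intros lim)
    then show "(\<lambda>k. norm (bergman_cscale (w k $ i - z $ i) (?u k))) \<longlonglongrightarrow> 0"
      by (simp add: norm_bergman_cscale norm_unit_kernel[OF w])
  qed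
  ultimately have "(\<lambda>k. (bergman_mult (pvar i) (?u k) - bergman_cscale (w k $ i) (?u k)) +
      bergman_cscale (w k $ i - z $ i) (?u k)) \<longlonglongrightarrow> 0 + 0" by (rule tendsto_add)
  then show ?case by (simp add: approx_eigen_def cscale_diff_left)
next
  case (add f g)
  then show ?case by (simp add: mult_op_add approx_eigen_add)
next
  case (mult f g)
  then show ?case by (simp add: mult_op_mult approx_eigen_compose clinear_mult_op)
qed

text \<open>
  For a compact operator a nonzero approximate eigenvalue would make a subsequence of the normalized kernels
  converge, and the limit would be annihilated by multiplication with all \<open>x\<^sub>i - z\<^sub>i\<close>, where
  \<open>x\<close> is the variable.
\<close>

lemma unit_kernel_compact_eigen_zero:
  fixes z :: "complex ^ ('n::finite)"
  assumes w: "\<And>k. w k \<in> ball 0 1" and lim: "w \<longlonglongrightarrow> z" and z: "norm z = 1"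
    and uQ: "\<And>k. unit_kernel (w k) \<in> Q"
    and K: "K \<in> compact_ops Q" and eig: "approx_eigen (\<lambda>k. unit_kernel (w k)) K \<nu>"
  shows "\<nu> = 0"
proof (rule ccontr)
  assume \<nu>: "\<nu> \<noteq> 0"
  let ?u = "\<lambda>k. unit_kernel (w k)"
  have u1: "norm (?u k) = 1" for k by (rule norm_unit_kernel[OF w])
  let ?C = "closure (blinfun_apply K ` (Q \<inter> cball 0 1))"
  have "seq_compact ?C" using K by (simp add: compact_ops_def compact_imp_seq_compact)
  moreover have "\<forall>k. blinfun_apply K (?u k) \<in> ?C"
    using uQ u1 closure_subset by (intro allI subsetD[OF closure_subset] imageI) simp
  ultimately obtain v r where r: "strict_mono r" and v: "((\<lambda>k. blinfun_apply K (?u k)) \<circ> r) \<longlonglongrightarrow> v"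
    unfolding seq_compact_def by metis
  have sub: "(\<lambda>k. X (r k)) \<longlonglongrightarrow> L" if "X \<longlonglongrightarrow> L" for X :: "nat \<Rightarrow> 'n bergman" and L
    using LIMSEQ_subseq_LIMSEQ[OF that r] by (simp add: o_def)
  have "(\<lambda>k. blinfun_apply K (?u (r k)) - (blinfun_apply K (?u (r k)) - bergman_cscale \<nu> (?u (r k)))) \<longlonglongrightarrow> v - 0"
    using v sub[OF eig[unfolded approx_eigen_def]] by (intro tendsto_diff) (simp_all add: o_def)
  then have "(\<lambda>k. bergman_cscale \<nu> (?u (r k))) \<longlonglongrightarrow> v" by simp
  from tendsto_cscale[OF tendsto_const[of "1 / \<nu>"] this]
  have g: "(\<lambda>k. ?u (r k)) \<longlonglongrightarrow> bergman_cscale (1 / \<nu>) v" using \<nu> by simp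
  define g where "g = bergman_cscale (1 / \<nu>) v"
  have g1: "norm g = 1" using tendsto_norm[OF g] by (simp add: u1 LIMSEQ_const_iff g_def)
  have eig_g: "bergman_mult (pvar i) g = bergman_cscale (z $ i) g" for i
  proof -
    have "(\<lambda>k. blinfun_apply (mult_op (pvar i)) (?u (r k)) - bergman_cscale (z $ i) (?u (r k))) \<longlonglongrightarrow>
        blinfun_apply (mult_op (pvar i)) g - bergman_cscale (z $ i) g"
      unfolding g_def by (intro tendsto_diff tendsto_cscale tendsto_const blinfun.tendsto g)
    moreover have "(\<lambda>k. blinfun_apply (mult_op (pvar i)) (?u (r k)) - bergman_cscale (z $ i) (?u (r k))) \<longlonglongrightarrow> 0"
      using sub[OF unit_kernel_approx_eigen[OF w lim z, of "pvar i", unfolded approx_eigen_def]] by simp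
    ultimately have "blinfun_apply (mult_op (pvar i)) g - bergman_cscale (z $ i) g = 0" by (rule LIMSEQ_unique)
    then show ?thesis by simp
  qed
  have "g = 0"
  proof (rule bergman_eqI)
    fix x :: "complex ^ 'n" assume "x \<in> ball 0 1"
    then have "x \<noteq> z" using z by auto
    then obtain i where i: "x $ i \<noteq> z $ i" by (auto simp: vec_eq_iff)
    have "x $ i * Rep_bergman g x = z $ i * Rep_bergman g x"
      using arg_cong[OF eig_g[of i], of "\<lambda>h. Rep_bergman h x"] by (simp add: bergman_rep)
    then show "Rep_bergman g x = Rep_bergman 0 x" using i by (simp add: bergman_rep)
  qed
  then show False using g1 by simp
qed

text \<open>
  The approximate eigenvalues of a convergent sequence of operators form a Cauchy sequence, since an approximate
  eigenvalue is bounded by the norm of the operator.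
\<close>

lemma closed_approx_eigen_ops:
  assumes Q: "complex_subspace Q" and u: "\<And>k. norm (u k) = 1"
  shows "closed {T \<in> bounded_ops Q. \<exists>\<nu>. approx_eigen u T \<nu> \<and> approx_eigen u (hadj T) (cnj \<nu>)}"
  unfolding closed_sequential_limits
proof (intro allI impI, elim conjE)
  fix X T
  assume X: "\<forall>n. X n \<in> {T \<in> bounded_ops Q. \<exists>\<nu>. approx_eigen u T \<nu> \<and> approx_eigen u (hadj T) (cnj \<nu>)}"
    and lim: "X \<longlonglongrightarrow> T"
  obtain l where l: "\<And>n. approx_eigen u (X n) (l n)" "\<And>n. approx_eigen u (hadj (X n)) (cnj (l n))"
    using X by simp metis
  have "Cauchy l"
  proof (rule CauchyI)
    fix e :: real assume "e > 0"
    then obtain M where M: "\<And>m n. m \<ge> M \<Longrightarrow> n \<ge> M \<Longrightarrow> norm (X m - X n) < e"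
      using CauchyD[OF LIMSEQ_imp_Cauchy[OF lim]] by blast
    have "norm (l m - l n) < e" if "m \<ge> M" "n \<ge> M" for m n
      using approx_eigen_norm_le[OF u approx_eigen_diff[OF l(1)[of m] l(1)[of n]]] M[OF that] by linarith
    then show "\<exists>M. \<forall>m\<ge>M. \<forall>n\<ge>M. norm (l m - l n) < e" by blast
  qed
  then obtain \<nu> where \<nu>: "l \<longlonglongrightarrow> \<nu>" using Cauchy_convergent convergent_def by blast
  have adj: "(\<lambda>n. hadj (X n)) \<longlonglongrightarrow> hadj T"
  proof (rule LIMSEQ_I)
    fix e :: real assume "e > 0"
    from LIMSEQ_D[OF lim this] obtain M where M: "\<And>n. n \<ge> M \<Longrightarrow> norm (X n - T) < e" by blast
    have "norm (hadj (X n) - hadj T) < e" if "n \<ge> M" for n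
      using norm_hadj_le[of "X n - T"] M[OF that] by (simp add: hadj_diff)
    then show "\<exists>M. \<forall>n\<ge>M. norm (hadj (X n) - hadj T) < e" by blast
  qed
  have "T \<in> bounded_ops Q"
    using closed_sequentially[OF closed_bounded_ops[OF Q]] X lim by blast
  moreover have "approx_eigen u T \<nu>" by (rule approx_eigen_limit[OF u l(1) lim \<nu>])
  moreover have "approx_eigen u (hadj T) (cnj \<nu>)"
    by (rule approx_eigen_limit[OF u l(2) adj]) (intro tendsto_intros \<nu>)
  ultimately show "T \<in> {T \<in> bounded_ops Q. \<exists>\<nu>. approx_eigen u T \<nu> \<and> approx_eigen u (hadj T) (cnj \<nu>)}" by blast
qed

lemma hadj_op_cscale: "clinear_op T \<Longrightarrow> hadj (op_cscale c T) = op_cscale (cnj c) (hadj T)"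
proof (rule blinfun_eqI, rule cinner_eqI)
  fix x y assume T: "clinear_op T"
  then have "clinear_op (op_cscale c T)"
    by (simp add: clinear_op_def blinfun_apply_op_cscale mult.commute)
  then show "bergman_cinner x (blinfun_apply (hadj (op_cscale c T)) y) = bergman_cinner x (blinfun_apply (op_cscale (cnj c) (hadj T)) y)"
    by (simp add: cinner_hadj[symmetric] T blinfun_apply_op_cscale cinner_cscale_left cinner_cscale_right)
qed

text \<open>
  The character is the approximate eigenvalue along normalized kernels at zeros of \<open>p\<close> that converge to the given
  boundary point.
\<close>

proposition zero_set_boundary_subset:
  fixes p :: "('n::finite) cpoly"
  shows "closure (zero_set p \<inter> ball 0 1) \<inter> sphere 0 1 \<subseteq> maximal_ideal_space p"
proof
  fix z assume "z \<in> closure (zero_set p \<inter> ball 0 1) \<inter> sphere 0 1"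
  then have z: "norm z = 1" and "z \<in> closure (zero_set p \<inter> ball 0 1)" by auto
  then obtain w where wZ: "\<And>k. w k \<in> zero_set p" and w: "\<And>k. w k \<in> ball 0 1" and lim: "w \<longlonglongrightarrow> z"
    unfolding closure_sequential by blast
  define Q where "Q = quotient_module p"
  have Q: "complex_subspace Q" unfolding Q_def by (rule quotient_subspace)
  define u where "u k = unit_kernel (w k)" for k
  have u1: "norm (u k) = 1" for k unfolding u_def by (rule norm_unit_kernel[OF w])
  have uQ: "u k \<in> Q" for k
    using kernel_in_quotient_module[OF wZ w] Q unfolding Q_def u_def unit_kernel_def complex_subspace_def
    by (simp add: subspace_scale)
  define A where "A = {T \<in> bounded_ops Q. \<exists>\<nu>. approx_eigen u T \<nu> \<and> approx_eigen u (hadj T) (cnj \<nu>)}"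
  have comp: "approx_eigen u (compression Q f) (peval f z) \<and> approx_eigen u (hadj (compression Q f)) (cnj (peval f z))" for f
  proof
    have "(\<lambda>k. blinfun_apply (proj_op Q) (blinfun_apply (mult_op f) (u k) - bergman_cscale (peval f z) (u k))) \<longlonglongrightarrow>
        blinfun_apply (proj_op Q) 0"
      using unit_kernel_approx_eigen[OF w lim z, of f] unfolding approx_eigen_def u_def
      by (intro blinfun.tendsto tendsto_const)
    then show "approx_eigen u (compression Q f) (peval f z)"
      unfolding approx_eigen_def
      by (simp add: blinfun.diff_right blinfun.zero_right proj_op_apply[OF Q] orth_proj_cscale[OF Q] orth_proj_id[OF Q uQ] compression_apply[OF Q])
    have "isCont (peval f) z"
      using continuous_on_peval[of UNIV f] by (simp add: continuous_on_eq_continuous_at)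
    then have fw: "(\<lambda>k. peval f (w k)) \<longlonglongrightarrow> peval f z" using lim by (rule isCont_tendsto_compose)
    have "blinfun_apply (hadj (compression Q f)) (u k) = bergman_cscale (cnj (peval f (w k))) (u k)" for k
      using hadj_compression_apply[of "u k" p f] uQ hadj_mult_op_unit_kernel[OF w] unfolding Q_def u_def by simp
    moreover have "(\<lambda>k. bergman_cscale (cnj (peval f (w k)) - cnj (peval f z)) (u k)) \<longlonglongrightarrow> 0"
    proof (rule tendsto_norm_zero_cancel)
      have "(\<lambda>k. cmod (cnj (peval f (w k)) - cnj (peval f z))) \<longlonglongrightarrow> cmod (cnj (peval f z) - cnj (peval f z))"
        by (intro tendsto_intros fw)
      then show "(\<lambda>k. norm (bergman_cscale (cnj (peval f (w k)) - cnj (peval f z)) (u k))) \<longlonglongrightarrow> 0"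
        by (simp add: norm_bergman_cscale u1)
    qed
    ultimately show "approx_eigen u (hadj (compression Q f)) (cnj (peval f z))"
      unfolding approx_eigen_def by (simp add: cscale_diff_left)
  qed
  have "cstar_subalgebra Q A"
    unfolding cstar_subalgebra_iff[OF Q]
  proof (intro conjI ballI allI)
    show "A \<subseteq> bounded_ops Q" by (auto simp: A_def)
    show "closed A" unfolding A_def by (rule closed_approx_eigen_ops[OF Q u1])
    have "hadj 0 = (0 :: 'n operator)" by (rule hadj_unique) simp
    then show "0 \<in> A" using bounded_ops_zero[OF Q] by (auto simp: A_def approx_eigen_def intro!: exI[of _ 0])
  next
    fix S T assume "S \<in> A" "T \<in> A"
    then obtain \<mu> \<nu> where S: "S \<in> bounded_ops Q" "approx_eigen u S \<mu>" "approx_eigen u (hadj S) (cnj \<mu>)"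
      and T: "T \<in> bounded_ops Q" "approx_eigen u T \<nu>" "approx_eigen u (hadj T) (cnj \<nu>)" by (auto simp: A_def)
    have "approx_eigen u (hadj (S + T)) (cnj (\<mu> + \<nu>))"
      using approx_eigen_add[OF S(3) T(3)] by (simp add: hadj_add)
    then show "S + T \<in> A"
      using bounded_ops_add[OF Q S(1) T(1)] approx_eigen_add[OF S(2) T(2)] unfolding A_def by blast
    have "approx_eigen u (hadj (S o\<^sub>L T)) (cnj (\<mu> * \<nu>))"
      using approx_eigen_compose[OF T(3) S(3) clinear_hadj[OF bounded_opsD(1)[OF T(1)]]]
      by (simp add: hadj_compose mult.commute)
    then show "S o\<^sub>L T \<in> A"
      using bounded_ops_compose[OF S(1) T(1)] approx_eigen_compose[OF S(2) T(2) bounded_opsD(1)[OF S(1)]]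
      unfolding A_def by blast
  next
    fix c T assume "T \<in> A"
    then obtain \<nu> where T: "T \<in> bounded_ops Q" "approx_eigen u T \<nu>" "approx_eigen u (hadj T) (cnj \<nu>)" by (auto simp: A_def)
    have "approx_eigen u (hadj (op_cscale c T)) (cnj (c * \<nu>))"
      using approx_eigen_cscale[OF T(3)] by (simp add: hadj_op_cscale[OF bounded_opsD(1)[OF T(1)]])
    then show "op_cscale c T \<in> A"
      using bounded_ops_cscale[OF Q T(1)] approx_eigen_cscale[OF T(2)] unfolding A_def by blast
  next
    fix T assume "T \<in> A"
    then obtain \<nu> where T: "T \<in> bounded_ops Q" "approx_eigen u T \<nu>" "approx_eigen u (hadj T) (cnj \<nu>)" by (auto simp: A_def)
    then show "hadj T \<in> A"
      using hadj_bounded_ops[OF Q T(1)] unfolding A_def by (auto intro!: exI[of _ "cnj \<nu>"])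
  qed
  then have TA: "toeplitz_algebra p \<subseteq> A"
    using comp compression_bounded_ops[OF Q] unfolding Q_def by (intro toeplitz_algebra_subset) (auto simp: A_def Q_def)
  let ?\<pi> = "calkin_class Q"
  define \<phi> where "\<phi> X = (THE \<nu>. \<exists>T\<in>toeplitz_algebra p. X = ?\<pi> T \<and> approx_eigen u T \<nu>)" for X
  have \<phi>: "\<phi> (?\<pi> T) = \<nu>" if T: "T \<in> toeplitz_algebra p" "approx_eigen u T \<nu>" for T \<nu>
    unfolding \<phi>_def
  proof (rule the_equality)
    show "\<exists>T'\<in>toeplitz_algebra p. ?\<pi> T = ?\<pi> T' \<and> approx_eigen u T' \<nu>" using T by blast
    fix \<nu>' assume "\<exists>T'\<in>toeplitz_algebra p. ?\<pi> T = ?\<pi> T' \<and> approx_eigen u T' \<nu>'"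
    then obtain T' where T': "T' \<in> toeplitz_algebra p" "?\<pi> T = ?\<pi> T'" "approx_eigen u T' \<nu>'" by blast
    have "T \<in> ?\<pi> T'" using calkin_class_self[OF Q, of T] T'(2) TA T(1) by (auto simp: A_def)
    then have "T - T' \<in> compact_ops Q" by (simp add: calkin_class_def)
    from unit_kernel_compact_eigen_zero[OF w lim z uQ[unfolded u_def] this approx_eigen_diff[OF T(2) T'(3), unfolded u_def]]
    show "\<nu>' = \<nu>" by simp
  qed
  have ex: "\<exists>\<nu>. approx_eigen u T \<nu>" if "T \<in> toeplitz_algebra p" for T
    using that TA by (auto simp: A_def)
  have alg: "cstar_subalgebra Q (toeplitz_algebra p)" unfolding Q_def by (rule cstar_subalgebra_toeplitz)
  have cT: "compression Q f \<in> toeplitz_algebra p" for f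
    unfolding Q_def by (rule compression_in_toeplitz)
  have "is_character p \<phi>"
    unfolding is_character_def Let_def Q_def[symmetric]
  proof (intro conjI ballI allI)
    fix S T assume ST: "S \<in> toeplitz_algebra p" "T \<in> toeplitz_algebra p"
    then obtain \<mu> \<nu> where e: "approx_eigen u S \<mu>" "approx_eigen u T \<nu>" using ex by blast
    have cl: "S + T \<in> toeplitz_algebra p" "S o\<^sub>L T \<in> toeplitz_algebra p"
      using alg ST unfolding cstar_subalgebra_iff[OF Q] by blast+
    have "clinear_op S" using ST TA bounded_opsD(1) by (auto simp: A_def)
    then show "\<phi> (?\<pi> (S o\<^sub>L T)) = \<phi> (?\<pi> S) * \<phi> (?\<pi> T)"
      unfolding \<phi>[OF ST(1) e(1)] \<phi>[OF ST(2) e(2)] by (intro \<phi> cl approx_eigen_compose e)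
    show "\<phi> (?\<pi> (S + T)) = \<phi> (?\<pi> S) + \<phi> (?\<pi> T)"
      unfolding \<phi>[OF ST(1) e(1)] \<phi>[OF ST(2) e(2)] by (intro \<phi> cl approx_eigen_add e)
  next
    fix c T assume T: "T \<in> toeplitz_algebra p"
    then obtain \<nu> where e: "approx_eigen u T \<nu>" using ex by blast
    have "op_cscale c T \<in> toeplitz_algebra p" using alg T unfolding cstar_subalgebra_iff[OF Q] by blast
    then show "\<phi> (?\<pi> (op_cscale c T)) = c * \<phi> (?\<pi> T)"
      unfolding \<phi>[OF T e] by (intro \<phi> approx_eigen_cscale e)
  next
    have "\<phi> (?\<pi> (compression Q 1)) = 1" using \<phi>[OF cT[of 1]] comp[of 1] by simp
    then show "\<exists>T\<in>toeplitz_algebra p. \<phi> (?\<pi> T) \<noteq> 0" using cT by (intro bexI[of _ "compression Q 1"]) simp_all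
  qed
  moreover have "z $ i = \<phi> (?\<pi> (compression Q (pvar i)))" for i
    using \<phi>[OF cT conjunct1[OF comp], of "pvar i"] by simp
  ultimately show "z \<in> maximal_ideal_space p"
    unfolding maximal_ideal_space_def Q_def by blast
qed


section \<open>Characters live on the zero set and on the sphere\<close>

lemma norm_op_cscale_le: "norm (op_cscale c T) \<le> cmod c * norm T"
proof (rule norm_blinfun_bound)
  fix h
  show "norm (blinfun_apply (op_cscale c T) h) \<le> cmod c * norm T * norm h"
    using mult_left_mono[OF norm_blinfun[of T h], of "cmod c"]
    by (simp add: blinfun_apply_op_cscale norm_bergman_cscale mult.assoc)
qed simp

text \<open>
  The exponent is shifted by one, because the identity of the Bergman space belongs to the operator algebra
  only if \<open>[p] = 0\<close>: \<open>op_power T m\<close> is the power of \<open>T\<close> with exponent \<open>m + 1\<close>.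
\<close>

primrec op_power :: "('n::finite) operator \<Rightarrow> nat \<Rightarrow> 'n operator" where
  "op_power T 0 = T"
| "op_power T (Suc m) = T o\<^sub>L op_power T m"

lemma norm_op_power_le: "norm (op_power T m) \<le> norm T ^ Suc m"
proof (induction m)
  case (Suc m)
  have "norm (op_power T (Suc m)) \<le> norm T * norm (op_power T m)" by (simp add: norm_blinfun_compose)
  also have "\<dots> \<le> norm T * norm T ^ Suc m" by (intro mult_left_mono Suc) auto
  finally show ?case by simp
qed simp

locale quotient_character =
  fixes p :: "('n::finite) cpoly" and \<phi> :: "'n operator set \<Rightarrow> complex"
  assumes character: "is_character p \<phi>"
begin

definition "Q = quotient_module p"

definition "chi T = \<phi> (calkin_class Q T)"

abbreviation "TA \<equiv> toeplitz_algebra p"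

lemma Q: "complex_subspace Q"
  unfolding Q_def by (rule quotient_subspace)

lemma TA_bounded_ops: "T \<in> TA \<Longrightarrow> T \<in> bounded_ops Q"
  using toeplitz_bounded_ops unfolding Q_def by blast

lemma TA_closure:
  shows TA_closed: "closed TA" and TA_add: "S \<in> TA \<Longrightarrow> T \<in> TA \<Longrightarrow> S + T \<in> TA"
    and TA_cscale: "T \<in> TA \<Longrightarrow> op_cscale c T \<in> TA" and TA_compose: "S \<in> TA \<Longrightarrow> T \<in> TA \<Longrightarrow> S o\<^sub>L T \<in> TA"
    and TA_hadj: "T \<in> TA \<Longrightarrow> hadj T \<in> TA" and TA_zero: "0 \<in> TA"
  using cstar_subalgebra_toeplitz[of p] unfolding cstar_subalgebra_iff[OF quotient_subspace] by blast+

lemma TA_compression: "compression Q f \<in> TA"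
  unfolding Q_def by (rule compression_in_toeplitz)

lemma chi_add: "S \<in> TA \<Longrightarrow> T \<in> TA \<Longrightarrow> chi (S + T) = chi S + chi T"
  and chi_cscale: "T \<in> TA \<Longrightarrow> chi (op_cscale c T) = c * chi T"
  and chi_compose: "S \<in> TA \<Longrightarrow> T \<in> TA \<Longrightarrow> chi (S o\<^sub>L T) = chi S * chi T"
  and chi_nontrivial: "\<exists>T\<in>TA. chi T \<noteq> 0"
  using character unfolding is_character_def Let_def chi_def Q_def by blast+

lemma TA_diff: "S \<in> TA \<Longrightarrow> T \<in> TA \<Longrightarrow> S - T \<in> TA"
  using TA_add[of S "op_cscale (-1) T"] TA_cscale[of T "-1"] by (simp add: op_cscale_minus)

lemma chi_diff: "S \<in> TA \<Longrightarrow> T \<in> TA \<Longrightarrow> chi (S - T) = chi S - chi T"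
  using chi_add[of S "op_cscale (-1) T"] TA_cscale[of T "-1"] chi_cscale[of T "-1"] by (simp add: op_cscale_minus)

lemma chi_zero: "chi 0 = 0"
  using chi_diff[OF TA_zero TA_zero] by simp

lemma TA_sum: "(\<And>i. i \<in> A \<Longrightarrow> T i \<in> TA) \<Longrightarrow> (\<Sum>i\<in>A. T i) \<in> TA"
  by (induction A rule: infinite_finite_induct) (auto intro: TA_zero TA_add)

lemma chi_sum: "(\<And>i. i \<in> A \<Longrightarrow> T i \<in> TA) \<Longrightarrow> chi (\<Sum>i\<in>A. T i) = (\<Sum>i\<in>A. chi (T i))"
  by (induction A rule: infinite_finite_induct) (auto simp: chi_zero chi_add TA_sum)

lemma TA_power: "T \<in> TA \<Longrightarrow> op_power T m \<in> TA"
  by (induction m) (auto intro: TA_compose)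

lemma chi_power: "T \<in> TA \<Longrightarrow> chi (op_power T m) = chi T ^ Suc m"
  by (induction m) (auto simp: chi_compose TA_power)

text \<open>
  Automatic continuity: if \<open>\<chi>(S) = 1\<close> with \<open>\<parallel>S\<parallel> < 1\<close>, then the sum \<open>R\<close> of all \<open>S\<^sup>m\<close>
  with \<open>m \<ge> 1\<close> satisfies \<open>R = S + S R\<close>, whence \<open>\<chi>(R) = 1 + \<chi>(R)\<close>.
\<close>

lemma chi_norm_le:
  assumes T: "T \<in> TA"
  shows "cmod (chi T) \<le> norm T"
proof (rule ccontr)
  assume "\<not> ?thesis"
  then have less: "norm T < cmod (chi T)" by simp
  then have c0: "chi T \<noteq> 0" using norm_ge_zero[of T] by auto
  define S where "S = op_cscale (1 / chi T) T"
  have S: "S \<in> TA" unfolding S_def by (rule TA_cscale[OF T])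
  have chiS: "chi S = 1" unfolding S_def using c0 by (simp add: chi_cscale[OF T])
  have "norm S \<le> cmod (1 / chi T) * norm T" unfolding S_def by (rule norm_op_cscale_le)
  also have "\<dots> < 1" using less c0 by (simp add: norm_divide)
  finally have S1: "norm S < 1" .
  have "summable (\<lambda>m. norm S ^ Suc m)"
    using S1 by (intro summable_ignore_initial_segment[of _ 1, simplified] summable_geometric) simp
  then have "summable (\<lambda>m. norm (op_power S m))"
    by (rule summable_comparison_test'[where N = 0]) (simp add: norm_op_power_le del: power_Suc)
  then have sum: "summable (op_power S)" by (rule summable_norm_cancel)
  define R where "R = suminf (op_power S)"
  have R: "R \<in> TA"
  proof (rule closed_sequentially[OF TA_closed])
    show "(\<lambda>n. \<Sum>m<n. op_power S m) \<longlonglongrightarrow> R" unfolding R_def by (rule summable_LIMSEQ[OF sum])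
    show "(\<Sum>m<n. op_power S m) \<in> TA" for n by (intro TA_sum TA_power S)
  qed
  have "R = op_power S 0 + suminf (\<lambda>m. op_power S (Suc m))"
    unfolding R_def using suminf_split_head[OF sum] by simp
  also have "(\<lambda>m. op_power S (Suc m)) = (\<lambda>m. S o\<^sub>L op_power S m)" by simp
  also have "suminf (\<lambda>m. S o\<^sub>L op_power S m) = S o\<^sub>L R"
    unfolding R_def
    by (rule bounded_linear.suminf[OF bounded_bilinear.bounded_linear_right[OF bounded_bilinear_blinfun_compose] sum, symmetric])
  finally have "chi R = chi (S + (S o\<^sub>L R))" by simp
  also have "\<dots> = 1 + chi R" by (simp add: chi_add chi_compose S R TA_compose chiS)
  finally show False by simp
qed

lemma chi_one: "chi (compression Q 1) = 1"
proof -
  obtain T where T: "T \<in> TA" "chi T \<noteq> 0" using chi_nontrivial by blast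
  have "T o\<^sub>L compression Q 1 = T"
  proof (rule blinfun_eqI)
    fix h
    show "blinfun_apply (T o\<^sub>L compression Q 1) h = blinfun_apply T h"
      using bounded_ops_apply_proj[OF Q TA_bounded_ops[OF T(1)], of h]
      by (simp add: compression_one_apply Q_def)
  qed
  then have "chi T * chi (compression Q 1) = chi T" using chi_compose[OF T(1) TA_compression] by metis
  then show ?thesis using T(2) by simp
qed

definition "point = (\<chi> i. chi (compression Q (pvar i)))"

lemma chi_compression: "chi (compression Q f) = peval f point"
proof (induction f rule: cpoly_induct)
  case (const c)
  show ?case
    unfolding Q_def compression_const unfolding Q_def[symmetric]
    by (simp add: chi_cscale TA_compression chi_one)
next
  case (var i)
  show ?case by (simp add: point_def)
next
  case (add f g)
  have "compression Q (f + g) = compression Q f + compression Q g" unfolding Q_def by (rule compression_add)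
  then show ?case using add by (simp add: chi_add TA_compression)
next
  case (mult f g)
  have "compression Q (f * g) = compression Q f o\<^sub>L compression Q g" unfolding Q_def by (rule compression_mult)
  then show ?case using mult by (simp add: chi_compose TA_compression)
qed

lemma point_in_zero_set: "point \<in> zero_set p"
proof -
  have "compression Q p = 0" unfolding Q_def by (rule compression_self)
  then show ?thesis using chi_compression[of p] by (simp add: zero_set_def chi_zero)
qed

lemma norm_compression_le:
  assumes "\<And>z. z \<in> ball 0 1 \<Longrightarrow> cmod (peval f z) \<le> B"
  shows "norm (compression Q f) \<le> B"
proof (rule norm_blinfun_bound)
  have "norm (peval f 0) \<le> B" using assms[of 0] by simp
  then show B: "B \<ge> 0" by (rule order_trans[OF norm_ge_zero])
  fix h
  have "norm (blinfun_apply (compression Q f) h) \<le> norm (bergman_mult f (orth_proj Q h))"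
    unfolding compression_apply[OF Q] by (rule norm_orth_proj_le[OF Q])
  also have "\<dots> \<le> B * norm (orth_proj Q h)" by (rule norm_bergman_mult_le[OF assms])
  also have "\<dots> \<le> B * norm h" by (intro mult_left_mono norm_orth_proj_le[OF Q] B)
  finally show "norm (blinfun_apply (compression Q f) h) \<le> B * norm h" .
qed

text \<open>
  The linear form that pairs with the conjugate of the point is bounded by \<open>|w|\<close> on the ball and takes the value
  \<open>|w|\<^sup>2\<close> at the point \<open>w\<close> itself.
\<close>

lemma norm_point_le: "norm point \<le> 1"
proof -
  define L :: "'n cpoly" where "L = (\<Sum>i\<in>UNIV. pconst (cnj (point $ i)) * pvar i)"
  have L: "peval L z = (\<Sum>i\<in>UNIV. cnj (point $ i) * z $ i)" for z by (simp add: L_def)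
  have "cmod (peval L z) \<le> norm point" if "z \<in> ball 0 1" for z
  proof -
    have "cmod (peval L z) \<le> (\<Sum>i\<in>UNIV. \<bar>cmod (point $ i)\<bar> * \<bar>cmod (z $ i)\<bar>)"
      unfolding L by (rule order_trans[OF norm_sum]) (simp add: norm_mult)
    also have "\<dots> \<le> L2_set (\<lambda>i. cmod (point $ i)) UNIV * L2_set (\<lambda>i. cmod (z $ i)) UNIV"
      by (rule L2_set_mult_ineq)
    also have "\<dots> = norm point * norm z" by (simp add: norm_vec_def)
    also have "\<dots> \<le> norm point * 1" using that by (intro mult_left_mono) auto
    finally show ?thesis by simp
  qed
  then have "norm (compression Q L) \<le> norm point" by (rule norm_compression_le)
  then have "cmod (peval L point) \<le> norm point"
    using chi_norm_le[OF TA_compression[of L]] unfolding chi_compression by linarith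
  moreover have "peval L point = of_real ((norm point)\<^sup>2)"
    unfolding L norm_sq_coord of_real_sum by (intro sum.cong refl) (simp only: complex_norm_square mult.commute)
  ultimately have "norm point * norm point \<le> 1 * norm point"
    by (simp add: norm_mult norm_power power2_eq_square del: of_real_power)
  then show ?thesis by (cases "norm point = 0") auto
qed

lemma compact_ops_diff:
  assumes "S \<in> compact_ops Q" "T \<in> compact_ops Q"
  shows "S - T \<in> compact_ops Q"
proof -
  let ?A = "closure (blinfun_apply S ` (Q \<inter> cball 0 1))" and ?B = "closure (blinfun_apply T ` (Q \<inter> cball 0 1))"
  let ?C = "blinfun_apply (S - T) ` (Q \<inter> cball 0 1)"
  have comp: "compact {x - y | x y. x \<in> ?A \<and> y \<in> ?B}"
    using assms by (intro compact_differences) (auto simp: compact_ops_def)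
  have "?C \<subseteq> {x - y | x y. x \<in> ?A \<and> y \<in> ?B}"
  proof (rule image_subsetI)
    fix h assume h: "h \<in> Q \<inter> cball 0 1"
    have "blinfun_apply S h \<in> ?A" "blinfun_apply T h \<in> ?B"
      using h by (auto intro!: subsetD[OF closure_subset] imageI)
    then show "blinfun_apply (S - T) h \<in> {x - y | x y. x \<in> ?A \<and> y \<in> ?B}"
      by (auto simp: blinfun.diff_left)
  qed
  then have "closure ?C \<subseteq> {x - y | x y. x \<in> ?A \<and> y \<in> ?B}"
    using comp compact_imp_closed by (intro closure_minimal)
  then have "compact (closure ?C)"
    using compact_Int_closed[OF comp closed_closure[of ?C]] by (simp add: Int_absorb1)
  then show ?thesis using assms bounded_ops_diff[OF Q] by (simp add: compact_ops_def)
qed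

text \<open>
  A compact operator has the same class as \<open>0\<close>, because the compact operators are closed under differences.
\<close>

lemma chi_compact:
  assumes E: "E \<in> compact_ops Q"
  shows "chi E = 0"
proof -
  have "calkin_class Q E = calkin_class Q 0"
  proof -
    have "S - E \<in> compact_ops Q \<longleftrightarrow> S \<in> compact_ops Q" for S
    proof
      assume "S - E \<in> compact_ops Q"
      moreover have "0 - E \<in> compact_ops Q" by (rule compact_ops_diff[OF zero_compact_op[OF Q] E])
      ultimately have "(S - E) - (0 - E) \<in> compact_ops Q" by (rule compact_ops_diff)
      then show "S \<in> compact_ops Q" by simp
    qed (rule compact_ops_diff[OF _ E])
    then show ?thesis by (simp add: calkin_class_def)
  qed
  then have "chi E = chi 0" by (simp add: chi_def)
  then show ?thesis by (simp add: chi_zero)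
qed

definition rank_one :: "'n bergman \<Rightarrow> 'n operator" where
  "rank_one u = Blinfun (\<lambda>h. bergman_cscale (bergman_cinner h u) u)"

lemma rank_one_apply: "blinfun_apply (rank_one u) h = bergman_cscale (bergman_cinner h u) u"
proof -
  have "bounded_linear (\<lambda>h. bergman_cscale (bergman_cinner h u) u)"
  proof (rule bounded_linear_intro[where K = "norm u * norm u"])
    fix h
    have "cmod (bergman_cinner h u) * norm u \<le> (norm h * norm u) * norm u"
      by (intro mult_right_mono cinner_cauchy_schwarz) auto
    then show "norm (bergman_cscale (bergman_cinner h u) u) \<le> norm h * (norm u * norm u)"
      by (simp add: norm_bergman_cscale mult.assoc)
  qed (simp_all add: cinner_add_left cscale_add_left cscale_scaleR cinner_cscale_left)
  then show ?thesis by (simp add: rank_one_def bounded_linear_Blinfun_apply)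
qed

lemma rank_one_compact:
  assumes u: "u \<in> Q"
  shows "rank_one u \<in> compact_ops Q"
proof -
  have "rank_one u \<in> bounded_ops Q"
    by (rule bounded_opsI)
       (use u Q in \<open>auto simp: clinear_op_def rank_one_apply cinner_cscale_left complex_subspace_def\<close>)
  moreover have "compact (closure (blinfun_apply (rank_one u) ` (Q \<inter> cball 0 1)))"
  proof -
    let ?I = "(\<lambda>c. bergman_cscale c u) ` cball 0 (norm u)" and ?C = "blinfun_apply (rank_one u) ` (Q \<inter> cball 0 1)"
    have "continuous_on (cball 0 (norm u)) (\<lambda>c. bergman_cscale c u)"
      unfolding continuous_on_def by (intro ballI tendsto_cscale tendsto_const tendsto_ident_at)
    then have comp: "compact ?I" by (intro compact_continuous_image) auto
    have "?C \<subseteq> ?I"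
    proof (rule image_subsetI)
      fix h assume h: "h \<in> Q \<inter> cball 0 1"
      have "cmod (bergman_cinner h u) \<le> norm h * norm u" by (rule cinner_cauchy_schwarz)
      also have "\<dots> \<le> 1 * norm u" using h by (intro mult_right_mono) auto
      finally show "blinfun_apply (rank_one u) h \<in> ?I" by (auto simp: rank_one_apply)
    qed
    then have "closure ?C \<subseteq> ?I" using comp compact_imp_closed by (intro closure_minimal)
    then show ?thesis
      using compact_Int_closed[OF comp closed_closure[of ?C]] by (simp add: Int_absorb1)
  qed
  ultimately show ?thesis by (simp add: compact_ops_def)
qed

text \<open>
  If the point lay inside the ball, then \<open>B = \<Sum>\<^sub>i (Q\<^sub>i - w\<^sub>i)(Q\<^sub>i - w\<^sub>i)\<^sup>*\<close>, where \<open>w\<close> is the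
  point and \<open>Q\<^sub>i\<close> is the compression of the \<open>i\<close>-th coordinate, would be in the
  kernel of the character. But \<open>B\<close> vanishes exactly on the kernel function at \<open>w\<close> and is bounded
  below on its complement, so the powers of \<open>1 - t B\<close> converge in norm to a projection of rank one for
  small \<open>t > 0\<close>. The character takes the value \<open>1\<close> on all of these powers and \<open>0\<close> on the limit.
\<close>

lemma point_not_in_ball: "point \<notin> ball 0 1"
proof
  assume w: "point \<in> ball 0 1"
  let ?g = "shift_var point"
  define C where "C i = compression Q (?g i)" for i
  have C: "C i \<in> TA" for i unfolding C_def by (rule TA_compression)
  have chiC: "chi (C i) = 0" for i unfolding C_def chi_compression by simp
  define B where "B = (\<Sum>i\<in>UNIV. C i o\<^sub>L hadj (C i))"
  have B: "B \<in> TA" unfolding B_def by (intro TA_sum TA_compose TA_hadj C)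
  have chiB: "chi B = 0"
    unfolding B_def by (subst chi_sum) (simp_all add: chi_compose TA_compose TA_hadj C chiC)
  have hB: "hadj B = B"
  proof (rule hadj_unique)
    fix x y
    have "inner (blinfun_apply B x) y = (\<Sum>i\<in>UNIV. inner (blinfun_apply (hadj (C i)) x) (blinfun_apply (hadj (C i)) y))"
      unfolding B_def by (simp add: blinfun.sum_left inner_sum_left inner_hadj)
    also have "\<dots> = inner x (blinfun_apply B y)"
      unfolding B_def by (simp add: blinfun.sum_left inner_sum_right inner_hadj')
    finally show "inner (blinfun_apply B x) y = inner x (blinfun_apply B y)" .
  qed
  have CQ: "blinfun_apply (hadj (C i)) h = blinfun_apply (hadj (mult_op (?g i))) h" if "h \<in> Q" for i h
    using hadj_compression_apply[of h p "?g i"] that unfolding C_def Q_def by simp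
  have BQ: "inner (blinfun_apply B h) h = (\<Sum>i\<in>UNIV. (norm (blinfun_apply (hadj (mult_op (?g i))) h))\<^sup>2)"
    if "h \<in> Q" for h
    unfolding B_def by (simp add: blinfun.sum_left inner_sum_left inner_hadj CQ[OF that] power2_norm_eq_inner)
  define u where "u = unit_kernel point"
  have u1: "norm u = 1" unfolding u_def by (rule norm_unit_kernel[OF w])
  have uQ: "u \<in> Q"
    using kernel_in_quotient_module[OF point_in_zero_set w] Q unfolding Q_def u_def unit_kernel_def complex_subspace_def
    by (simp add: subspace_scale)
  have "blinfun_apply (hadj (C i)) u = 0" for i
    unfolding CQ[OF uQ] unfolding u_def hadj_mult_op_unit_kernel[OF w] by simp
  then have Bu: "blinfun_apply B u = 0" unfolding B_def by (simp add: blinfun.sum_left blinfun.zero_right)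
  obtain \<delta> where \<delta>: "\<delta> > 0" and low: "\<And>h. bergman_cinner h (kernel_at point) = 0 \<Longrightarrow>
      \<delta> * norm h \<le> (\<Sum>i\<in>UNIV. norm (blinfun_apply (hadj (mult_op (?g i))) h))"
    using shift_adj_bounded_below[OF w] by blast
  define c where "c = norm B + 1"
  have c: "c > 0" unfolding c_def using norm_ge_zero[of B] by linarith
  \<comment> \<open>The minimum with \<open>c\<close> keeps \<open>1 - (e / c)\<^sup>2\<close> nonnegative.\<close>
  define e where "e = min c (\<delta>\<^sup>2 / real CARD('n))"
  have e: "e > 0" "e \<le> c" using c \<delta> by (simp_all add: e_def)
  have lower: "e * (norm h)\<^sup>2 \<le> inner (blinfun_apply B h) h" if h: "h \<in> Q" "bergman_cinner h u = 0" for h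
  proof -
    have "bergman_cinner h (kernel_at point) = 0"
      using h(2) kernel_nonzero[OF w] by (simp add: u_def unit_kernel_def cscale_scaleR cinner_cscale_right)
    from low[OF this] have "(\<delta> * norm h)\<^sup>2 \<le> (\<Sum>i\<in>UNIV. norm (blinfun_apply (hadj (mult_op (?g i))) h))\<^sup>2"
      using \<delta> by (intro power_mono) auto
    also have "\<dots> \<le> (\<Sum>i\<in>UNIV. (norm (blinfun_apply (hadj (mult_op (?g i))) h))\<^sup>2) * real CARD('n)"
      by (rule sum_squared_le_sum_of_squares)
    finally have "(\<delta>\<^sup>2 / real CARD('n)) * (norm h)\<^sup>2 \<le> inner (blinfun_apply B h) h"
      unfolding BQ[OF h(1)] by (simp add: power_mult_distrib divide_le_eq)
    moreover have "e * (norm h)\<^sup>2 \<le> (\<delta>\<^sup>2 / real CARD('n)) * (norm h)\<^sup>2"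
      by (intro mult_right_mono) (auto simp: e_def)
    ultimately show ?thesis by linarith
  qed
  \<comment> \<open>The minimizer of \<open>1 - 2 t e + t\<^sup>2 c\<^sup>2\<close>, which bounds the squared contraction factor.\<close>
  define t where "t = e / c\<^sup>2"
  define D where "D = compression Q 1 + op_cscale (of_real (- t)) B"
  have D: "D \<in> TA" unfolding D_def by (intro TA_add TA_cscale TA_compression B)
  have chiD: "chi D = 1" unfolding D_def by (simp add: chi_add chi_cscale TA_compression TA_cscale B chi_one chiB)
  have D_apply: "blinfun_apply D h = orth_proj Q h - t *\<^sub>R blinfun_apply B h" for h
    using compression_one_apply[of p h]
    by (simp add: D_def Q_def blinfun.add_left blinfun_apply_op_cscale cscale_scaleR[symmetric] del: of_real_minus)
  have DQ: "blinfun_apply D h = h - t *\<^sub>R blinfun_apply B h" if "h \<in> Q" for h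
    by (simp add: D_apply orth_proj_id[OF Q that])
  define q where "q = sqrt (1 - (e / c)\<^sup>2)"
  have ec: "0 < e / c" "e / c \<le> 1"
    using divide_pos_pos[OF e(1) c] e(2) by (simp_all only: divide_le_eq_1_pos[OF c])
  have ec2: "0 < (e / c)\<^sup>2" "(e / c)\<^sup>2 \<le> 1"
    using zero_less_power[OF ec(1), of 2] power_le_one[OF less_imp_le[OF ec(1)] ec(2), of 2] by blast+
  have q: "0 \<le> q" "q\<^sup>2 = 1 - (e / c)\<^sup>2" unfolding q_def using ec2(2) by (simp_all only: diff_ge_0_iff_ge real_sqrt_ge_zero real_sqrt_pow2)
  have q1: "q < 1"
  proof (rule power2_less_imp_less)
    show "q\<^sup>2 < 1\<^sup>2" unfolding q(2) one_power2 using ec2(1) by linarith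
  qed simp
  have contract: "blinfun_apply D h \<in> Q \<and> bergman_cinner (blinfun_apply D h) u = 0 \<and> norm (blinfun_apply D h) \<le> q * norm h"
    if h: "h \<in> Q" "bergman_cinner h u = 0" for h
  proof (intro conjI)
    show "blinfun_apply D h \<in> Q" by (rule bounded_opsD(2)[OF TA_bounded_ops[OF D] h(1)])
    have "bergman_cinner (blinfun_apply B h) u = bergman_cinner h (blinfun_apply (hadj B) u)"
      by (rule cinner_hadj[OF bounded_opsD(1)[OF TA_bounded_ops[OF B]]])
    then show "bergman_cinner (blinfun_apply D h) u = 0"
      by (simp add: DQ[OF h(1)] hB Bu cinner_diff_left cscale_scaleR cinner_cscale_left h(2))
    have "norm (blinfun_apply B h) \<le> c * norm h"
      using norm_blinfun[of B h] mult_right_mono[of "norm B" c "norm h"] by (simp add: c_def)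
    then have Bn: "(norm (blinfun_apply B h))\<^sup>2 \<le> (c * norm h)\<^sup>2" by (intro power_mono) auto
    have "(norm (blinfun_apply D h))\<^sup>2 = (norm h)\<^sup>2 - 2 * t * inner (blinfun_apply B h) h + t\<^sup>2 * (norm (blinfun_apply B h))\<^sup>2"
    proof -
      have "(norm (x - t *\<^sub>R y))\<^sup>2 = (norm x)\<^sup>2 - 2 * t * inner y x + t\<^sup>2 * (norm y)\<^sup>2" for x y :: "'n bergman"
        unfolding power2_norm_eq_inner
        by (simp add: inner_diff_left inner_diff_right inner_commute[of x y] power2_eq_square algebra_simps)
      then show ?thesis unfolding DQ[OF h(1)] .
    qed
    also have "\<dots> \<le> (norm h)\<^sup>2 - 2 * t * (e * (norm h)\<^sup>2) + t\<^sup>2 * (c * norm h)\<^sup>2"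
    proof (intro add_mono diff_mono mult_left_mono order_refl lower[OF h] Bn)
      show "0 \<le> 2 * t" unfolding t_def using e c by simp
    qed simp
    also have "\<dots> = (q * norm h)\<^sup>2"
    proof -
      have te: "t * e = (e / c)\<^sup>2" by (simp add: t_def power2_eq_square)
      have tc: "t\<^sup>2 * c\<^sup>2 = (e / c)\<^sup>2" using c by (simp add: t_def power2_eq_square)
      have "(norm h)\<^sup>2 - 2 * t * (e * (norm h)\<^sup>2) + t\<^sup>2 * (c * norm h)\<^sup>2 =
          (norm h)\<^sup>2 - 2 * (t * e) * (norm h)\<^sup>2 + (t\<^sup>2 * c\<^sup>2) * (norm h)\<^sup>2"
        by (simp only: power_mult_distrib mult.assoc)
      also have "\<dots> = (1 - (e / c)\<^sup>2) * (norm h)\<^sup>2" unfolding te tc by (simp add: algebra_simps)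
      finally show ?thesis by (simp only: power_mult_distrib q(2))
    qed
    finally show "norm (blinfun_apply D h) \<le> q * norm h" by (rule power2_le_imp_le) (use q(1) in simp)
  qed
  have Du: "blinfun_apply D u = u" by (simp add: DQ[OF uQ] Bu)
  have pow_u: "blinfun_apply (op_power D m) u = u" for m by (induction m) (simp_all add: Du)
  have pow_k: "blinfun_apply (op_power D m) k \<in> Q \<and> bergman_cinner (blinfun_apply (op_power D m) k) u = 0 \<and>
      norm (blinfun_apply (op_power D m) k) \<le> q ^ Suc m * norm k"
    if k: "k \<in> Q" "bergman_cinner k u = 0" for m k
  proof (induction m)
    case 0
    show ?case using contract[OF k] by simp
  next
    case (Suc m)
    let ?x = "blinfun_apply (op_power D m) k"
    have "norm (blinfun_apply D ?x) \<le> q * norm ?x" using contract Suc by blast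
    also have "\<dots> \<le> q * (q ^ Suc m * norm k)" using Suc q(1) by (intro mult_left_mono) auto
    finally show ?case using contract[of ?x] Suc by (simp add: mult.assoc)
  qed
  define E where "E = rank_one u"
  have conv_bound: "norm (op_power D m - E) \<le> q ^ Suc m" for m
  proof (rule norm_blinfun_bound)
    fix h
    define a where "a = bergman_cinner h u"
    define k where "k = orth_proj Q h - bergman_cscale a u"
    have "bergman_cinner (orth_proj Q h) u = a"
      using orth_proj_orth[OF Q uQ, of h] by (simp add: a_def cinner_diff_left)
    then have ku: "bergman_cinner k u = 0"
      by (simp add: k_def cinner_diff_left cinner_cscale_left cinner_self u1)
    have kQ: "k \<in> Q"
      using orth_proj_in[OF Q, of h] uQ Q unfolding k_def complex_subspace_def by (simp add: subspace_diff)
    have cl: "clinear_op (op_power D m)" by (rule bounded_opsD(1)[OF TA_bounded_ops[OF TA_power[OF D]]])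
    have "blinfun_apply (op_power D m) h = blinfun_apply (op_power D m) (orth_proj Q h)"
      by (rule bounded_ops_apply_proj[OF Q TA_bounded_ops[OF TA_power[OF D]]])
    also have "orth_proj Q h = bergman_cscale a u + k" by (simp add: k_def)
    also have "blinfun_apply (op_power D m) \<dots> = bergman_cscale a u + blinfun_apply (op_power D m) k"
      using cl by (simp add: blinfun.add_right clinear_op_def pow_u)
    finally have "blinfun_apply (op_power D m - E) h = blinfun_apply (op_power D m) k"
      by (simp add: blinfun.diff_left E_def rank_one_apply a_def)
    then have "norm (blinfun_apply (op_power D m - E) h) \<le> q ^ Suc m * norm k" using pow_k[OF kQ ku] by simp
    also have "\<dots> \<le> q ^ Suc m * norm h"
    proof (rule mult_left_mono)
      have "bergman_cinner k (bergman_cscale a u) = 0" by (simp add: cinner_cscale_right ku)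
      from cinner_zero_pythagoras[OF this] have "(norm k)\<^sup>2 \<le> (norm (orth_proj Q h))\<^sup>2" by (simp add: k_def)
      then have "norm k \<le> norm (orth_proj Q h)" by (rule power2_le_imp_le) simp
      then show "norm k \<le> norm h" using norm_orth_proj_le[OF Q, of h] by linarith
    qed (use q(1) in simp)
    finally show "norm (blinfun_apply (op_power D m - E) h) \<le> q ^ Suc m * norm h" .
  qed (use q(1) in simp)
  have q0: "(\<lambda>m. q ^ Suc m) \<longlonglongrightarrow> 0"
    using q(1) q1 by (intro LIMSEQ_Suc LIMSEQ_realpow_zero)
  have lim: "op_power D \<longlonglongrightarrow> E"
  proof (rule LIM_zero_cancel, rule tendsto_norm_zero_cancel)
    show "(\<lambda>m. norm (op_power D m - E)) \<longlonglongrightarrow> 0"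
      by (rule tendsto_sandwich[OF _ _ tendsto_const q0]) (use conv_bound in \<open>auto intro!: always_eventually simp del: power_Suc\<close>)
  qed
  have E: "E \<in> TA"
    by (rule closed_sequentially[OF TA_closed _ lim]) (rule TA_power[OF D])
  have "cmod (1 - chi E) \<le> q ^ Suc m" for m
  proof -
    have "cmod (1 - chi E) = cmod (chi (op_power D m - E))"
      by (simp add: chi_diff TA_power D E chi_power chiD)
    also have "\<dots> \<le> norm (op_power D m - E)" by (intro chi_norm_le TA_diff TA_power D E)
    also have "\<dots> \<le> q ^ Suc m" by (rule conv_bound)
    finally show ?thesis .
  qed
  then have "cmod (1 - chi E) \<le> 0" by (intro LIMSEQ_le_const[OF q0]) auto
  then have "chi E = 1" by simp
  moreover have "chi E = 0" unfolding E_def by (rule chi_compact[OF rank_one_compact[OF uQ]])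
  ultimately show False by simp
qed

lemma point_in_sphere: "point \<in> sphere 0 1"
  using norm_point_le point_not_in_ball by simp

end

proposition maximal_ideal_space_subset:
  fixes p :: "('n::finite) cpoly"
  shows "maximal_ideal_space p \<subseteq> zero_set p \<inter> sphere 0 1"
proof
  fix z assume "z \<in> maximal_ideal_space p"
  then obtain \<phi> where \<phi>: "is_character p \<phi>"
    and z: "\<And>i. z $ i = \<phi> (calkin_class (quotient_module p) (compression (quotient_module p) (pvar i)))"
    unfolding maximal_ideal_space_def by blast
  interpret quotient_character p \<phi> by unfold_locales (rule \<phi>)
  have "z = point" by (simp add: vec_eq_iff z point_def chi_def Q_def)
  then show "z \<in> zero_set p \<inter> sphere 0 1" using point_in_zero_set point_in_sphere by simp
qed

theorem proposition4p6:
  fixes p :: "('n::finite) cpoly"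
  shows "closure (zero_set p \<inter> ball 0 1) \<inter> sphere 0 1 \<subseteq> maximal_ideal_space p
    \<and> maximal_ideal_space p \<subseteq> zero_set p \<inter> sphere 0 1"
  using zero_set_boundary_subset maximal_ideal_space_subset by blast

end
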